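(* Let $1\le\ell<n$, $1\le m\le\ell$, $\lambda\in\mathbb C^N$ with $N=\binom n2-\binom\ell2$, and let $J=\{j_1<\dots<j_q\}\subseteq[\ell+2,n]$. Write $$\pi_{m,\ell+1}\circ\Psi^q_J(\lambda)(a_{I,J})=\sum_R\Lambda^J_{R,I}\;a_{m,\ell+1}\wedge a_{R,J},$$ where $I=(i_1,\dots,i_q)$ and the sum is over all $R=(r_1,\dots,r_q)$, with $1\le i_p,r_p<j_p$ for all $p$. Then the coefficient $\Lambda^J_{R,I}\in\mathbb C$ is given by $$\Lambda^J_{R,I}=(-1)^{|R\setminus R\cap I|}\Bigl(\epsilon_{R,I}\,\lambda_{m,\ell+1}+\sum_{j\in J}\sum_K\lambda_{k,j}\Bigr),$$ where $\epsilon_{R,I}=1$ if $R=I$ and $0$ otherwise and, if $j=j_p$, the second sum is over all $I_p$-admissible sets $K=\{k_{s_1},\dots,k_{s_t},k\}$ (with last element $k=k_p$) for which $R\setminus R\cap I\subseteq K$. Here $I_p=(i_1,\dots,i_p)$.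
   Context: **Algebra.** $[a,b]=\{a,a+1,\dots,b\}$. Let $A=\mathcal E/\mathcal I$ be the Orlik-Solomon algebra of the discriminantal arrangement $\mathcal A_{n,\ell}$: $\mathcal E$ is the exterior algebra over $\mathbb C$ on $e_{i,j}$, $\ell+1\le j\le n$, $1\le i<j$, and $\mathcal I$ is generated by $e_{i,j}\wedge e_{i,k}-e_{i,j}\wedge e_{j,k}+e_{i,k}\wedge e_{j,k}$ for $1\le i<j<k\le n$ with $j\ge\ell+1$, and $e_{i,k}\wedge e_{j,k}$ for $1\le i<j\le\ell<k\le n$. Let $a_{i,j}$ be the image of $e_{i,j}$. For $J=\{j_1<\dots<j_q\}\subseteq[\ell+1,n]$ and a tuple $I=(i_1,\dots,i_q)$ with $1\le i_p<j_p$, put $a_{I,J}=a_{i_1,j_1}\wedge\cdots\wedge a_{i_q,j_q}$ (equal to $1$ if $q=0$). It is known that the $a_{I,J}$ with $|J|=q$ form a basis of $A^q$, so $A^q=\bigoplus_{|J|=q}A^q_J$ with $A^q_J=\bigoplus_I\mathbb C\,a_{I,J}$. **Maps.** Let $\omega=\sum\lambda_{i,j}a_{i,j}$ and $\mu^q(\lambda):A^q\to A^{q+1}$, $\eta\mapsto\omega\wedge\eta$. Decompose $A^q=B^q\oplus\widehat A^q$ with $B^q=\bigoplus_{\ell+1\in J}A^q_J$, $\widehat A^q=\bigoplus_{\ell+1\notin J}A^q_J$, and let $\pi_B:A^q\to B^q$ be the projection. Put $\Psi^q(\lambda)=\pi_B\circ\mu^q(\lambda):\widehat A^q\to B^{q+1}$.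 For $J\subseteq[\ell+2,n]$ with $|J|=q$, let $\Psi^q_J(\lambda)$ be its restriction to $A^q_J$; it takes values in $A^{q+1}_{\{\ell+1\}\cup J}=\bigoplus_{m=1}^\ell a_{m,\ell+1}\wedge A^q_J$. Let $\pi_{m,\ell+1}:A^{q+1}_{\{\ell+1\}\cup J}\to a_{m,\ell+1}\wedge A^q_J$ be the projection onto the $m$-th summand. **Admissible sets.** Fix $m\le\ell$ and $J=\{j_1<\dots<j_q\}\subseteq[\ell+2,n]$. For $1\le p\le q$ and $I_p=(i_1,\dots,i_p)$ with $1\le i_s<j_s$, an $I_p$-admissible set is an indexed family $K=\{k_{s_1},\dots,k_{s_t},k_{s_{t+1}}\}$ of integers ($t\ge0$), with indices $1\le s_1<\dots<s_t<s_{t+1}=p$, such that $\{k_{s_1},i_{s_1}\}=\{m,\ell+1\}$ and $\{k_{s_u},i_{s_u}\}=\{k_{s_{u-1}},j_{s_{u-1}}\}$ for $u=2,\dots,t+1$ (a vacuous condition if $t=0$). Then automatically $1\le k_{s_u}<j_{s_u}$ and $k_{s_u}\ne i_{s_u}$. **Index-set conventions.** $I$, $R$, $K$ are families indexed by position. $R\setminus R\cap I$ denotes the family of those $r_s$ with $r_s\neq i_s$, $|R\setminus R\cap I|$ is the number of such positions $s$, and $R\setminus R\cap I\subseteq K$ means that every such position $s$ is one of the indices of $K$ and $r_s=k_s$. *)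

theory Defs
  imports Complex_Main "HOL-Library.Product_Lexorder" "HOL-Library.FuncSet" "HOL-Algebra.QuotRing"
begin

section \<open>The exterior algebra on a finite ordered set\<close>

text \<open>
  For a finite linearly ordered set \<open>G\<close>, the exterior algebra over the complex numbers
  on the symbols \<open>e_g\<close> is realised on its basis of increasing monomials \<open>e_S\<close> for
  \<open>S \<subseteq> G\<close>: an element is the family of its coefficients. The sign below is the one in
  \<open>e_S \<and> e_T = ext_sign S T e_(S \<union> T)\<close> for disjoint \<open>S\<close>, \<open>T\<close> (number of inversions).
\<close>

definition ext_sign :: "'g::linorder set \<Rightarrow> 'g set \<Rightarrow> complex" where
  "ext_sign S T = (-1) ^ card {(s, t). s \<in> S \<and> t \<in> T \<and> t < s}"

definition exterior_algebra :: "'g::linorder set \<Rightarrow> ('g set \<Rightarrow> complex) ring" where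
  "exterior_algebra G =
     \<lparr>carrier = {x. \<forall>S. x S \<noteq> 0 \<longrightarrow> S \<subseteq> G},
      mult = (\<lambda>x y U. \<Sum>S\<in>Pow U. ext_sign S (U - S) * x S * y (U - S)),
      one = (\<lambda>S. if S = {} then 1 else 0),
      zero = (\<lambda>S. 0),
      add = (\<lambda>x y S. x S + y S)\<rparr>"

definition ext_basis :: "'g set \<Rightarrow> 'g set \<Rightarrow> complex" where
  "ext_basis T = (\<lambda>S. if S = T then 1 else 0)"

definition ext_gen :: "'g \<Rightarrow> 'g set \<Rightarrow> complex" where
  "ext_gen g = ext_basis {g}"

definition ext_scalar :: "complex \<Rightarrow> 'g set \<Rightarrow> complex" where
  "ext_scalar c = (\<lambda>S. if S = {} then c else 0)"

lemma ext_sign_empty [simp]: "ext_sign {} T = 1" "ext_sign S {} = 1"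
  by (simp_all add: ext_sign_def)

lemma ext_sign_Un_left:
  assumes "finite S" "finite T" "finite U" "S \<inter> T = {}"
  shows "ext_sign (S \<union> T) U = ext_sign S U * ext_sign T U"
proof -
  have eq: "{(s, t). s \<in> S \<union> T \<and> t \<in> U \<and> t < s} =
      {(s, t). s \<in> S \<and> t \<in> U \<and> t < s} \<union> {(s, t). s \<in> T \<and> t \<in> U \<and> t < s}" by auto
  have "card {(s, t). s \<in> S \<union> T \<and> t \<in> U \<and> t < s} =
      card {(s, t). s \<in> S \<and> t \<in> U \<and> t < s} + card {(s, t). s \<in> T \<and> t \<in> U \<and> t < s}"
    unfolding eq
  proof (rule card_Un_disjoint)
    show "finite {(s, t). s \<in> S \<and> t \<in> U \<and> t < s}"
      by (rule finite_subset[of _ "S \<times> U"]) (use assms in auto)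
    show "finite {(s, t). s \<in> T \<and> t \<in> U \<and> t < s}"
      by (rule finite_subset[of _ "T \<times> U"]) (use assms in auto)
  qed (use assms(4) in auto)
  then show ?thesis by (simp add: ext_sign_def power_add)
qed

lemma ext_sign_Un_right:
  assumes "finite S" "finite T" "finite U" "T \<inter> U = {}"
  shows "ext_sign S (T \<union> U) = ext_sign S T * ext_sign S U"
proof -
  have eq: "{(s, t). s \<in> S \<and> t \<in> T \<union> U \<and> t < s} =
      {(s, t). s \<in> S \<and> t \<in> T \<and> t < s} \<union> {(s, t). s \<in> S \<and> t \<in> U \<and> t < s}" by auto
  have "card {(s, t). s \<in> S \<and> t \<in> T \<union> U \<and> t < s} =
      card {(s, t). s \<in> S \<and> t \<in> T \<and> t < s} + card {(s, t). s \<in> S \<and> t \<in> U \<and> t < s}"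
    unfolding eq
  proof (rule card_Un_disjoint)
    show "finite {(s, t). s \<in> S \<and> t \<in> T \<and> t < s}"
      by (rule finite_subset[of _ "S \<times> T"]) (use assms in auto)
    show "finite {(s, t). s \<in> S \<and> t \<in> U \<and> t < s}"
      by (rule finite_subset[of _ "S \<times> U"]) (use assms in auto)
  qed (use assms(4) in auto)
  then show ?thesis by (simp add: ext_sign_def power_add)
qed

lemma ext_mult_assoc:
  fixes x y z :: "'g::linorder set \<Rightarrow> complex"
  shows "(x \<otimes>\<^bsub>exterior_algebra G\<^esub> y) \<otimes>\<^bsub>exterior_algebra G\<^esub> z =
         x \<otimes>\<^bsub>exterior_algebra G\<^esub> (y \<otimes>\<^bsub>exterior_algebra G\<^esub> z)"
proof
  fix W :: "'g set"
  let ?s = "ext_sign :: 'g set \<Rightarrow> 'g set \<Rightarrow> complex"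
  show "((x \<otimes>\<^bsub>exterior_algebra G\<^esub> y) \<otimes>\<^bsub>exterior_algebra G\<^esub> z) W =
        (x \<otimes>\<^bsub>exterior_algebra G\<^esub> (y \<otimes>\<^bsub>exterior_algebra G\<^esub> z)) W"
  proof (cases "finite W")
    case False
    then show ?thesis by (simp add: exterior_algebra_def)
  next
    case True
    have fin: "finite A" if "A \<subseteq> W" for A using that True finite_subset by blast
    have "((x \<otimes>\<^bsub>exterior_algebra G\<^esub> y) \<otimes>\<^bsub>exterior_algebra G\<^esub> z) W =
       (\<Sum>P\<in>Pow W. \<Sum>S\<in>Pow P. ?s P (W - P) * (?s S (P - S) * x S * y (P - S)) * z (W - P))"
      by (simp add: exterior_algebra_def sum_distrib_left sum_distrib_right)
    also have "\<dots> = (\<Sum>(P, S)\<in>(SIGMA P:Pow W. Pow P).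
        ?s P (W - P) * (?s S (P - S) * x S * y (P - S)) * z (W - P))"
      by (rule sum.Sigma) (use fin in auto)
    also have "\<dots> = (\<Sum>(S, T)\<in>(SIGMA S:Pow W. Pow (W - S)).
        ?s S (W - S) * x S * (?s T (W - S - T) * y T * z (W - S - T)))"
    proof (rule sum.reindex_bij_witness[where i = "\<lambda>(S, T). (S \<union> T, S)" and j = "\<lambda>(P, S). (S, P - S)"])
      fix a assume "a \<in> (SIGMA P:Pow W. Pow P)"
      then obtain P S where a: "a = (P, S)" and P: "P \<subseteq> W" and S: "S \<subseteq> P" by auto
      have 1: "?s P (W - P) = ?s S (W - P) * ?s (P - S) (W - P)"
        using ext_sign_Un_left[of S "P - S" "W - P"] P S fin
        by (metis Diff_disjoint Diff_subset Un_Diff_cancel subset_trans sup.absorb2)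
      have WS: "W - S = (P - S) \<union> (W - P)" using P S by auto
      have 2: "?s S (W - S) = ?s S (P - S) * ?s S (W - P)"
        unfolding WS by (rule ext_sign_Un_right) (use P S fin in auto)
      have 3: "W - S - (P - S) = W - P" using P S by auto
      show "(case (case a of (P, S) \<Rightarrow> (S, P - S)) of (S, T) \<Rightarrow>
          ?s S (W - S) * x S * (?s T (W - S - T) * y T * z (W - S - T))) =
        (case a of (P, S) \<Rightarrow> ?s P (W - P) * (?s S (P - S) * x S * y (P - S)) * z (W - P))"
        by (simp add: a 1 2 3)
    qed auto
    also have "\<dots> = (\<Sum>S\<in>Pow W. \<Sum>T\<in>Pow (W - S).
        ?s S (W - S) * x S * (?s T (W - S - T) * y T * z (W - S - T)))"
      by (rule sum.Sigma[symmetric]) (use fin in auto)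
    also have "\<dots> = (x \<otimes>\<^bsub>exterior_algebra G\<^esub> (y \<otimes>\<^bsub>exterior_algebra G\<^esub> z)) W"
      by (simp add: exterior_algebra_def sum_distrib_left)
    finally show ?thesis .
  qed
qed

lemma exterior_algebra_ring:
  fixes G :: "'g::linorder set"
  assumes "finite G"
  shows "ring (exterior_algebra G)"
proof (rule ringI)
  show "abelian_group (exterior_algebra G)"
  proof (rule abelian_groupI)
    fix x assume x: "x \<in> carrier (exterior_algebra G)"
    show "\<exists>y\<in>carrier (exterior_algebra G). y \<oplus>\<^bsub>exterior_algebra G\<^esub> x = \<zero>\<^bsub>exterior_algebra G\<^esub>"
      by (rule bexI[of _ "\<lambda>S. - x S"]) (use x in \<open>auto simp: exterior_algebra_def\<close>)
  qed (auto simp: exterior_algebra_def fun_eq_iff, metis add.right_neutral subsetD)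
  show "monoid (exterior_algebra G)"
  proof (rule monoidI)
    fix x y assume x: "x \<in> carrier (exterior_algebra G)" and y: "y \<in> carrier (exterior_algebra G)"
    have "U \<subseteq> G" if "(x \<otimes>\<^bsub>exterior_algebra G\<^esub> y) U \<noteq> 0" for U
    proof -
      from that have "(\<Sum>S\<in>Pow U. ext_sign S (U - S) * x S * y (U - S)) \<noteq> 0"
        by (simp add: exterior_algebra_def)
      then obtain S where "S \<subseteq> U" "ext_sign S (U - S) * x S * y (U - S) \<noteq> 0"
        by (meson PowD sum.not_neutral_contains_not_neutral)
      then have "S \<subseteq> G" "U - S \<subseteq> G" using x y by (auto simp: exterior_algebra_def)
      then show ?thesis by auto
    qed
    then show "x \<otimes>\<^bsub>exterior_algebra G\<^esub> y \<in> carrier (exterior_algebra G)"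
      by (auto simp: exterior_algebra_def)
  next
    fix x assume x: "x \<in> carrier (exterior_algebra G)"
    have supp: "x U = 0" if "infinite U" for U
      using x that assms by (auto simp: exterior_algebra_def dest: finite_subset)
    show "\<one>\<^bsub>exterior_algebra G\<^esub> \<otimes>\<^bsub>exterior_algebra G\<^esub> x = x"
    proof
      fix U
      have "(\<Sum>S\<in>Pow U. ext_sign S (U - S) * (if S = {} then 1 else 0) * x (U - S)) =
            (\<Sum>S\<in>Pow U. if S = {} then x U else 0)"
        by (rule sum.cong) auto
      then show "(\<one>\<^bsub>exterior_algebra G\<^esub> \<otimes>\<^bsub>exterior_algebra G\<^esub> x) U = x U"
        by (cases "finite U") (simp_all add: exterior_algebra_def supp)
    qed
    show "x \<otimes>\<^bsub>exterior_algebra G\<^esub> \<one>\<^bsub>exterior_algebra G\<^esub> = x"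
    proof
      fix U
      have "(\<Sum>S\<in>Pow U. ext_sign S (U - S) * x S * (if U - S = {} then 1 else 0)) =
            (\<Sum>S\<in>Pow U. if S = U then x U else 0)"
        by (rule sum.cong) auto
      then show "(x \<otimes>\<^bsub>exterior_algebra G\<^esub> \<one>\<^bsub>exterior_algebra G\<^esub>) U = x U"
        by (cases "finite U") (simp_all add: exterior_algebra_def supp)
    qed
  qed (use ext_mult_assoc in \<open>auto simp: exterior_algebra_def\<close>)
qed (auto simp: exterior_algebra_def fun_eq_iff distrib_left distrib_right sum.distrib)

lemma ext_basis_mult:
  assumes "finite S" "finite T"
  shows "ext_basis S \<otimes>\<^bsub>exterior_algebra G\<^esub> ext_basis T =
    (\<lambda>U. if S \<inter> T = {} then ext_sign S T * ext_basis (S \<union> T) U else 0)"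
proof
  fix U
  show "(ext_basis S \<otimes>\<^bsub>exterior_algebra G\<^esub> ext_basis T) U =
    (if S \<inter> T = {} then ext_sign S T * ext_basis (S \<union> T) U else 0)"
  proof (cases "finite U")
    case True
    have "(ext_basis S \<otimes>\<^bsub>exterior_algebra G\<^esub> ext_basis T) U =
        (\<Sum>P\<in>Pow U. if P = S then ext_sign S (U - S) * ext_basis T (U - S) else 0)"
      unfolding exterior_algebra_def by (simp, rule sum.cong) (auto simp: ext_basis_def)
    also have "\<dots> = (if S \<subseteq> U then ext_sign S (U - S) * ext_basis T (U - S) else 0)"
      using True by (simp add: sum.delta)
    also have "\<dots> = (if S \<inter> T = {} then ext_sign S T * ext_basis (S \<union> T) U else 0)"
    proof (cases "S \<subseteq> U \<and> U - S = T")
      case True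
      then show ?thesis by (auto simp: ext_basis_def)
    next
      case False
      then have "S \<inter> T = {} \<Longrightarrow> U \<noteq> S \<union> T" by auto
      with False show ?thesis by (auto simp: ext_basis_def)
    qed
    finally show ?thesis .
  next
    case False
    then have "U \<noteq> S \<union> T" using assms by auto
    with False show ?thesis by (auto simp: exterior_algebra_def ext_basis_def)
  qed
qed

lemma ext_gen_square: "ext_gen g \<otimes>\<^bsub>exterior_algebra G\<^esub> ext_gen g = \<zero>\<^bsub>exterior_algebra G\<^esub>"
  by (simp add: ext_gen_def ext_basis_mult) (simp add: exterior_algebra_def)

lemma ext_gen_anticommute:
  "(ext_gen g \<otimes>\<^bsub>exterior_algebra G\<^esub> ext_gen h) \<oplus>\<^bsub>exterior_algebra G\<^esub>
   (ext_gen h \<otimes>\<^bsub>exterior_algebra G\<^esub> ext_gen g) = \<zero>\<^bsub>exterior_algebra G\<^esub>"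
proof -
  have "{(s, t). s = a \<and> t = b \<and> t < s} = (if b < a then {(a, b)} else {})" for a b :: 'a
    by auto
  then have "ext_sign {a} {b} = (if b < a then -1 else 1)" for a b :: 'a
    by (simp add: ext_sign_def)
  then have "\<And>U. (ext_gen g \<otimes>\<^bsub>exterior_algebra G\<^esub> ext_gen h) U +
      (ext_gen h \<otimes>\<^bsub>exterior_algebra G\<^esub> ext_gen g) U = 0"
    by (auto simp: ext_gen_def ext_basis_mult insert_commute)
  then show ?thesis by (simp add: exterior_algebra_def)
qed

lemma ext_gen_increasing:
  assumes "finite T" "\<And>t. t \<in> T \<Longrightarrow> g < t"
  shows "ext_gen g \<otimes>\<^bsub>exterior_algebra G\<^esub> ext_basis T = ext_basis (insert g T)"
proof -
  have "{(s, t). s \<in> {g} \<and> t \<in> T \<and> t < s} = {}" using assms(2) by fastforce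
  then have "ext_sign {g} T = 1" unfolding ext_sign_def by (simp only: card.empty power_0)
  moreover have "g \<notin> T" using assms(2) by auto
  ultimately show ?thesis by (simp add: ext_gen_def ext_basis_mult assms(1) fun_eq_iff)
qed


section \<open>The Orlik-Solomon algebra of the discriminantal arrangement\<close>

definition disc_gens :: "nat \<Rightarrow> nat \<Rightarrow> (nat \<times> nat) set" where
  "disc_gens n l = {(i, j). l + 1 \<le> j \<and> j \<le> n \<and> 1 \<le> i \<and> i < j}"

definition disc_ext :: "nat \<Rightarrow> nat \<Rightarrow> ((nat \<times> nat) set \<Rightarrow> complex) ring" where
  "disc_ext n l = exterior_algebra (disc_gens n l)"

definition os_relations :: "nat \<Rightarrow> nat \<Rightarrow> ((nat \<times> nat) set \<Rightarrow> complex) set" where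
  "os_relations n l =
     {ext_gen (i, j) \<otimes>\<^bsub>disc_ext n l\<^esub> ext_gen (i, k)
        \<ominus>\<^bsub>disc_ext n l\<^esub> ext_gen (i, j) \<otimes>\<^bsub>disc_ext n l\<^esub> ext_gen (j, k)
        \<oplus>\<^bsub>disc_ext n l\<^esub> ext_gen (i, k) \<otimes>\<^bsub>disc_ext n l\<^esub> ext_gen (j, k)
      | i j k. 1 \<le> i \<and> i < j \<and> j < k \<and> k \<le> n \<and> l + 1 \<le> j}
   \<union> {ext_gen (i, k) \<otimes>\<^bsub>disc_ext n l\<^esub> ext_gen (j, k)
      | i j k. 1 \<le> i \<and> i < j \<and> j \<le> l \<and> l < k \<and> k \<le> n}"

definition os_ideal :: "nat \<Rightarrow> nat \<Rightarrow> ((nat \<times> nat) set \<Rightarrow> complex) set" where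
  "os_ideal n l = Idl\<^bsub>disc_ext n l\<^esub> (os_relations n l)"

definition os_alg :: "nat \<Rightarrow> nat \<Rightarrow> ((nat \<times> nat) set \<Rightarrow> complex) set ring" where
  "os_alg n l = disc_ext n l Quot os_ideal n l"

definition os_class :: "nat \<Rightarrow> nat \<Rightarrow> ((nat \<times> nat) set \<Rightarrow> complex) \<Rightarrow> ((nat \<times> nat) set \<Rightarrow> complex) set" where
  "os_class n l x = os_ideal n l +>\<^bsub>disc_ext n l\<^esub> x"

definition os_gen :: "nat \<Rightarrow> nat \<Rightarrow> nat \<Rightarrow> nat \<Rightarrow> ((nat \<times> nat) set \<Rightarrow> complex) set" where
  "os_gen n l i j = os_class n l (ext_gen (i, j))"

definition os_smult ::
  "nat \<Rightarrow> nat \<Rightarrow> complex \<Rightarrow> ((nat \<times> nat) set \<Rightarrow> complex) set \<Rightarrow> ((nat \<times> nat) set \<Rightarrow> complex) set" where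
  "os_smult n l c x = os_class n l (ext_scalar c) \<otimes>\<^bsub>os_alg n l\<^esub> x"

definition os_deg :: "nat \<Rightarrow> nat \<Rightarrow> nat \<Rightarrow> ((nat \<times> nat) set \<Rightarrow> complex) set set" where
  "os_deg n l q = os_class n l ` {x \<in> carrier (disc_ext n l). \<forall>S. x S \<noteq> 0 \<longrightarrow> card S = q}"

lemma finite_disc_gens: "finite (disc_gens n l)"
  by (rule finite_subset[of _ "{..n} \<times> {..n}"]) (auto simp: disc_gens_def)

lemma disc_ext_ring: "ring (disc_ext n l)"
  unfolding disc_ext_def by (rule exterior_algebra_ring[OF finite_disc_gens])

lemma ext_gen_carrier: "g \<in> disc_gens n l \<Longrightarrow> ext_gen g \<in> carrier (disc_ext n l)"
  by (auto simp: disc_ext_def exterior_algebra_def ext_gen_def ext_basis_def split: if_splits)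

lemma os_relations_carrier: "os_relations n l \<subseteq> carrier (disc_ext n l)"
proof -
  interpret ring "disc_ext n l" by (rule disc_ext_ring)
  show ?thesis
    unfolding os_relations_def
    by (auto intro!: a_closed minus_closed m_closed ext_gen_carrier simp: disc_gens_def)
qed

lemma os_ideal_ideal: "ideal (os_ideal n l) (disc_ext n l)"
  unfolding os_ideal_def
  by (rule ring.genideal_ideal[OF disc_ext_ring os_relations_carrier])

lemma os_alg_ring: "ring (os_alg n l)"
  unfolding os_alg_def by (rule ideal.quotient_is_ring[OF os_ideal_ideal])


section \<open>Monomials and direct summands\<close>

text \<open>
  A subset \<open>J = {j_1 < \<dots> < j_q}\<close> has \<open>jth J p = j_p\<close> for \<open>1 \<le> p \<le> q\<close>. Index tuples
  \<open>I = (i_1, \<dots>, i_q)\<close> are extensional functions on the positions \<open>1, \<dots>, q\<close>.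
\<close>

definition jth :: "nat set \<Rightarrow> nat \<Rightarrow> nat" where
  "jth J p = sorted_list_of_set J ! (p - 1)"

definition tuples :: "nat set \<Rightarrow> (nat \<Rightarrow> nat) set" where
  "tuples J = (\<Pi>\<^sub>E p\<in>{1..card J}. {1..<jth J p})"

definition os_mono :: "nat \<Rightarrow> nat \<Rightarrow> (nat \<Rightarrow> nat) \<Rightarrow> nat set \<Rightarrow> ((nat \<times> nat) set \<Rightarrow> complex) set" where
  "os_mono n l I J =
     foldr (\<lambda>p x. os_gen n l (I p) (jth J p) \<otimes>\<^bsub>os_alg n l\<^esub> x) [1..<Suc (card J)] \<one>\<^bsub>os_alg n l\<^esub>"

definition A_J :: "nat \<Rightarrow> nat \<Rightarrow> nat set \<Rightarrow> ((nat \<times> nat) set \<Rightarrow> complex) set set" where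
  "A_J n l J =
     {\<Oplus>\<^bsub>os_alg n l\<^esub>I\<in>tuples J. os_smult n l (c I) (os_mono n l I J) | c. True}"

text \<open>The sum of a finite family of additive subgroups, and the projection onto \<open>U\<close> along \<open>W\<close>
  (meaningful on \<open>U + W\<close> when this sum is direct).\<close>

definition subspace_sum :: "('a, 'b) ring_scheme \<Rightarrow> 'i set \<Rightarrow> ('i \<Rightarrow> 'a set) \<Rightarrow> 'a set" where
  "subspace_sum R M V = {finsum R f M | f. f \<in> (\<Pi> i\<in>M. V i)}"

definition proj_along :: "('a, 'b) ring_scheme \<Rightarrow> 'a set \<Rightarrow> 'a set \<Rightarrow> 'a \<Rightarrow> 'a" where
  "proj_along R U W x = (THE u. u \<in> U \<and> (\<exists>w\<in>W. x = u \<oplus>\<^bsub>R\<^esub> w))"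

definition B_deg :: "nat \<Rightarrow> nat \<Rightarrow> nat \<Rightarrow> ((nat \<times> nat) set \<Rightarrow> complex) set set" where
  "B_deg n l q =
     subspace_sum (os_alg n l) {J. J \<subseteq> {l + 1..n} \<and> card J = q \<and> l + 1 \<in> J} (A_J n l)"

definition Ahat_deg :: "nat \<Rightarrow> nat \<Rightarrow> nat \<Rightarrow> ((nat \<times> nat) set \<Rightarrow> complex) set set" where
  "Ahat_deg n l q =
     subspace_sum (os_alg n l) {J. J \<subseteq> {l + 1..n} \<and> card J = q \<and> l + 1 \<notin> J} (A_J n l)"

definition pi_B ::
  "nat \<Rightarrow> nat \<Rightarrow> nat \<Rightarrow> ((nat \<times> nat) set \<Rightarrow> complex) set \<Rightarrow> ((nat \<times> nat) set \<Rightarrow> complex) set" where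
  "pi_B n l q = proj_along (os_alg n l) (B_deg n l q) (Ahat_deg n l q)"


section \<open>The maps\<close>

text \<open>Only the values of \<open>lam\<close> on \<^term>\<open>disc_gens n l\<close> enter, i.e. a vector of weights in
  \<open>\<complex>\<^sup>N\<close> with \<open>N = (n choose 2) - (l choose 2)\<close>.\<close>

definition os_omega :: "nat \<Rightarrow> nat \<Rightarrow> (nat \<Rightarrow> nat \<Rightarrow> complex) \<Rightarrow> ((nat \<times> nat) set \<Rightarrow> complex) set" where
  "os_omega n l lam =
     (\<Oplus>\<^bsub>os_alg n l\<^esub>g\<in>disc_gens n l. os_smult n l (lam (fst g) (snd g)) (os_gen n l (fst g) (snd g)))"

definition os_mu ::
  "nat \<Rightarrow> nat \<Rightarrow> nat \<Rightarrow> (nat \<Rightarrow> nat \<Rightarrow> complex) \<Rightarrow>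
   ((nat \<times> nat) set \<Rightarrow> complex) set \<Rightarrow> ((nat \<times> nat) set \<Rightarrow> complex) set" where
  "os_mu n l q lam = (\<lambda>\<eta>\<in>os_deg n l q. os_omega n l lam \<otimes>\<^bsub>os_alg n l\<^esub> \<eta>)"

definition Psi ::
  "nat \<Rightarrow> nat \<Rightarrow> nat \<Rightarrow> (nat \<Rightarrow> nat \<Rightarrow> complex) \<Rightarrow>
   ((nat \<times> nat) set \<Rightarrow> complex) set \<Rightarrow> ((nat \<times> nat) set \<Rightarrow> complex) set" where
  "Psi n l q lam = (\<lambda>\<eta>\<in>Ahat_deg n l q. pi_B n l (q + 1) (os_mu n l q lam \<eta>))"

definition Psi_J ::
  "nat \<Rightarrow> nat \<Rightarrow> nat set \<Rightarrow> (nat \<Rightarrow> nat \<Rightarrow> complex) \<Rightarrow>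
   ((nat \<times> nat) set \<Rightarrow> complex) set \<Rightarrow> ((nat \<times> nat) set \<Rightarrow> complex) set" where
  "Psi_J n l J lam = restrict (Psi n l (card J) lam) (A_J n l J)"

definition summand :: "nat \<Rightarrow> nat \<Rightarrow> nat set \<Rightarrow> nat \<Rightarrow> ((nat \<times> nat) set \<Rightarrow> complex) set set" where
  "summand n l J m = (\<lambda>\<eta>. os_gen n l m (l + 1) \<otimes>\<^bsub>os_alg n l\<^esub> \<eta>) ` A_J n l J"

definition pi_m ::
  "nat \<Rightarrow> nat \<Rightarrow> nat set \<Rightarrow> nat \<Rightarrow>
   ((nat \<times> nat) set \<Rightarrow> complex) set \<Rightarrow> ((nat \<times> nat) set \<Rightarrow> complex) set" where
  "pi_m n l J m =
     proj_along (os_alg n l) (summand n l J m) (subspace_sum (os_alg n l) ({1..l} - {m}) (summand n l J))"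


section \<open>Admissible sets\<close>

text \<open>
  An indexed family \<open>{k_(s_1), \<dots>, k_(s_(t+1))}\<close> is a partial map \<open>K\<close> whose domain is the index set
  \<open>{s_1 < \<dots> < s_(t+1)}\<close>; the list \<open>ss\<close> enumerates it increasingly. Only \<open>I 1, \<dots>, I p\<close> are
  inspected, so \<open>I\<close> may be longer than the truncation \<open>I_p\<close>.
\<close>

definition admissible ::
  "nat \<Rightarrow> nat \<Rightarrow> nat set \<Rightarrow> (nat \<Rightarrow> nat) \<Rightarrow> nat \<Rightarrow> (nat \<rightharpoonup> nat) \<Rightarrow> bool" where
  "admissible l m J I p K \<longleftrightarrow>
     (\<exists>ss. ss \<noteq> [] \<and> sorted_wrt (<) ss \<and> 1 \<le> hd ss \<and> last ss = p \<and> dom K = set ss \<and>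
        {the (K (hd ss)), I (hd ss)} = {m, l + 1} \<and>
        (\<forall>u. 1 \<le> u \<and> u < length ss \<longrightarrow>
           {the (K (ss ! u)), I (ss ! u)} = {the (K (ss ! (u - 1))), jth J (ss ! (u - 1))}))"

definition diff_positions :: "nat set \<Rightarrow> (nat \<Rightarrow> nat) \<Rightarrow> (nat \<Rightarrow> nat) \<Rightarrow> nat set" where
  "diff_positions J R I = {s \<in> {1..card J}. R s \<noteq> I s}"

text \<open>\<open>R \ (R \<inter> I) \<subseteq> K\<close>, read as an inclusion of indexed families.\<close>

definition diff_subfamily :: "nat set \<Rightarrow> (nat \<Rightarrow> nat) \<Rightarrow> (nat \<Rightarrow> nat) \<Rightarrow> (nat \<rightharpoonup> nat) \<Rightarrow> bool" where
  "diff_subfamily J R I K \<longleftrightarrow> (\<forall>s\<in>diff_positions J R I. K s = Some (R s))"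

text \<open>In the formula for the coefficients the sum over \<open>j \<in> J\<close> runs over the position \<open>p\<close> of
  \<open>j = j_p\<close>; the last element of an \<open>I_p\<close>-admissible \<open>K\<close> is \<open>the (K p)\<close>. The sum over \<open>K\<close> is
  over a finite set, because the entries of an admissible family are bounded:\<close>

lemma finite_admissible: "finite {K. admissible l m J I p K}"
proof -
  define N where "N = m + l + 1 + (\<Sum>s\<le>p. jth J s)"
  have bound: "dom K \<subseteq> {..p} \<and> ran K \<subseteq> {..N}" if "admissible l m J I p K" for K
  proof -
    from that obtain ss where ss: "ss \<noteq> []" "sorted_wrt (<) ss" "last ss = p" "dom K = set ss"
      and h: "{the (K (hd ss)), I (hd ss)} = {m, l + 1}"
      and st: "\<forall>u. 1 \<le> u \<and> u < length ss \<longrightarrow>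
           {the (K (ss ! u)), I (ss ! u)} = {the (K (ss ! (u - 1))), jth J (ss ! (u - 1))}"
      unfolding admissible_def by blast
    have le: "ss ! u \<le> p" if "u < length ss" for u
    proof (cases "u = length ss - 1")
      case True
      then show ?thesis using ss(1,3) by (simp add: last_conv_nth)
    next
      case False
      then have "ss ! u < ss ! (length ss - 1)"
        using that by (intro sorted_wrt_nth_less[OF ss(2)]) auto
      then show ?thesis using ss(1,3) by (simp add: last_conv_nth)
    qed
    have jb: "jth J s \<le> N" if "s \<le> p" for s
    proof -
      have "jth J s \<le> (\<Sum>s\<le>p. jth J s)" by (rule member_le_sum) (use that in auto)
      then show ?thesis by (simp add: N_def)
    qed
    have kb: "the (K (ss ! u)) \<le> N" if "u < length ss" for u
      using that
    proof (induction u)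
      case 0
      have "the (K (ss ! 0)) \<in> {m, l + 1}" using h ss(1) by (auto simp: hd_conv_nth)
      then show ?case by (auto simp: N_def)
    next
      case (Suc u)
      then have "the (K (ss ! Suc u)) \<in> {the (K (ss ! u)), jth J (ss ! u)}" using st by force
      with Suc jb[OF le[of u]] show ?case by auto
    qed
    have "dom K \<subseteq> {..p}" using ss(4) le by (auto simp: in_set_conv_nth)
    moreover have "ran K \<subseteq> {..N}"
    proof
      fix v assume "v \<in> ran K"
      then obtain s where s: "K s = Some v" by (auto simp: ran_def)
      then obtain u where "u < length ss" "s = ss ! u" using ss(4) by (metis domI in_set_conv_nth)
      then show "v \<in> {..N}" using kb[of u] s by simp
    qed
    ultimately show ?thesis by blast
  qed
  have "finite (\<Union>D\<in>Pow {..p}. {K. dom K = D \<and> ran K \<subseteq> {..N}})"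
    by (intro finite_UN_I finite_set_of_finite_maps) (auto intro: finite_subset[of _ "{..p}"])
  then show ?thesis by (rule rev_finite_subset) (use bound in auto)
qed

end

theory Submission
  imports Defs "HOL-Library.Function_Algebras"
begin

text \<open>
  Read a basis monomial \<open>a_{I,J}\<close> as a forest with an edge from \<open>j_p\<close> to its parent
  \<open>i_p < j_p\<close> for every \<open>p\<close>. By the defining relations, multiplying a forest by an
  edge \<open>(k, j)\<close> whose end \<open>j\<close> already has the parent \<open>i \<noteq> k\<close> equals the edge \<open>{i, k}\<close>
  (or \<open>0\<close> if \<open>i, k \<le> l\<close>) times the difference of the forest and the forest with the
  parent of \<open>j\<close> replaced by \<open>k\<close>. As \<open>max i k < j\<close>, iterating terminates; the successive
  pairs \<open>{k, i}\<close> are the ones that occur in the admissible families, and the two terms of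
  the difference account for the choice of \<open>R\<close> and for the sign.

  For linear independence, every forest \<open>f\<close> gives a functional dual to the basis. Send \<open>e_{i,j}\<close> to
  the generator indexed by the smallest edge label on the path from \<open>i\<close> to \<open>j\<close> in \<open>f\<close>, and to
  \<open>0\<close> if there is no path. Among the labels of the three edges of a triangle two agree
  (ultrametricity), so this homomorphism of exterior algebras kills the relations; its top
  coefficient is \<open>1\<close> on \<open>f\<close> and vanishes on all other forests.
\<close>

section \<open>Exterior algebras\<close>

definition ext_times :: "('g::linorder set \<Rightarrow> complex) \<Rightarrow> ('g set \<Rightarrow> complex) \<Rightarrow> 'g set \<Rightarrow> complex"
    (infixl "\<odot>" 70) where
  "x \<odot> y = (\<lambda>U. \<Sum>S\<in>Pow U. ext_sign S (U - S) * x S * y (U - S))"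

definition ext_scale :: "complex \<Rightarrow> ('g set \<Rightarrow> complex) \<Rightarrow> 'g set \<Rightarrow> complex" (infixr "\<bullet>" 75) where
  "c \<bullet> x = (\<lambda>S. c * x S)"

lemma sum_fun_apply: "(\<Sum>i\<in>M. f i) x = (\<Sum>i\<in>M. f i x)"
  by (induction M rule: infinite_finite_induct) auto

text \<open>Apart from the carrier, nothing in the ring depends on \<open>G\<close>. Calculations
  can thus be made with plain functions, using the pointwise \<open>+\<close>, \<open>-\<close> and
  \<open>0\<close>.\<close>

lemma ext_algebra_simps:
  "x \<otimes>\<^bsub>exterior_algebra G\<^esub> y = x \<odot> y"
  "x \<oplus>\<^bsub>exterior_algebra G\<^esub> y = x + y"
  "\<zero>\<^bsub>exterior_algebra G\<^esub> = 0"
  "\<one>\<^bsub>exterior_algebra G\<^esub> = ext_basis {}"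
  by (auto simp: exterior_algebra_def ext_times_def ext_basis_def fun_eq_iff)

lemma ext_times_assoc: "(x \<odot> y) \<odot> z = x \<odot> (y \<odot> z)"
  using ext_mult_assoc[of UNIV x y z] by (simp add: ext_algebra_simps)

lemma ext_times_distrib:
  "(x + y) \<odot> z = x \<odot> z + y \<odot> z" "x \<odot> (y + z) = x \<odot> y + x \<odot> z"
  "(x - y) \<odot> z = x \<odot> z - y \<odot> z" "x \<odot> (y - z) = x \<odot> y - x \<odot> z"
  "(c \<bullet> x) \<odot> y = c \<bullet> (x \<odot> y)" "x \<odot> (c \<bullet> y) = c \<bullet> (x \<odot> y)"
  by (auto simp: ext_times_def ext_scale_def fun_eq_iff algebra_simps sum.distrib
      sum_subtractf sum_distrib_left)

lemma ext_times_zero [simp]: "0 \<odot> x = 0" "x \<odot> 0 = 0"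
  by (auto simp: ext_times_def fun_eq_iff)

lemma ext_times_sum_left: "(\<Sum>i\<in>M. f i) \<odot> x = (\<Sum>i\<in>M. f i \<odot> x)"
  by (induction M rule: infinite_finite_induct)
    (simp_all only: sum.infinite sum.empty sum.insert ext_times_zero ext_times_distrib not_False_eq_True)

lemma ext_times_sum_right: "x \<odot> (\<Sum>i\<in>M. f i) = (\<Sum>i\<in>M. x \<odot> f i)"
  by (induction M rule: infinite_finite_induct)
    (simp_all only: sum.infinite sum.empty sum.insert ext_times_zero ext_times_distrib not_False_eq_True)

lemma ext_scale_simps:
  "0 \<bullet> x = 0" "1 \<bullet> x = x" "c \<bullet> 0 = 0" "c \<bullet> d \<bullet> x = (c * d) \<bullet> x" "(-1) \<bullet> x = - x"
  by (auto simp: ext_scale_def fun_eq_iff)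

lemma ext_scale_distrib:
  "c \<bullet> (x + y) = c \<bullet> x + c \<bullet> y" "(c + d) \<bullet> x = c \<bullet> x + d \<bullet> x"
  "c \<bullet> (x - y) = c \<bullet> x - c \<bullet> y" "(c - d) \<bullet> x = c \<bullet> x - d \<bullet> x"
  by (auto simp: ext_scale_def fun_eq_iff algebra_simps)

lemma ext_scale_sum: "c \<bullet> (\<Sum>i\<in>M. f i) = (\<Sum>i\<in>M. c \<bullet> f i)"
  by (induction M rule: infinite_finite_induct) 
    (simp_all only: sum.infinite sum.empty sum.insert ext_scale_simps ext_scale_distrib not_False_eq_True)

lemma ext_gen_times_self: "ext_gen g \<odot> ext_gen g = 0"
  using ext_gen_square[of UNIV g] by (simp add: ext_algebra_simps)

lemma ext_gen_times_commute: "ext_gen g \<odot> ext_gen h = - (ext_gen h \<odot> ext_gen g)"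
  using ext_gen_anticommute[of UNIV g h] by (simp add: ext_algebra_simps eq_neg_iff_add_eq_0)

lemma ext_gen_times_eq_0:
  assumes "(ext_gen g \<odot> x) T \<noteq> 0"
  shows "g \<in> T \<and> x (T - {g}) \<noteq> 0"
proof -
  from assms obtain S where "S \<subseteq> T" "ext_gen g S \<noteq> 0" "x (T - S) \<noteq> 0"
    unfolding ext_times_def by (metis (no_types, lifting) PowD mult_eq_0_iff sum.not_neutral_contains_not_neutral)
  then show ?thesis by (auto simp: ext_gen_def ext_basis_def split: if_splits)
qed

text \<open>For \<nu> injective on \<open>S\<close>, this is the sign of the permutation that sorts
  the images of the increasingly listed elements of \<open>S\<close>.\<close>

definition inv_sign :: "('g::linorder \<Rightarrow> 'h::linorder) \<Rightarrow> 'g set \<Rightarrow> complex" where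
  "inv_sign \<nu> S = (-1) ^ card {(s, t). s \<in> S \<and> t \<in> S \<and> s < t \<and> \<nu> t < \<nu> s}"

lemma inv_sign_simps [simp]: "inv_sign \<nu> {} = 1" "inv_sign \<nu> {g} = 1"
proof -
  have "{(s, t). s \<in> {g} \<and> t \<in> {g} \<and> s < t \<and> \<nu> t < \<nu> s} = {}" by auto
  then show "inv_sign \<nu> {g} = 1" unfolding inv_sign_def by (simp only: card.empty power_0)
qed (simp add: inv_sign_def)

lemma inv_sign_Un:
  assumes "finite S" "finite T" "S \<inter> T = {}" and inj: "inj_on \<nu> (S \<union> T)"
  shows "inv_sign \<nu> (S \<union> T) * ext_sign S T = inv_sign \<nu> S * inv_sign \<nu> T * ext_sign (\<nu> ` S) (\<nu> ` T)"
proof -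
  define D where "D = (\<lambda>S. {(s, t). s \<in> S \<and> t \<in> S \<and> s < t \<and> \<nu> t < \<nu> s})"
  \<comment> \<open>The pairs that are out of order between \<open>S\<close> and \<open>T\<close>
    are those that \<nu> puts in order (\<open>A1\<close>) and those that it leaves out of order
    (\<open>A2\<close>); \<open>C\<close> holds the pairs that \<nu> puts out of order. Source signs
    see \<open>A1\<close> and \<open>A2\<close>, image signs \<open>A2\<close> and \<open>C\<close>,
    and the inversions of the union see \<open>C\<close> and \<open>A1\<close>, so \<open>A1\<close>
    is counted twice.\<close>
  define A1 where "A1 = {(s, t). s \<in> S \<and> t \<in> T \<and> t < s \<and> \<nu> s < \<nu> t}"
  define A2 where "A2 = {(s, t). s \<in> S \<and> t \<in> T \<and> t < s \<and> \<nu> t < \<nu> s}"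
  define C where "C = {(s, t). s \<in> S \<and> t \<in> T \<and> s < t \<and> \<nu> t < \<nu> s}"
  have ne: "\<nu> s \<noteq> \<nu> t" "s \<noteq> t" if "s \<in> S" "t \<in> T" for s t
    using that assms(3) inj by (auto simp: inj_on_def)
  have fin: "finite X" if "X \<subseteq> (S \<union> T) \<times> (S \<union> T)" for X
    by (rule finite_subset[OF that]) (use assms in auto)
  have finD: "finite (D S)" "finite (D T)" and finA: "finite A1" "finite A2" "finite C"
    by (rule fin; auto simp: D_def A1_def A2_def C_def)+
  \<comment> \<open>In \<open>A1\<close> the element of \<open>T\<close> is the smaller one, whereas
    \<open>D\<close> lists the smaller element first.\<close>
  have swap: "card (prod.swap ` A1) = card A1"
    by (rule card_image) (auto simp: inj_on_def)
  have "D (S \<union> T) = (D S \<union> D T) \<union> (C \<union> prod.swap ` A1)"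
    by (auto simp: D_def A1_def C_def)
  then have "card (D (S \<union> T)) = card ((D S \<union> D T) \<union> (C \<union> prod.swap ` A1))" by simp
  also have "\<dots> = card (D S \<union> D T) + card (C \<union> prod.swap ` A1)"
    by (rule card_Un_disjoint) (use assms(3) finD finA in \<open>auto simp: D_def A1_def C_def\<close>)
  also have "card (D S \<union> D T) = card (D S) + card (D T)"
    by (rule card_Un_disjoint) (use assms(3) finD in \<open>auto simp: D_def\<close>)
  also have "card (C \<union> prod.swap ` A1) = card C + card A1"
    unfolding swap[symmetric]
    by (rule card_Un_disjoint) (use assms(3) finA in \<open>auto simp: A1_def C_def\<close>)
  finally have 1: "card (D (S \<union> T)) = card (D S) + card (D T) + (card C + card A1)" .
  have "{(s, t). s \<in> S \<and> t \<in> T \<and> t < s} = A1 \<union> A2"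
    using ne by (auto simp: A1_def A2_def) fastforce
  then have "card {(s, t). s \<in> S \<and> t \<in> T \<and> t < s} = card (A1 \<union> A2)" by simp
  also have "\<dots> = card A1 + card A2"
    by (rule card_Un_disjoint) (use finA in \<open>auto simp: A1_def A2_def\<close>)
  finally have 2: "card {(s, t). s \<in> S \<and> t \<in> T \<and> t < s} = card A1 + card A2" .
  have "{(s, t). s \<in> \<nu> ` S \<and> t \<in> \<nu> ` T \<and> t < s} = map_prod \<nu> \<nu> ` (A2 \<union> C)"
  proof
    show "{(s, t). s \<in> \<nu> ` S \<and> t \<in> \<nu> ` T \<and> t < s} \<subseteq> map_prod \<nu> \<nu> ` (A2 \<union> C)"
    proof clarify
      fix s t assume "s \<in> S" "t \<in> T" "\<nu> t < \<nu> s"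
      then have "(s, t) \<in> A2 \<union> C" using ne[of s t] by (auto simp: A2_def C_def)
      then show "(\<nu> s, \<nu> t) \<in> map_prod \<nu> \<nu> ` (A2 \<union> C)" by force
    qed
  qed (auto simp: A2_def C_def)
  moreover have "inj_on (map_prod \<nu> \<nu>) (A2 \<union> C)"
    using inj by (auto simp: A2_def C_def inj_on_def)
  ultimately have "card {(s, t). s \<in> \<nu> ` S \<and> t \<in> \<nu> ` T \<and> t < s} = card (A2 \<union> C)"
    by (simp add: card_image)
  also have "\<dots> = card A2 + card C"
    by (rule card_Un_disjoint) (use finA in \<open>auto simp: A2_def C_def\<close>)
  finally have 3: "card {(s, t). s \<in> \<nu> ` S \<and> t \<in> \<nu> ` T \<and> t < s} = card A2 + card C" .
  have "inv_sign \<nu> (S \<union> T) * ext_sign S T = (-1) ^ (card (D (S \<union> T)) + (card A1 + card A2))"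
    by (simp add: inv_sign_def ext_sign_def D_def 2 power_add)
  also have "\<dots> = (-1) ^ (card (D S) + card (D T) + (card A2 + card C))"
    by (simp add: 1 power_add)
  also have "\<dots> = inv_sign \<nu> S * inv_sign \<nu> T * ext_sign (\<nu> ` S) (\<nu> ` T)"
    by (simp add: inv_sign_def ext_sign_def D_def 3 power_add)
  finally show ?thesis .
qed

text \<open>The algebra homomorphism sending a generator \<open>g\<close> to the generator \<open>\<nu> g\<close>, or to \<open>0\<close> if
  \<open>\<nu> g = 0\<close>.\<close>

definition ext_push :: "'g::linorder set \<Rightarrow> ('g \<Rightarrow> nat) \<Rightarrow> ('g set \<Rightarrow> complex) \<Rightarrow> nat set \<Rightarrow> complex" where
  "ext_push G \<nu> x = (\<lambda>T. if 0 \<in> T then 0 else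
     \<Sum>S | S \<subseteq> G \<and> inj_on \<nu> S \<and> \<nu> ` S = T. inv_sign \<nu> S * x S)"

lemma ext_push_linear:
  "ext_push G \<nu> (x + y) = ext_push G \<nu> x + ext_push G \<nu> y"
  "ext_push G \<nu> (x - y) = ext_push G \<nu> x - ext_push G \<nu> y"
  "ext_push G \<nu> (c \<bullet> x) = c \<bullet> ext_push G \<nu> x"
  "ext_push G \<nu> 0 = 0"
  by (auto simp: ext_push_def fun_eq_iff ext_scale_def algebra_simps sum.distrib
      sum_subtractf sum_distrib_left)

lemma ext_push_sum: "ext_push G \<nu> (\<Sum>i\<in>M. f i) = (\<Sum>i\<in>M. ext_push G \<nu> (f i))"
  by (induction M rule: infinite_finite_induct)
    (simp_all only: sum.infinite sum.empty sum.insert ext_push_linear not_False_eq_True)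

lemma ext_push_basis_empty:
  assumes "finite G"
  shows "ext_push G \<nu> (ext_basis {}) = ext_basis {}"
proof
  fix T
  have "(\<Sum>S | S \<subseteq> G \<and> inj_on \<nu> S \<and> \<nu> ` S = T. inv_sign \<nu> S * ext_basis {} S) =
      (\<Sum>S | S \<subseteq> G \<and> inj_on \<nu> S \<and> \<nu> ` S = T. if S = {} then 1 else 0)"
    by (rule sum.cong) (auto simp: ext_basis_def)
  also have "\<dots> = (if T = {} then 1 else 0)"
    using assms by (subst sum.delta) auto
  finally show "ext_push G \<nu> (ext_basis {}) T = ext_basis {} T"
    by (auto simp: ext_push_def ext_basis_def)
qed

lemma ext_push_gen:
  assumes "finite G" "g \<in> G"
  shows "ext_push G \<nu> (ext_gen g) = (if \<nu> g = 0 then 0 else ext_gen (\<nu> g))"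
proof
  fix T
  have "(\<Sum>S | S \<subseteq> G \<and> inj_on \<nu> S \<and> \<nu> ` S = T. inv_sign \<nu> S * ext_gen g S) =
      (\<Sum>S | S \<subseteq> G \<and> inj_on \<nu> S \<and> \<nu> ` S = T. if S = {g} then 1 else 0)"
    by (rule sum.cong) (auto simp: ext_gen_def ext_basis_def)
  also have "\<dots> = (if T = {\<nu> g} then 1 else 0)"
    using assms by (subst sum.delta) auto
  finally show "ext_push G \<nu> (ext_gen g) T = (if \<nu> g = 0 then 0 else ext_gen (\<nu> g)) T"
    by (auto simp: ext_push_def ext_gen_def ext_basis_def)
qed

text \<open>Both sides expand into sums over pairs of sets. A subset \<open>S\<close> of
  \<open>U\<close> corresponds to its image \<open>P\<close> together with \<open>S\<close> and
  \<open>U - S\<close>; in the other direction, disjointness of \<open>P\<close> and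
  \<open>T - P\<close> makes \<nu> injective on the union. The signs agree by
  \<open>inv_sign_Un\<close>.\<close>

lemma ext_push_times:
  assumes "finite G"
  shows "ext_push G \<nu> (x \<odot> y) = ext_push G \<nu> x \<odot> ext_push G \<nu> y"
proof
  fix T
  define F where "F = (\<lambda>T. {S. S \<subseteq> G \<and> inj_on \<nu> S \<and> \<nu> ` S = T})"
  have finG: "finite S" if "S \<subseteq> G" for S using assms that finite_subset by blast
  have finF: "finite (F T)" for T by (rule finite_subset[of _ "Pow G"]) (use assms in \<open>auto simp: F_def\<close>)
  show "ext_push G \<nu> (x \<odot> y) T = (ext_push G \<nu> x \<odot> ext_push G \<nu> y) T"
  proof (cases "0 \<in> T \<or> infinite T")
    \<comment> \<open>If \<open>0\<close> lies in \<open>T\<close>, it lies in one of the two parts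
      of every splitting. For infinite \<open>T\<close> there is no preimage inside the finite set
      \<open>G\<close>, and the sum over the infinite power set is \<open>0\<close> by
      convention.\<close>
    case True
    then have "(ext_push G \<nu> x \<odot> ext_push G \<nu> y) T = 0"
    proof
      assume "0 \<in> T"
      then show ?thesis
        unfolding ext_times_def by (intro sum.neutral) (auto simp: ext_push_def)
    qed (simp add: ext_times_def)
    moreover have "ext_push G \<nu> (x \<odot> y) T = 0"
    proof (cases "0 \<in> T")
      case False
      with True finG have empty: "{S. S \<subseteq> G \<and> inj_on \<nu> S \<and> \<nu> ` S = T} = {}" by auto
      show ?thesis unfolding ext_push_def empty by simp
    qed (simp add: ext_push_def)
    ultimately show ?thesis by simp
  next
    case False
    then have T0: "0 \<notin> T" and finT: "finite T" by auto
    have "ext_push G \<nu> (x \<odot> y) T =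
        (\<Sum>U\<in>F T. \<Sum>S\<in>Pow U. inv_sign \<nu> U * (ext_sign S (U - S) * x S * y (U - S)))"
      using T0 by (simp add: ext_push_def ext_times_def F_def sum_distrib_left)
    also have "\<dots> = (\<Sum>(U, S)\<in>(SIGMA U:F T. Pow U).
        inv_sign \<nu> U * (ext_sign S (U - S) * x S * y (U - S)))"
      by (rule sum.Sigma) (use finF finG in \<open>auto simp: F_def\<close>)
    also have "\<dots> = (\<Sum>(P, S, S')\<in>(SIGMA P:Pow T. F P \<times> F (T - P)).
        ext_sign P (T - P) * (inv_sign \<nu> S * x S) * (inv_sign \<nu> S' * y S'))"
    proof (rule sum.reindex_bij_witness[where i = "\<lambda>(P, S, S'). (S \<union> S', S)" and
          j = "\<lambda>(U, S). (\<nu> ` S, S, U - S)"])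
      fix a assume "a \<in> (SIGMA U:F T. Pow U)"
      then obtain U S where a: "a = (U, S)" and "U \<in> F T" and S: "S \<subseteq> U" by blast
      then have U: "U \<subseteq> G" "inj_on \<nu> U" "\<nu> ` U = T" by (simp_all add: F_def)
      have eq: "\<nu> ` (U - S) = T - \<nu> ` S"
        using inj_on_image_set_diff[OF U(2), of U S] U(3) S by simp
      have inj: "inj_on \<nu> S" "inj_on \<nu> (U - S)" using U(2) S by (auto intro: inj_on_subset)
      show "(case case a of (U, S) \<Rightarrow> (\<nu> ` S, S, U - S) of (P, S, S') \<Rightarrow> (S \<union> S', S)) = a"
        using S by (simp add: a Un_absorb1)
      show "(case a of (U, S) \<Rightarrow> (\<nu> ` S, S, U - S)) \<in> (SIGMA P:Pow T. F P \<times> F (T - P))"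
        using inj U S eq by (auto simp: a F_def)
      have "inv_sign \<nu> (S \<union> (U - S)) * ext_sign S (U - S) =
          inv_sign \<nu> S * inv_sign \<nu> (U - S) * ext_sign (\<nu> ` S) (\<nu> ` (U - S))"
        by (rule inv_sign_Un) (use U S finG[of S] finG[of "U - S"] in \<open>auto simp: Un_absorb1\<close>)
      moreover have "S \<union> (U - S) = U" using S by auto
      ultimately have "inv_sign \<nu> U * ext_sign S (U - S) =
          inv_sign \<nu> S * inv_sign \<nu> (U - S) * ext_sign (\<nu> ` S) (T - \<nu> ` S)" by (simp add: eq)
      then have "inv_sign \<nu> U * (ext_sign S (U - S) * x S * y (U - S)) =
          inv_sign \<nu> S * inv_sign \<nu> (U - S) * ext_sign (\<nu> ` S) (T - \<nu> ` S) * (x S * y (U - S))"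
        by (simp flip: mult.assoc)
      then show "(case case a of (U, S) \<Rightarrow> (\<nu> ` S, S, U - S) of (P, S, S') \<Rightarrow>
            ext_sign P (T - P) * (inv_sign \<nu> S * x S) * (inv_sign \<nu> S' * y S')) =
          (case a of (U, S) \<Rightarrow> inv_sign \<nu> U * (ext_sign S (U - S) * x S * y (U - S)))"
        by (simp only: a prod.case mult_ac)
    next
      fix b assume "b \<in> (SIGMA P:Pow T. F P \<times> F (T - P))"
      then obtain P S S' where b: "b = (P, S, S')" "P \<subseteq> T" "S \<in> F P" "S' \<in> F (T - P)" by auto
      then have "S \<inter> S' = {}" by (auto simp: F_def)
      with b show "(case case b of (P, S, S') \<Rightarrow> (S \<union> S', S) of (U, S) \<Rightarrow> (\<nu> ` S, S, U - S)) = b"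
        by (auto simp: F_def)
      show "(case b of (P, S, S') \<Rightarrow> (S \<union> S', S)) \<in> (SIGMA U:F T. Pow U)"
        using b by (auto simp: F_def inj_on_Un)
    qed
    also have "\<dots> = (\<Sum>P\<in>Pow T. \<Sum>(S, S')\<in>F P \<times> F (T - P).
        ext_sign P (T - P) * (inv_sign \<nu> S * x S) * (inv_sign \<nu> S' * y S'))"
      by (subst sum.Sigma) (use finF finT in \<open>auto simp: case_prod_beta\<close>)
    also have "\<dots> = (\<Sum>P\<in>Pow T. ext_sign P (T - P) *
        (\<Sum>S\<in>F P. inv_sign \<nu> S * x S) * (\<Sum>S\<in>F (T - P). inv_sign \<nu> S * y S))"
      by (rule sum.cong[OF refl], subst sum.cartesian_product[symmetric])
        (simp add: sum_distrib_left sum_distrib_right mult.assoc, rule sum.swap)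
    also have "\<dots> = (ext_push G \<nu> x \<odot> ext_push G \<nu> y) T"
      unfolding ext_times_def using T0 by (intro sum.cong) (auto simp: ext_push_def F_def)
    finally show ?thesis .
  qed
qed

section \<open>Products of generators in a prescribed order\<close>

definition ext_prod :: "'g::linorder list \<Rightarrow> 'g set \<Rightarrow> complex" where
  "ext_prod gs = foldr (\<lambda>g x. ext_gen g \<odot> x) gs (ext_basis {})"

lemma ext_prod_simps [simp]:
  "ext_prod [] = ext_basis {}" "ext_prod (g # gs) = ext_gen g \<odot> ext_prod gs"
  by (simp_all add: ext_prod_def)

text \<open>A product of generators is a signed basis monomial, or \<open>0\<close> if a generator
  is repeated. Knowing the support is enough to see that a functional vanishes and to find the
  degree.\<close>

lemma ext_prod_nonzero:
  assumes "ext_prod gs T \<noteq> 0"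
  shows "T = set gs \<and> distinct gs"
  using assms
proof (induction gs arbitrary: T)
  case Nil
  then show ?case by (auto simp: ext_basis_def split: if_splits)
next
  case (Cons g gs)
  then have "g \<in> T" "ext_prod gs (T - {g}) \<noteq> 0" using ext_gen_times_eq_0 by force+
  then show ?case using Cons.IH[of "T - {g}"] by auto
qed

lemma ext_prod_sorted:
  assumes "sorted_wrt (<) gs"
  shows "ext_prod gs = ext_basis (set gs)"
  using assms
proof (induction gs)
  case (Cons g gs)
  then show ?case using ext_gen_increasing[of "set gs" g UNIV] by (simp add: ext_algebra_simps)
qed simp

lemma ext_push_prod:
  assumes "finite G" "set gs \<subseteq> G"
  shows "ext_push G \<nu> (ext_prod gs) = (if 0 \<in> \<nu> ` set gs then 0 else ext_prod (map \<nu> gs))"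
  using assms(2)
  by (induction gs) (auto simp: ext_push_basis_empty ext_push_times ext_push_gen assms(1))

section \<open>Levels in forests\<close>

text \<open>A map \<open>f\<close> with \<open>f j < j\<close> is a forest with an edge labelled \<open>j\<close> between \<open>j\<close> and its parent
  \<open>f j\<close>; the value \<open>0\<close> marks the roots. The level of \<open>i\<close> and \<open>j\<close> is the smallest
  label on the path joining them, and \<open>0\<close> if they are not connected.\<close>

function level :: "(nat \<Rightarrow> nat) \<Rightarrow> nat \<Rightarrow> nat \<Rightarrow> nat" where
  "level f i j =
    (if i = 0 \<or> j = 0 \<or> i = j then 0
     else if i < j then (if j \<le> f j then 0 else if f j = i then j else level f i (f j))
     else (if i \<le> f i then 0 else if f i = j then i else level f (f i) j))"
  by pat_completeness auto
termination by (relation "measure (\<lambda>(f, i, j). i + j)") auto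

declare level.simps [simp del]

lemma level_commute: "level f i j = level f j i"
proof (induction f i j rule: level.induct)
  case (1 f i j)
  then show ?case by (subst (1 2) level.simps) auto
qed

lemma level_zero [simp]: "level f i 0 = 0" "level f 0 j = 0"
  by (simp_all add: level.simps)

lemma level_le: "level f i j \<le> max i j"
proof (induction f i j rule: level.induct)
  case (1 f i j)
  show ?case
  proof (cases "i = 0 \<or> j = 0 \<or> i = j")
    case True
    then show ?thesis by (simp add: level.simps)
  next
    case False
    then show ?thesis using 1 by (subst level.simps) (auto simp: max_def split: if_splits)
  qed
qed

lemma level_parent:
  assumes "0 < i" "i < j"
  shows "level f i j = (if j \<le> f j then 0 else if f j = i then j else level f i (f j))"
  using assms by (subst level.simps) simp

text \<open>Being connected by edges with labels at least \<open>r\<close> is transitive, so the two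
  smallest of the three levels agree. The induction replaces the largest vertex by its
  parent.\<close>

lemma level_isosceles_aux:
  fixes i j k :: nat
  defines "ultra \<equiv> \<lambda>a b c :: nat. a = b \<and> a \<le> c \<or> a = c \<and> a \<le> b \<or> b = c \<and> b \<le> a"
  assumes "0 < i" "0 < j" "0 < k" "i \<noteq> j" "i \<noteq> k" "j \<noteq> k"
  shows "ultra (level f i j) (level f i k) (level f j k)"
  using assms(2-)
proof (induction "i + j + k" arbitrary: i j k rule: less_induct)
  case less
  \<comment> \<open>The case in which the last vertex is the largest; the relation
    \<open>ultra\<close> is symmetric enough to give the other two orders.\<close>
  have top: "ultra (level f i j) (level f i k) (level f j k)"
    if IH: "\<And>k'. \<lbrakk>k' < k; 0 < k'; i \<noteq> k'; j \<noteq> k'\<rbrakk> \<Longrightarrow> ultra (level f i j) (level f i k') (level f j k')"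
      and "0 < i" "0 < j" "i \<noteq> j" "i < k" "j < k" for i j k
  proof -
    consider "k \<le> f k \<or> f k = 0" | "f k = i" | "f k = j" | "f k < k" "0 < f k" "f k \<noteq> i" "f k \<noteq> j"
      by linarith
    then show ?thesis
    proof cases
      case 1
      then show ?thesis using that by (auto simp: level_parent[of _ k] ultra_def)
    next
      case 2
      then show ?thesis
        using that level_le[of f i j] by (auto simp: level_parent[of _ k] ultra_def level_commute[of f j i])
    next
      case 3
      then show ?thesis using that level_le[of f i j] by (auto simp: level_parent[of _ k] ultra_def)
    next
      case 4
      then show ?thesis using that IH[of "f k"] by (auto simp: level_parent[of _ k])
    qed
  qed
  consider "i < k" "j < k" | "i < j" "k < j" | "j < i" "k < i" using less.prems by linarith
  then show ?case
  proof cases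
    case 1
    show ?thesis
    proof (rule top)
      fix k' assume "k' < k" "0 < k'" "i \<noteq> k'" "j \<noteq> k'"
      then show "ultra (level f i j) (level f i k') (level f j k')"
        using less.prems by (intro less.hyps) simp_all
    qed (use 1 less.prems in simp_all)
  next
    case 2
    have "ultra (level f i k) (level f i j) (level f k j)"
    proof (rule top)
      fix k' assume "k' < j" "0 < k'" "i \<noteq> k'" "k \<noteq> k'"
      then show "ultra (level f i k) (level f i k') (level f k k')"
        using less.prems by (intro less.hyps) simp_all
    qed (use 2 less.prems in simp_all)
    then show ?thesis by (auto simp: ultra_def level_commute[of f k j])
  next
    case 3
    have "ultra (level f k j) (level f k i) (level f j i)"
    proof (rule top)
      fix k' assume "k' < i" "0 < k'" "k \<noteq> k'" "j \<noteq> k'"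
      then show "ultra (level f k j) (level f k k') (level f j k')"
        using less.prems by (intro less.hyps) simp_all
    qed (use 3 less.prems in simp_all)
    then show ?thesis
      by (auto simp: ultra_def level_commute[of f k j] level_commute[of f k i] level_commute[of f j i])
  qed
qed

lemma level_isosceles:
  assumes "0 < i" "i < j" "j < k"
  shows "level f i j = level f i k \<or> level f i j = level f j k \<or> level f i k = level f j k"
  using level_isosceles_aux[of i j k f] assms by auto

text \<open>If the parent of \<open>j\<close> were not \<open>i\<close>, the level would be that of
  \<open>i\<close> and \<open>f j\<close>, which is at most the larger of the two and thus below
  \<open>j\<close>.\<close>

lemma level_eq_label:
  assumes "0 < i" "i < j" "level f i j = j"
  shows "f j = i"
proof (rule ccontr)
  assume "f j \<noteq> i"
  with assms have "f j < j" "level f i (f j) = j" by (auto simp: level_parent split: if_splits)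
  then show False using level_le[of f i "f j"] assms by auto
qed

text \<open>If \<open>s j < j\<close>, then by induction \<open>s\<close> fixes \<open>s j\<close>,
  so that \<open>s j\<close> and \<open>j\<close> have the same image.\<close>

lemma inj_decreasing_id:
  fixes s :: "nat \<Rightarrow> nat"
  assumes "inj_on s A" "s ` A \<subseteq> A" "\<And>j. j \<in> A \<Longrightarrow> s j \<le> j" "j \<in> A"
  shows "s j = j"
  using assms(4)
proof (induction j rule: less_induct)
  case (less j)
  then show ?case
    using assms by (metis image_subset_iff inj_onD le_neq_implies_less)
qed

section \<open>The dual basis\<close>

definition supp :: "(nat \<Rightarrow> nat) \<Rightarrow> nat set" where
  "supp f = {j. f j \<noteq> 0}"

text \<open>This lifts a basis monomial to the exterior algebra. Parents are at least
  \<open>1\<close>, so \<open>0\<close> is free to mark roots and one total function carries both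
  the tuple \<open>I\<close> and the set \<open>J = supp f\<close>.\<close>

definition forest_mono :: "(nat \<Rightarrow> nat) \<Rightarrow> (nat \<times> nat) set \<Rightarrow> complex" where
  "forest_mono f = ext_prod (map (\<lambda>j. (f j, j)) (sorted_list_of_set (supp f)))"

section \<open>Representatives in the exterior algebra and their classes in the quotient\<close>

locale discriminantal =
  fixes n l :: nat
begin

abbreviation "E \<equiv> disc_ext n l"
abbreviation "A \<equiv> os_alg n l"
abbreviation "gens \<equiv> disc_gens n l"
abbreviation "cl \<equiv> os_class n l"

sublocale E: ring E by (rule disc_ext_ring)
sublocale A: ring A by (rule os_alg_ring)
sublocale I: ideal "os_ideal n l" E by (rule os_ideal_ideal)

lemma E_simps:
  "x \<otimes>\<^bsub>E\<^esub> y = x \<odot> y" "x \<oplus>\<^bsub>E\<^esub> y = x + y" "\<zero>\<^bsub>E\<^esub> = 0" "\<one>\<^bsub>E\<^esub> = ext_basis {}"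
  by (simp_all add: disc_ext_def ext_algebra_simps)

lemma E_carrier: "x \<in> carrier E \<longleftrightarrow> (\<forall>S. x S \<noteq> 0 \<longrightarrow> S \<subseteq> gens)"
  by (simp add: disc_ext_def exterior_algebra_def)

lemma E_closed:
  "0 \<in> carrier E" "ext_basis {} \<in> carrier E"
  "x \<in> carrier E \<Longrightarrow> y \<in> carrier E \<Longrightarrow> x + y \<in> carrier E"
  "x \<in> carrier E \<Longrightarrow> y \<in> carrier E \<Longrightarrow> x - y \<in> carrier E"
  "x \<in> carrier E \<Longrightarrow> - x \<in> carrier E"
  "x \<in> carrier E \<Longrightarrow> c \<bullet> x \<in> carrier E"
  "x \<in> carrier E \<Longrightarrow> y \<in> carrier E \<Longrightarrow> x \<odot> y \<in> carrier E"
  "(i, j) \<in> gens \<Longrightarrow> ext_gen (i, j) \<in> carrier E"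
proof -
  have neg: "- x \<in> carrier E" if "x \<in> carrier E" for x
    using that by (auto simp: E_carrier)
  then show "- x \<in> carrier E" if "x \<in> carrier E" using that .
  show "c \<bullet> x \<in> carrier E" if "x \<in> carrier E"
    using that by (auto simp: E_carrier ext_scale_def)
  show "x - y \<in> carrier E" if "x \<in> carrier E" "y \<in> carrier E"
    using E.a_closed[of x "- y"] that neg[of y] by (simp add: E_simps)
qed (use E.m_closed[of x y] E.a_closed[of x y] E.zero_closed E.one_closed in
    \<open>simp_all only: E_simps ext_gen_carrier\<close>)

lemma E_sum_closed: "(\<And>i. i \<in> M \<Longrightarrow> x i \<in> carrier E) \<Longrightarrow> (\<Sum>i\<in>M. x i) \<in> carrier E"
  by (induction M rule: infinite_finite_induct) (simp_all only: sum.infinite sum.empty sum.insert E_closed insert_iff not_False_eq_True simp_thms)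

lemma E_a_minus: "x \<in> carrier E \<Longrightarrow> y \<in> carrier E \<Longrightarrow> x \<ominus>\<^bsub>E\<^esub> y = x - y"
  using E.minus_equality[of "- y" y] by (simp add: E.minus_eq E_simps E_closed)

lemma ext_prod_closed: "set gs \<subseteq> gens \<Longrightarrow> ext_prod gs \<in> carrier E"
  by (induction gs) (auto simp: E_closed)

lemma one_times: "x \<in> carrier E \<Longrightarrow> ext_basis {} \<odot> x = x" "x \<in> carrier E \<Longrightarrow> x \<odot> ext_basis {} = x"
  using E.l_one E.r_one by (simp_all add: E_simps)

lemma cl_hom: "cl \<in> ring_hom E A"
proof -
  have "cl = (+>\<^bsub>E\<^esub>) (os_ideal n l)" by (simp add: os_class_def fun_eq_iff)
  then show ?thesis using I.rcos_ring_hom by (simp add: os_alg_def)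
qed

lemma cl_simps:
  "x \<in> carrier E \<Longrightarrow> cl x \<in> carrier A"
  "x \<in> carrier E \<Longrightarrow> y \<in> carrier E \<Longrightarrow> cl x \<oplus>\<^bsub>A\<^esub> cl y = cl (x + y)"
  "x \<in> carrier E \<Longrightarrow> y \<in> carrier E \<Longrightarrow> cl x \<otimes>\<^bsub>A\<^esub> cl y = cl (x \<odot> y)"
  "\<one>\<^bsub>A\<^esub> = cl (ext_basis {})"
  using ring_hom_closed[OF cl_hom] ring_hom_add[OF cl_hom] ring_hom_mult[OF cl_hom]
    ring_hom_one[OF cl_hom] by (simp_all add: E_simps)

lemma cl_zero: "\<zero>\<^bsub>A\<^esub> = cl 0"
  using ring_hom_zero[OF cl_hom E.ring_axioms A.ring_axioms] by (simp add: E_simps)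

lemma cl_eq_iff:
  assumes "x \<in> carrier E" "y \<in> carrier E"
  shows "cl x = cl y \<longleftrightarrow> x - y \<in> os_ideal n l"
  using E.quotient_eq_iff_same_a_r_cos[OF os_ideal_ideal assms] by (simp add: os_class_def E_a_minus assms)

lemma cl_cong:
  assumes "x \<in> carrier E" "x' \<in> carrier E" "y \<in> carrier E" "y' \<in> carrier E" "cl x = cl x'" "cl y = cl y'"
  shows "cl (x + y) = cl (x' + y')" "cl (x \<odot> y) = cl (x' \<odot> y')"
  using cl_simps(2)[OF assms(1,3)] cl_simps(2)[OF assms(2,4)] cl_simps(3)[OF assms(1,3)]
    cl_simps(3)[OF assms(2,4)] assms(5,6) by simp_all

lemma cl_finsum:
  assumes "finite M" "\<And>i. i \<in> M \<Longrightarrow> x i \<in> carrier E"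
  shows "(\<Oplus>\<^bsub>A\<^esub>i\<in>M. cl (x i)) = cl (\<Sum>i\<in>M. x i)"
  using assms
proof (induction M)
  case empty
  then show ?case by (simp only: A.finsum_empty sum.empty cl_zero)
next
  case (insert i M)
  have "(\<Oplus>\<^bsub>A\<^esub>i\<in>insert i M. cl (x i)) = cl (x i) \<oplus>\<^bsub>A\<^esub> (\<Oplus>\<^bsub>A\<^esub>i\<in>M. cl (x i))"
    using insert by (intro A.finsum_insert) (auto simp: cl_simps)
  also have "\<dots> = cl (x i + (\<Sum>i\<in>M. x i))"
    using insert by (simp add: cl_simps E_sum_closed)
  finally show ?case using insert by (simp only: sum.insert not_False_eq_True)
qed

lemma cl_smult: "x \<in> carrier E \<Longrightarrow> os_smult n l c (cl x) = cl (c \<bullet> x)"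
proof -
  assume x: "x \<in> carrier E"
  have "(ext_scalar c :: (nat \<times> nat) set \<Rightarrow> complex) = c \<bullet> ext_basis {}"
    by (auto simp: ext_scalar_def ext_scale_def ext_basis_def)
  then show ?thesis
    using cl_simps(3)[OF E_closed(6)[OF E_closed(2)] x] x
    by (simp add: os_smult_def ext_times_distrib one_times)
qed

section \<open>The defining relations, solved for a product of two edges with the same upper
  end\<close>

lemma gens_iff: "(i, j) \<in> gens \<longleftrightarrow> l < j \<and> j \<le> n \<and> 0 < i \<and> i < j"
  by (auto simp: disc_gens_def)

lemma relation_parallel:
  assumes "l < j" "j \<le> n" "0 < i" "0 < k" "i \<le> l" "k \<le> l" "i \<noteq> k"
  shows "cl (ext_gen (k, j) \<odot> ext_gen (i, j)) = cl 0"
proof -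
  have *: "ext_gen (a, j) \<odot> ext_gen (b, j) \<in> os_ideal n l" if "0 < a" "a < b" "b \<le> l" for a b
  proof -
    have "ext_gen (a, j) \<odot> ext_gen (b, j) \<in> os_relations n l"
      unfolding os_relations_def E_simps using that assms by auto
    then show ?thesis unfolding os_ideal_def using E.genideal_self[OF os_relations_carrier] by auto
  qed
  have "ext_gen (k, j) \<odot> ext_gen (i, j) \<in> os_ideal n l"
  proof (cases "k < i")
    case False
    \<comment> \<open>The relation is given for one order of the factors; the other order differs by
      a sign, and the ideal is closed under negation.\<close>
    then have "\<ominus>\<^bsub>E\<^esub> (ext_gen (i, j) \<odot> ext_gen (k, j)) \<in> os_ideal n l"
      using assms by (intro I.a_inv_closed *) auto
    moreover have "\<ominus>\<^bsub>E\<^esub> x = - x" if "x \<in> carrier E" for x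
      using that E.minus_equality[of "- x" x] by (simp add: E_simps E_closed)
    ultimately show ?thesis
      using assms by (simp add: E_closed gens_iff ext_gen_times_commute[of "(k, j)"])
  qed (use * assms in auto)
  then show ?thesis using assms by (subst cl_eq_iff) (auto simp: E_closed gens_iff)
qed

text \<open>This is the three-term relation of the triangle \<open>min i k\<close>,
  \<open>max i k\<close>, \<open>j\<close>. Exchanging \<open>i\<close> and \<open>k\<close> changes
  the sign on both sides, so one formula covers both orders.\<close>

lemma relation_triple:
  assumes "l < j" "j \<le> n" "0 < i" "0 < k" "i < j" "k < j" "i \<noteq> k" "l < max i k"
  shows "cl (ext_gen (k, j) \<odot> ext_gen (i, j)) =
         cl (ext_gen (min i k, max i k) \<odot> (ext_gen (i, j) - ext_gen (k, j)))"
proof -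
  have *: "ext_gen (a, b) \<odot> ext_gen (a, j) - ext_gen (a, b) \<odot> ext_gen (b, j)
      + ext_gen (a, j) \<odot> ext_gen (b, j) \<in> os_ideal n l" (is "?r \<in> _")
    if "0 < a" "a < b" "l < b" "b < j" for a b
  proof -
    have "ext_gen (a, b) \<odot> ext_gen (a, j) \<ominus>\<^bsub>E\<^esub> ext_gen (a, b) \<odot> ext_gen (b, j)
      + ext_gen (a, j) \<odot> ext_gen (b, j) \<in> os_relations n l"
      unfolding os_relations_def E_simps using that assms
      by (intro UnI1 CollectI exI[of _ a] exI[of _ b] exI[of _ j]) auto
    then have "?r \<in> os_relations n l"
      using that assms by (subst (asm) E_a_minus) (auto simp: E_closed gens_iff)
    then show ?thesis unfolding os_ideal_def using E.genideal_self[OF os_relations_carrier] by auto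
  qed
  have "ext_gen (k, j) \<odot> ext_gen (i, j) -
      ext_gen (min i k, max i k) \<odot> (ext_gen (i, j) - ext_gen (k, j)) \<in> os_ideal n l"
  proof (cases "k < i")
    case True
    then show ?thesis using *[of k i] assms by (simp add: ext_times_distrib algebra_simps min_def max_def)
  next
    case False
    have "\<ominus>\<^bsub>E\<^esub> (ext_gen (i, k) \<odot> ext_gen (i, j) - ext_gen (i, k) \<odot> ext_gen (k, j)
      + ext_gen (i, j) \<odot> ext_gen (k, j)) \<in> os_ideal n l"
      using False assms by (intro I.a_inv_closed *) auto
    moreover have "\<ominus>\<^bsub>E\<^esub> x = - x" if "x \<in> carrier E" for x
      using that E.minus_equality[of "- x" x] by (simp add: E_simps E_closed)
    ultimately show ?thesis
      using assms False
      by (simp add: E_closed gens_iff ext_gen_times_commute[of "(k, j)" "(i, j)"] ext_times_distrib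
          min_def max_def algebra_simps)
  qed
  then show ?thesis using assms
    by (subst cl_eq_iff) (auto simp: E_closed gens_iff min_def max_def)
qed

section \<open>Forests and the functionals dual to their monomials\<close>

definition forests :: "(nat \<Rightarrow> nat) set" where
  "forests = {f. \<forall>j. f j \<noteq> 0 \<longrightarrow> l < j \<and> j \<le> n \<and> f j < j}"

lemma finite_forests: "finite forests"
proof (rule finite_subset[OF _ finite_set_of_finite_funs[of "{..n}" "{..n}" 0]])
  have "f x \<le> n" "x \<le> n \<or> f x = 0" if "f \<in> forests" for f x
  proof -
    have "f x \<noteq> 0 \<longrightarrow> l < x \<and> x \<le> n \<and> f x < x" using that by (simp add: forests_def)
    then show "f x \<le> n" "x \<le> n \<or> f x = 0" by (cases "f x = 0"; simp)+
  qed
  then show "forests \<subseteq> {f. \<forall>x. (x \<in> {..n} \<longrightarrow> f x \<in> {..n}) \<and> (x \<notin> {..n} \<longrightarrow> f x = 0)}"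
    by auto
qed auto

lemma finite_supp: "f \<in> forests \<Longrightarrow> finite (supp f)"
  by (rule finite_subset[of _ "{..n}"]) (auto simp: forests_def supp_def)

lemma forest_edges: "f \<in> forests \<Longrightarrow> j \<in> supp f \<Longrightarrow> (f j, j) \<in> gens"
  by (auto simp: forests_def supp_def gens_iff)

lemma forest_mono_closed: "f \<in> forests \<Longrightarrow> forest_mono f \<in> carrier E"
  unfolding forest_mono_def by (intro ext_prod_closed) (auto simp: finite_supp forest_edges)

definition coef :: "(nat \<Rightarrow> nat) \<Rightarrow> ((nat \<times> nat) set \<Rightarrow> complex) \<Rightarrow> complex" where
  "coef f x = ext_push gens (\<lambda>(i, j). level f i j) x (supp f)"

lemma coef_linear:
  "coef f (x + y) = coef f x + coef f y" "coef f (x - y) = coef f x - coef f y"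
  "coef f (c \<bullet> x) = c * coef f x" "coef f 0 = 0"
  by (simp_all add: coef_def ext_push_linear) (simp add: ext_scale_def)

lemma coef_sum: "coef f (\<Sum>i\<in>M. x i) = (\<Sum>i\<in>M. coef f (x i))"
  by (simp add: coef_def ext_push_sum sum_fun_apply)

text \<open>The target is the exterior algebra on the finite set of levels of generators. It is
  therefore a ring, and the kernel is an ideal.\<close>

lemma push_level_hom:
  "ext_push gens (\<lambda>(i, j). level f i j) \<in> ring_hom E (exterior_algebra ((\<lambda>(i, j). level f i j) ` gens))"
proof (rule ring_hom_memI)
  fix x assume "x \<in> carrier E"
  have "T \<subseteq> \<nu> ` gens" if "ext_push gens \<nu> x T \<noteq> 0" for T and \<nu> :: "nat \<times> nat \<Rightarrow> nat"
  proof -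
    from that have "(\<Sum>S | S \<subseteq> gens \<and> inj_on \<nu> S \<and> \<nu> ` S = T. inv_sign \<nu> S * x S) \<noteq> 0"
      by (auto simp: ext_push_def split: if_splits)
    then obtain S where "S \<subseteq> gens" "\<nu> ` S = T"
      by (metis (mono_tags, lifting) mem_Collect_eq sum.not_neutral_contains_not_neutral)
    then show ?thesis by auto
  qed
  then show "ext_push gens (\<lambda>(i, j). level f i j) x \<in>
      carrier (exterior_algebra ((\<lambda>(i, j). level f i j) ` gens))"
    by (simp add: exterior_algebra_def)
qed (simp_all only: E_simps ext_algebra_simps ext_push_times[OF finite_disc_gens] ext_push_linear
    ext_push_basis_empty[OF finite_disc_gens])

lemma push_level_relations:
  assumes "f \<in> forests" "r \<in> os_relations n l"
  shows "ext_push gens (\<lambda>(i, j). level f i j) r = 0"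
proof -
  define \<nu> where "\<nu> = (\<lambda>(i, j). level f i j)"
  have gen: "ext_push gens \<nu> (ext_gen (i, j)) = (if level f i j = 0 then 0 else ext_gen (level f i j))"
    if "(i, j) \<in> gens" for i j
    using ext_push_gen[OF finite_disc_gens that, of \<nu>] by (simp add: \<nu>_def)
  have "ext_push gens \<nu> r = 0"
    using assms(2) unfolding os_relations_def E_simps
  proof (elim UnE CollectE exE conjE)
    fix i j k
    assume r: "r = ext_gen (i, j) \<odot> ext_gen (i, k) \<ominus>\<^bsub>E\<^esub> ext_gen (i, j) \<odot> ext_gen (j, k) +
        ext_gen (i, k) \<odot> ext_gen (j, k)"
      and ijk: "1 \<le> i" "i < j" "j < k" "k \<le> n" "l + 1 \<le> j"
    have r: "r = ext_gen (i, j) \<odot> ext_gen (i, k) - ext_gen (i, j) \<odot> ext_gen (j, k) +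
        ext_gen (i, k) \<odot> ext_gen (j, k)"
      unfolding r using ijk by (subst E_a_minus) (auto simp: E_closed gens_iff)
    show "ext_push gens \<nu> r = 0"
      \<comment> \<open>Whichever two of the three levels coincide, one of the three terms is a
        square and the other two cancel.\<close>
      using level_isosceles[of i j k f] ijk
      by (auto simp: r ext_push_linear ext_push_times finite_disc_gens gen gens_iff ext_gen_times_self
          ext_gen_times_commute[of "level f j k" "level f i k"])
  next
    fix i j k
    assume r: "r = ext_gen (i, k) \<odot> ext_gen (j, k)" and ijk: "1 \<le> i" "i < j" "j \<le> l" "l < k" "k \<le> n"
    \<comment> \<open>Both \<open>i\<close> and \<open>j\<close> are roots, hence not connected. By
      the isosceles property the two factors have equal images or one of them is sent to
      \<open>0\<close>.\<close>
    have "f j = 0" using assms(1) ijk by (auto simp: forests_def)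
    then have "level f i j = 0" using ijk by (simp add: level_parent)
    then show "ext_push gens \<nu> r = 0"
      using level_isosceles[of i j k f] ijk
      by (auto simp: r ext_push_times finite_disc_gens gen gens_iff ext_gen_times_self)
  qed
  then show ?thesis by (simp add: \<nu>_def)
qed

lemma coef_ideal:
  assumes "f \<in> forests" "x \<in> os_ideal n l"
  shows "coef f x = 0"
proof -
  let ?h = "ext_push gens (\<lambda>(i, j). level f i j)"
  let ?R = "exterior_algebra ((\<lambda>(i, j). level f i j) ` gens)"
  have h: "ring_hom_ring E ?R ?h"
    using push_level_hom
    by (intro ring_hom_ringI2 E.ring_axioms exterior_algebra_ring) (simp_all add: finite_disc_gens)
  have kernel: "a_kernel E ?R ?h = {x \<in> carrier E. ?h x = 0}"
    by (simp only: a_kernel_def' ext_algebra_simps)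
  have "os_relations n l \<subseteq> {x \<in> carrier E. ?h x = 0}"
    using os_relations_carrier push_level_relations[OF assms(1)] by blast
  then have "os_ideal n l \<subseteq> {x \<in> carrier E. ?h x = 0}"
    unfolding os_ideal_def kernel[symmetric]
    by (rule E.genideal_minimal[OF ring_hom_ring.kernel_is_ideal[OF h]])
  then have "?h x = 0" using assms(2) by blast
  then show ?thesis by (simp add: coef_def)
qed

lemma coef_cong:
  assumes "f \<in> forests" "x \<in> carrier E" "y \<in> carrier E" "cl x = cl y"
  shows "coef f x = coef f y"
  using coef_ideal[OF assms(1), of "x - y"] assms by (simp add: cl_eq_iff coef_linear)

text \<open>A label \<open>j\<close> of \<open>g\<close> has a nonzero level, so it also has a
  parent in \<open>f\<close>; by cardinality the supports agree. The levels then define an injective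
  self-map of the support with \<open>s j \<le> j\<close>. It is the identity, and level
  \<open>j\<close> forces the edge of \<open>g\<close> at \<open>j\<close> to be that of
  \<open>f\<close>.\<close>

lemma forest_level_determined:
  assumes f: "f \<in> forests" and g: "g \<in> forests"
    and inj: "inj_on (\<lambda>j. level f (g j) j) (supp g)"
    and img: "(\<lambda>j. level f (g j) j) ` supp g = supp f"
  shows "g = f"
proof -
  define s where "s = (\<lambda>j. level f (g j) j)"
  have gj: "0 < g j" "g j < j" if "j \<in> supp g" for j using g that by (auto simp: forests_def supp_def)
  have s0: "s j \<noteq> 0" if "j \<in> supp g" for j
  proof -
    have "s j \<in> supp f" using img that by (auto simp: s_def)
    then show ?thesis using f by (cases "s j = 0") (auto simp: supp_def forests_def)
  qed
  have sub: "supp g \<subseteq> supp f"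
  proof
    fix j assume j: "j \<in> supp g"
    then show "j \<in> supp f"
      using s0[OF j] gj[OF j]
      by (cases "f j = 0") (auto simp: supp_def s_def level_parent split: if_splits)
  qed
  have "card (supp g) = card (supp f)" using card_image[OF inj] img by simp
  then have eq: "supp g = supp f" using sub finite_supp[OF f] card_subset_eq by blast
  have "g j = f j" for j
  proof (cases "j \<in> supp g")
    case True
    have "s j = j"
    proof (rule inj_decreasing_id[of s "supp g"])
      fix j assume "j \<in> supp g"
      then show "s j \<le> j" using level_le[of f "g j" j] gj[of j] by (simp add: s_def)
    qed (use inj img eq True in \<open>auto simp: s_def\<close>)
    then show ?thesis using level_eq_label[of "g j" j f] gj[OF True] by (simp add: s_def)
  next
    case False
    then have "j \<notin> supp f" using eq by simp
    with False show ?thesis by (simp add: supp_def)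
  qed
  then show ?thesis by auto
qed

lemma coef_forest_mono:
  assumes f: "f \<in> forests" and g: "g \<in> forests"
  shows "coef f (forest_mono g) = (if f = g then 1 else 0)"
proof -
  define xs where "xs = sorted_list_of_set (supp g)"
  have set_xs: "set xs = supp g" by (simp add: xs_def finite_supp g)
  have coef: "coef f (forest_mono g) = (if 0 \<in> (\<lambda>j. level f (g j) j) ` supp g then 0
      else ext_prod (map (\<lambda>j. level f (g j) j) xs) (supp f))"
    unfolding coef_def forest_mono_def xs_def[symmetric]
    using forest_edges[OF g] by (subst ext_push_prod) (auto simp: finite_disc_gens set_xs image_image comp_def)
  show ?thesis
  proof (cases "f = g")
    case True
    have lev: "level f (f j) j = j" "j \<noteq> 0" if "j \<in> supp g" for j
    proof -
      have "0 < f j" "f j < j" using that f True by (auto simp: supp_def forests_def)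
      then show "level f (f j) j = j" "j \<noteq> 0" by (auto simp: level_parent)
    qed
    then have "map (\<lambda>j. level f (g j) j) xs = xs"
      by (intro map_idI) (simp add: set_xs True)
    \<comment> \<open>On its own forest every edge is sent to its label, and the edges are listed by
      increasing label, so no sign appears.\<close>
    moreover have "0 \<notin> (\<lambda>j. level f (g j) j) ` supp g" using lev True by force
    moreover have "ext_prod xs = ext_basis (set xs)"
      by (rule ext_prod_sorted) (simp add: xs_def)
    ultimately show ?thesis unfolding coef using True by (simp add: set_xs ext_basis_def)
  next
    case False
    then have "ext_prod (map (\<lambda>j. level f (g j) j) xs) (supp f) = 0"
      using ext_prod_nonzero[of "map (\<lambda>j. level f (g j) j) xs" "supp f"]
        forest_level_determined[OF f g] by (auto simp: distinct_map set_xs)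
    then show ?thesis using False by (simp add: coef)
  qed
qed

end

section \<open>Multiplying a forest monomial by a generator\<close>

lemma ext_gen_insert:
  "ext_gen g \<odot> ext_prod (gs @ hs) = (-1) ^ length gs \<bullet> ext_prod (gs @ g # hs)"
proof (induction gs)
  case Nil
  then show ?case by (simp add: ext_scale_simps)
next
  case (Cons a gs)
  have "ext_gen g \<odot> ext_prod ((a # gs) @ hs) = - (ext_gen a \<odot> (ext_gen g \<odot> ext_prod (gs @ hs)))"
    using ext_gen_times_commute[of g a] ext_times_distrib(5)[of "-1"]
    by (simp add: ext_scale_simps flip: ext_times_assoc)
  also have "\<dots> = (-1) \<bullet> (-1) ^ length gs \<bullet> ext_prod ((a # gs) @ g # hs)"
    by (simp only: Cons.IH ext_times_distrib ext_scale_simps(5) append_Cons ext_prod_simps)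
  finally show ?case by (simp only: ext_scale_simps list.size power_Suc add_0_right add_Suc_right)
qed

text \<open>The same two lists describe the set with and without \<open>j\<close>, so monomials that
  differ only at \<open>j\<close> can be compared factor by factor.\<close>

lemma sorted_list_split:
  fixes A :: "nat set"
  assumes "finite A"
  obtains as bs where "sorted_list_of_set (A - {j}) = as @ bs"
    "sorted_list_of_set (insert j A) = as @ j # bs" "length as = card {i \<in> A. i < j}"
proof -
  define as bs where "as = sorted_list_of_set {i \<in> A. i < j}" and "bs = sorted_list_of_set {i \<in> A. j < i}"
  have fin: "finite {i \<in> A. i < j}" "finite {i \<in> A. j < i}" using assms by auto
  have set_ins: "set (sorted_list_of_set (insert j A)) = insert j A"
    by (rule set_sorted_list_of_set) (simp add: assms)
  have "sorted_list_of_set (A - {j}) = as @ bs"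
    by (rule sorted_distinct_set_unique) (use assms fin in \<open>auto simp: as_def bs_def sorted_append\<close>)
  moreover have "sorted_list_of_set (insert j A) = as @ j # bs"
    by (rule sorted_distinct_set_unique[OF sorted_sorted_list_of_set distinct_sorted_list_of_set])
      (use fin in \<open>auto simp: as_def bs_def sorted_append set_ins simp del: sorted_list_of_set_insert_remove\<close>)
  moreover have "length as = card {i \<in> A. i < j}" by (simp add: as_def)
  ultimately show ?thesis by (rule that)
qed

context discriminantal
begin

lemma ext_prod_append:
  "set hs \<subseteq> gens \<Longrightarrow> ext_prod (gs @ hs) = ext_prod gs \<odot> ext_prod hs"
  by (induction gs) (auto simp: one_times ext_prod_closed ext_times_assoc)

text \<open>Brings the new generator next to the factor with which it interacts, so that a relation
  can be applied in place.\<close>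

lemma gen_times_ext_prod:
  assumes "set hs \<subseteq> gens" "g \<in> gens"
  shows "ext_gen g \<odot> ext_prod (gs @ hs) = (-1) ^ length gs \<bullet> ext_prod gs \<odot> (ext_gen g \<odot> ext_prod hs)"
  unfolding ext_gen_insert using ext_prod_append[of "g # hs" gs] assms by (simp add: ext_times_distrib)

lemma forests_update: "f \<in> forests \<Longrightarrow> (k, j) \<in> gens \<Longrightarrow> f(j := k) \<in> forests"
  by (auto simp: forests_def gens_iff)

lemma supp_update: "0 < k \<Longrightarrow> supp (f(j := k)) = insert j (supp f)"
  by (auto simp: supp_def)

text \<open>The flanking factors do not depend on the parent \<open>k\<close>: changing the parent
  of \<open>j\<close> changes one factor and keeps its place.\<close>

lemma forest_mono_split:
  assumes "f \<in> forests" "j \<in> supp f"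
  obtains gs hs where "set gs \<subseteq> gens" "set hs \<subseteq> gens"
    "\<And>k. 0 < k \<Longrightarrow> forest_mono (f(j := k)) = ext_prod (gs @ (k, j) # hs)"
proof -
  obtain as bs where *: "sorted_list_of_set (supp f - {j}) = as @ bs"
    "sorted_list_of_set (insert j (supp f)) = as @ j # bs"
    by (rule sorted_list_split[OF finite_supp[OF assms(1)], of j])
  have "set (as @ bs) = supp f - {j}" unfolding *(1)[symmetric] by (simp add: finite_supp assms)
  then have as_bs: "set as \<union> set bs = supp f - {j}" by simp
  show ?thesis
  proof
    show "set (map (\<lambda>i. (f i, i)) as) \<subseteq> gens" "set (map (\<lambda>i. (f i, i)) bs) \<subseteq> gens"
      using as_bs forest_edges[OF assms(1)] by auto
    fix k :: nat assume k: "0 < k"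
    have "map (\<lambda>i. ((f(j := k)) i, i)) as = map (\<lambda>i. (f i, i)) as"
      "map (\<lambda>i. ((f(j := k)) i, i)) bs = map (\<lambda>i. (f i, i)) bs"
      using as_bs by auto
    then show "forest_mono (f(j := k)) =
        ext_prod (map (\<lambda>i. (f i, i)) as @ (k, j) # map (\<lambda>i. (f i, i)) bs)"
      unfolding forest_mono_def supp_update[OF k] *(2) by (simp only: map_append list.map fun_upd_same)
  qed
qed

lemma gen_times_new_edge:
  assumes "f \<in> forests" "f j = 0" "0 < k"
  shows "ext_gen (k, j) \<odot> forest_mono f = (-1) ^ card {i \<in> supp f. i < j} \<bullet> forest_mono (f(j := k))"
proof -
  obtain as bs where *: "sorted_list_of_set (supp f - {j}) = as @ bs"
    "sorted_list_of_set (insert j (supp f)) = as @ j # bs" "length as = card {i \<in> supp f. i < j}"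
    by (rule sorted_list_split[OF finite_supp[OF assms(1)], of j])
  have j: "supp f - {j} = supp f" using assms(2) by (auto simp: supp_def)
  have "set (as @ bs) = supp f - {j}" unfolding *(1)[symmetric] by (simp add: finite_supp assms)
  then have "map (\<lambda>i. ((f(j := k)) i, i)) as = map (\<lambda>i. (f i, i)) as"
    "map (\<lambda>i. ((f(j := k)) i, i)) bs = map (\<lambda>i. (f i, i)) bs"
    by auto
  then have "forest_mono (f(j := k)) = ext_prod (map (\<lambda>i. (f i, i)) as @ (k, j) # map (\<lambda>i. (f i, i)) bs)"
    unfolding forest_mono_def supp_update[OF assms(3)] *(2) by (simp only: map_append list.map fun_upd_same)
  moreover have "forest_mono f = ext_prod (map (\<lambda>i. (f i, i)) as @ map (\<lambda>i. (f i, i)) bs)"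
    using *(1) by (simp add: forest_mono_def j)
  ultimately show ?thesis
    using ext_gen_insert[of "(k, j)" "map (\<lambda>i. (f i, i)) as"]
    by (simp add: *(3))
qed

lemma gen_times_same_edge:
  assumes "f \<in> forests" "j \<in> supp f"
  shows "ext_gen (f j, j) \<odot> forest_mono f = 0"
proof -
  obtain gs hs where "set gs \<subseteq> gens" "set hs \<subseteq> gens"
    "\<And>k. 0 < k \<Longrightarrow> forest_mono (f(j := k)) = ext_prod (gs @ (k, j) # hs)"
    using forest_mono_split[OF assms] by blast
  from this(3)[of "f j"] have f: "forest_mono f = ext_prod (gs @ (f j, j) # hs)"
    using assms(2) by (simp add: supp_def)
  have "ext_gen (f j, j) \<odot> (ext_gen (f j, j) \<odot> x) = 0" for x
    by (simp add: ext_gen_times_self flip: ext_times_assoc)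
  moreover have "ext_prod (gs @ (f j, j) # (f j, j) # hs) = ext_prod gs \<odot> ext_prod ((f j, j) # (f j, j) # hs)"
    using \<open>set hs \<subseteq> gens\<close> forest_edges[OF assms] by (intro ext_prod_append) auto
  ultimately show ?thesis by (simp add: f ext_gen_insert ext_scale_simps)
qed

lemma gen_times_parallel_edge:
  assumes f: "f \<in> forests" and j: "j \<in> supp f" and k: "(k, j) \<in> gens" "k \<noteq> f j" and le: "max k (f j) \<le> l"
  shows "cl (ext_gen (k, j) \<odot> forest_mono f) = cl 0"
proof -
  obtain gs hs where gens: "set gs \<subseteq> gens" "set hs \<subseteq> gens"
    and split: "\<And>k. 0 < k \<Longrightarrow> forest_mono (f(j := k)) = ext_prod (gs @ (k, j) # hs)"
    using forest_mono_split[OF f j] by blast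
  have fj: "(f j, j) \<in> gens" using forest_edges[OF f j] .
  have eq: "ext_gen (k, j) \<odot> forest_mono f = (-1) ^ length gs \<bullet> ext_prod gs \<odot>
      ((ext_gen (k, j) \<odot> ext_gen (f j, j)) \<odot> ext_prod hs)"
    using split[of "f j"] j gens fj k gen_times_ext_prod[of "(f j, j) # hs" "(k, j)" gs]
    by (simp add: supp_def ext_times_assoc)
  have "cl ((ext_gen (k, j) \<odot> ext_gen (f j, j)) \<odot> ext_prod hs) = cl (0 \<odot> ext_prod hs)"
    by (rule cl_cong(2)) (use relation_parallel[of j "f j" k] k fj le gens in
        \<open>auto simp: E_closed gens_iff ext_prod_closed\<close>)
  then have "cl ((-1) ^ length gs \<bullet> ext_prod gs \<odot>
      ((ext_gen (k, j) \<odot> ext_gen (f j, j)) \<odot> ext_prod hs)) = cl ((-1) ^ length gs \<bullet> ext_prod gs \<odot> 0)"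
    by - (rule cl_cong(2), use k fj gens in \<open>auto simp: E_closed ext_prod_closed\<close>)
  then show ?thesis by (simp add: eq)
qed

text \<open>The generator is moved next to \<open>(f j, j)\<close>, the three-term relation is
  applied, and the resulting edge is moved back to the front. Both moves pass the factors
  \<open>gs\<close>, so the two signs cancel.\<close>

lemma gen_times_replace_edge:
  assumes f: "f \<in> forests" and j: "j \<in> supp f" and k: "(k, j) \<in> gens" "k \<noteq> f j" and gt: "l < max k (f j)"
  shows "cl (ext_gen (k, j) \<odot> forest_mono f) =
    cl (ext_gen (min k (f j), max k (f j)) \<odot> (forest_mono f - forest_mono (f(j := k))))"
proof -
  obtain gs hs where gens: "set gs \<subseteq> gens" "set hs \<subseteq> gens"
    and split: "\<And>k. 0 < k \<Longrightarrow> forest_mono (f(j := k)) = ext_prod (gs @ (k, j) # hs)"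
    using forest_mono_split[OF f j] by blast
  define g where "g = (min k (f j), max k (f j))"
  have fj: "(f j, j) \<in> gens" using forest_edges[OF f j] .
  have g: "g \<in> gens" using k fj gt by (auto simp: g_def gens_iff)
  have mono: "forest_mono f = ext_prod (gs @ (f j, j) # hs)" "forest_mono (f(j := k)) = ext_prod (gs @ (k, j) # hs)"
    using split[of "f j"] split[of k] j k by (simp_all add: supp_def gens_iff)
  have g_closed: "ext_gen g \<in> carrier E" using g by (simp add: g_def E_closed)
  define c where "c = ((-1) ^ length gs :: complex)"
  have eq: "ext_gen (k, j) \<odot> forest_mono f = c \<bullet> ext_prod gs \<odot>
      ((ext_gen (k, j) \<odot> ext_gen (f j, j)) \<odot> ext_prod hs)"
    using gens fj k gen_times_ext_prod[of "(f j, j) # hs" "(k, j)" gs]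
    by (simp add: mono ext_times_assoc c_def)
  have "ext_gen g \<odot> forest_mono (f(j := k)) = c \<bullet> ext_prod gs \<odot> (ext_gen g \<odot> (ext_gen (k, j) \<odot> ext_prod hs))"
    "ext_gen g \<odot> forest_mono f = c \<bullet> ext_prod gs \<odot> (ext_gen g \<odot> (ext_gen (f j, j) \<odot> ext_prod hs))"
    using gens fj k g by (simp_all add: mono gen_times_ext_prod c_def)
  then have eq': "ext_gen g \<odot> (forest_mono f - forest_mono (f(j := k))) = c \<bullet> ext_prod gs \<odot>
      ((ext_gen g \<odot> (ext_gen (f j, j) - ext_gen (k, j))) \<odot> ext_prod hs)"
    by (simp add: ext_times_distrib ext_times_assoc)
  have "cl (ext_gen (k, j) \<odot> ext_gen (f j, j)) = cl (ext_gen g \<odot> (ext_gen (f j, j) - ext_gen (k, j)))"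
    using relation_triple[of j "f j" k] k fj gt by (simp add: g_def gens_iff max.commute min.commute)
  then have "cl ((ext_gen (k, j) \<odot> ext_gen (f j, j)) \<odot> ext_prod hs) =
      cl ((ext_gen g \<odot> (ext_gen (f j, j) - ext_gen (k, j))) \<odot> ext_prod hs)"
    by - (rule cl_cong(2), use k fj gens g_closed in \<open>auto simp: E_closed ext_prod_closed\<close>)
  then have "cl (c \<bullet> ext_prod gs \<odot> ((ext_gen (k, j) \<odot> ext_gen (f j, j)) \<odot> ext_prod hs)) =
      cl (c \<bullet> ext_prod gs \<odot> ((ext_gen g \<odot> (ext_gen (f j, j) - ext_gen (k, j))) \<odot> ext_prod hs))"
    by - (rule cl_cong(2), use k fj gens g_closed in \<open>auto simp: E_closed ext_prod_closed\<close>)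
  then show ?thesis by (simp only: eq eq' flip: g_def)
qed

section \<open>Spans of basis elements\<close>

definition lin_comb :: "(nat \<Rightarrow> nat) set \<Rightarrow> ((nat \<Rightarrow> nat) \<Rightarrow> complex) \<Rightarrow> (nat \<times> nat) set \<Rightarrow> complex" where
  "lin_comb X c = (\<Sum>f\<in>X. c f \<bullet> forest_mono f)"

definition os_span :: "(nat \<Rightarrow> nat) set \<Rightarrow> ((nat \<times> nat) set \<Rightarrow> complex) set set" where
  "os_span X = {cl (lin_comb X c) | c. True}"

lemma lin_comb_closed: "X \<subseteq> forests \<Longrightarrow> lin_comb X c \<in> carrier E"
  unfolding lin_comb_def by (intro E_sum_closed E_closed forest_mono_closed) auto

lemma finite_subset_forests: "X \<subseteq> forests \<Longrightarrow> finite X"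
  using finite_forests finite_subset by blast

lemma coef_lin_comb:
  assumes "X \<subseteq> forests" "f \<in> forests"
  shows "coef f (lin_comb X c) = (if f \<in> X then c f else 0)"
proof -
  have "coef f (lin_comb X c) = (\<Sum>g\<in>X. if g = f then c g else 0)"
    unfolding lin_comb_def coef_sum coef_linear
    by (rule sum.cong) (use assms coef_forest_mono[OF assms(2)] in auto)
  then show ?thesis using finite_subset_forests[OF assms(1)] by simp
qed

lemma lin_comb_cong: "(\<And>f. f \<in> X \<Longrightarrow> c f = d f) \<Longrightarrow> lin_comb X c = lin_comb X d"
  unfolding lin_comb_def by (rule sum.cong) auto

lemma lin_comb_Un:
  "X \<subseteq> forests \<Longrightarrow> Y \<subseteq> forests \<Longrightarrow> X \<inter> Y = {} \<Longrightarrow> lin_comb (X \<union> Y) c = lin_comb X c + lin_comb Y c"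
  unfolding lin_comb_def by (intro sum.union_disjoint finite_subset_forests)

lemma lin_comb_extend:
  assumes "X \<subseteq> Y" "Y \<subseteq> forests" "\<And>f. f \<in> Y \<Longrightarrow> f \<notin> X \<Longrightarrow> c f = 0"
  shows "lin_comb Y c = lin_comb X c"
  unfolding lin_comb_def
  by (rule sum.mono_neutral_right) (use assms finite_subset_forests in \<open>auto simp: ext_scale_simps\<close>)

lemma lin_comb_combine: "lin_comb X (\<lambda>f. a * c f + b * d f) = a \<bullet> lin_comb X c + b \<bullet> lin_comb X d"
  unfolding lin_comb_def ext_scale_sum sum.distrib[symmetric] ext_scale_distrib ext_scale_simps ..

lemma os_span_combine:
  assumes "X \<subseteq> forests" "x \<in> carrier E" "y \<in> carrier E" "cl x \<in> os_span X" "cl y \<in> os_span X"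
  shows "cl (a \<bullet> x + b \<bullet> y) \<in> os_span X"
proof -
  obtain c d where "cl x = cl (lin_comb X c)" "cl y = cl (lin_comb X d)"
    using assms by (auto simp: os_span_def)
  then have "cl (a \<bullet> x + b \<bullet> y) = cl (a \<bullet> lin_comb X c + b \<bullet> lin_comb X d)"
    using assms cl_smult[of _ a] cl_smult[of _ b]
    by (intro cl_cong) (metis E_closed(6) lin_comb_closed)+
  then show ?thesis by (auto simp: os_span_def lin_comb_combine[symmetric])
qed

lemma os_span_zero: "cl 0 \<in> os_span X"
  unfolding os_span_def by (rule CollectI, rule exI[of _ "\<lambda>_. 0"]) (simp add: lin_comb_def ext_scale_simps)

lemma os_span_sum:
  assumes X: "X \<subseteq> forests" and "\<And>i. i \<in> M \<Longrightarrow> x i \<in> carrier E \<and> cl (x i) \<in> os_span X"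
  shows "cl (\<Sum>i\<in>M. c i \<bullet> x i) \<in> os_span X"
  using assms(2)
proof (induction M rule: infinite_finite_induct)
  case (insert i M)
  then have "cl (c i \<bullet> x i + 1 \<bullet> (\<Sum>i\<in>M. c i \<bullet> x i)) \<in> os_span X"
    by (intro os_span_combine[OF X] E_sum_closed E_closed) auto
  then show ?case using insert by (simp only: ext_scale_simps sum.insert not_False_eq_True)
qed (simp_all only: sum.infinite sum.empty os_span_zero not_False_eq_True)

lemma os_span_mono:
  assumes "X \<subseteq> Y" "Y \<subseteq> forests"
  shows "os_span X \<subseteq> os_span Y"
proof
  fix u assume "u \<in> os_span X"
  then obtain c where u: "u = cl (lin_comb X c)" by (auto simp: os_span_def)
  have "lin_comb Y (\<lambda>f. if f \<in> X then c f else 0) = lin_comb X (\<lambda>f. if f \<in> X then c f else 0)"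
    by (rule lin_comb_extend[OF assms]) auto
  also have "\<dots> = lin_comb X c" by (rule lin_comb_cong) auto
  finally have "u = cl (lin_comb Y (\<lambda>f. if f \<in> X then c f else 0))" by (simp only: u)
  then show "u \<in> os_span Y" unfolding os_span_def by blast
qed

lemma os_span_forest_mono:
  assumes "f \<in> X" "X \<subseteq> forests"
  shows "cl (forest_mono f) \<in> os_span X"
proof -
  have "cl (forest_mono f) = cl (lin_comb {f} (\<lambda>_. 1))" by (simp add: lin_comb_def ext_scale_simps)
  then have "cl (forest_mono f) \<in> os_span {f}" unfolding os_span_def by blast
  then show ?thesis using os_span_mono[of "{f}" X] assms by blast
qed

text \<open>Membership in the span says that some expansion exists; the dual functionals identify
  its coefficients.\<close>

lemma cl_eq_lin_comb_coef:
  assumes "cl x \<in> os_span X" "X \<subseteq> Y" "Y \<subseteq> forests" "x \<in> carrier E"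
  shows "cl x = cl (lin_comb Y (\<lambda>f. coef f x))"
proof -
  have "cl x \<in> os_span Y" using os_span_mono[OF assms(2,3)] assms(1) by blast
  then obtain c where c: "cl x = cl (lin_comb Y c)" by (auto simp: os_span_def)
  have "coef f x = c f" if "f \<in> Y" for f
    using coef_cong[OF _ assms(4) lin_comb_closed[OF assms(3)] c, of f] coef_lin_comb[OF assms(3), of f]
      that assms(3) by auto
  then show ?thesis using lin_comb_cong[of Y "\<lambda>f. coef f x" c] c by simp
qed

text \<open>Disjoint sets of forests span independent subspaces: \<open>coef f\<close> for
  \<open>f\<close> in \<open>X\<close> sees nothing of \<open>Y\<close> and thus determines the
  component in the span of \<open>X\<close>.\<close>

lemma proj_along_os_span:
  assumes X: "X \<subseteq> forests" and Y: "Y \<subseteq> forests" and XY: "X \<inter> Y = {}"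
  shows "proj_along A (os_span X) (os_span Y) (cl (lin_comb (X \<union> Y) c)) = cl (lin_comb X c)"
  unfolding proj_along_def
proof (rule the_equality)
  show "cl (lin_comb X c) \<in> os_span X \<and>
      (\<exists>w\<in>os_span Y. cl (lin_comb (X \<union> Y) c) = cl (lin_comb X c) \<oplus>\<^bsub>A\<^esub> w)"
    unfolding lin_comb_Un[OF assms] cl_simps(2)[OF lin_comb_closed[OF X] lin_comb_closed[OF Y], symmetric]
    by (auto simp: os_span_def)
next
  fix u assume "u \<in> os_span X \<and> (\<exists>w\<in>os_span Y. cl (lin_comb (X \<union> Y) c) = u \<oplus>\<^bsub>A\<^esub> w)"
  then obtain d e where u: "u = cl (lin_comb X d)"
    and eq: "cl (lin_comb (X \<union> Y) c) = cl (lin_comb X d) \<oplus>\<^bsub>A\<^esub> cl (lin_comb Y e)"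
    by (auto simp: os_span_def)
  from eq have eq: "cl (lin_comb (X \<union> Y) c) = cl (lin_comb X d + lin_comb Y e)"
    by (simp add: cl_simps lin_comb_closed X Y)
  have "d f = c f" if "f \<in> X" for f
  proof -
    have f: "f \<in> forests" "f \<notin> Y" using that X XY by auto
    have "coef f (lin_comb (X \<union> Y) c) = coef f (lin_comb X d + lin_comb Y e)"
      using eq X Y f by (intro coef_cong) (auto simp: lin_comb_closed E_closed)
    then show ?thesis using that f X Y by (simp add: coef_linear coef_lin_comb)
  qed
  then show "u = cl (lin_comb X c)" unfolding u using lin_comb_cong[of X d c] by simp
qed

lemma subspace_sum_os_span:
  assumes fin: "finite M" and sub: "\<And>i. i \<in> M \<Longrightarrow> X i \<subseteq> forests"
    and disj: "\<And>i j. i \<in> M \<Longrightarrow> j \<in> M \<Longrightarrow> i \<noteq> j \<Longrightarrow> X i \<inter> X j = {}"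
    and V: "\<And>i. i \<in> M \<Longrightarrow> V i = os_span (X i)"
  shows "subspace_sum A M V = os_span (\<Union>i\<in>M. X i)"
proof
  have U: "(\<Union>i\<in>M. X i) \<subseteq> forests" using sub by auto
  show "subspace_sum A M V \<subseteq> os_span (\<Union>i\<in>M. X i)"
  proof
    fix u assume "u \<in> subspace_sum A M V"
    then obtain v where u: "u = finsum A v M" and v: "\<And>i. i \<in> M \<Longrightarrow> v i \<in> os_span (X i)"
      using V by (auto simp: subspace_sum_def)
    from v have "\<forall>i\<in>M. \<exists>c. v i = cl (lin_comb (X i) c)" by (auto simp: os_span_def)
    then obtain c where c: "\<And>i. i \<in> M \<Longrightarrow> v i = cl (lin_comb (X i) (c i))" by metis
    have "u = (\<Oplus>\<^bsub>A\<^esub>i\<in>M. cl (lin_comb (X i) (c i)))"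
      unfolding u by (rule A.finsum_cong') (use c sub in \<open>auto simp: cl_simps lin_comb_closed\<close>)
    also have "\<dots> = cl (\<Sum>i\<in>M. 1 \<bullet> lin_comb (X i) (c i))"
      using sub by (simp add: cl_finsum[OF fin] lin_comb_closed ext_scale_simps)
    also have "\<dots> \<in> os_span (\<Union>i\<in>M. X i)"
    proof (rule os_span_sum[OF U], safe)
      fix i assume i: "i \<in> M"
      show "lin_comb (X i) (c i) \<in> carrier E" using sub[OF i] by (rule lin_comb_closed)
      have "os_span (X i) \<subseteq> os_span (\<Union>i\<in>M. X i)" by (rule os_span_mono) (use i U in auto)
      then show "cl (lin_comb (X i) (c i)) \<in> os_span (\<Union>i\<in>M. X i)" by (auto simp: os_span_def)
    qed
    finally show "u \<in> os_span (\<Union>i\<in>M. X i)" .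
  qed
  show "os_span (\<Union>i\<in>M. X i) \<subseteq> subspace_sum A M V"
  proof
    fix u assume "u \<in> os_span (\<Union>i\<in>M. X i)"
    then obtain c where u: "u = cl (lin_comb (\<Union>i\<in>M. X i) c)" by (auto simp: os_span_def)
    have "lin_comb (\<Union>i\<in>M. X i) c = (\<Sum>i\<in>M. lin_comb (X i) c)"
      unfolding lin_comb_def
      by (rule sum.UNION_disjoint) (use fin sub disj finite_subset_forests in auto)
    then have "u = (\<Oplus>\<^bsub>A\<^esub>i\<in>M. cl (lin_comb (X i) c))"
      using sub by (simp add: u cl_finsum[OF fin] lin_comb_closed)
    moreover have "(\<lambda>i. cl (lin_comb (X i) c)) \<in> (\<Pi> i\<in>M. V i)" using V by (auto simp: os_span_def)
    ultimately show "u \<in> subspace_sum A M V" unfolding subspace_sum_def by blast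
  qed
qed

section \<open>Products of a generator and a forest lie in the span of larger forests\<close>

definition extensions :: "(nat \<Rightarrow> nat) \<Rightarrow> (nat \<Rightarrow> nat) set" where
  "extensions f = {g \<in> forests. \<exists>j. j \<notin> supp f \<and> supp g = insert j (supp f)}"

text \<open>Replacing an edge leads to a generator with upper end \<open>max k (f j) < j\<close>,
  but also to the changed forest \<open>f(j := k)\<close>; hence the induction on \<open>j\<close>
  for all \<open>f\<close>. \<open>extensions\<close> constrains only the support, which this change
  preserves.\<close>

lemma gen_times_in_span:
  assumes "f \<in> forests" "(k, j) \<in> gens"
  shows "cl (ext_gen (k, j) \<odot> forest_mono f) \<in> os_span (extensions f)"
  using assms
proof (induction j arbitrary: k f rule: less_induct)
  case (less j)
  have ext: "extensions f \<subseteq> forests" for f by (auto simp: extensions_def)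
  have k: "0 < k" using less.prems by (simp add: gens_iff)
  show ?case
  proof (cases "f j = 0")
    case True
    have "f(j := k) \<in> extensions f"
      using less.prems True by (auto simp: extensions_def forests_update supp_update k) (auto simp: supp_def)
    then have "cl (forest_mono (f(j := k))) \<in> os_span (extensions f)"
      using ext by (intro os_span_forest_mono) 
    then have "cl (c \<bullet> forest_mono (f(j := k)) + 0 \<bullet> 0) \<in> os_span (extensions f)" for c
      using less.prems by (intro os_span_combine[OF ext]) (auto simp: os_span_zero E_closed forests_update forest_mono_closed)
    then show ?thesis using gen_times_new_edge[OF less.prems(1) True k] by (simp add: ext_scale_simps)
  next
    case False
    then have j: "j \<in> supp f" by (simp add: supp_def)
    show ?thesis
    proof (cases "k = f j")
      case True
      show ?thesis unfolding True gen_times_same_edge[OF less.prems(1) j] by (rule os_span_zero)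
    next
      case neq: False
      show ?thesis
      proof (cases "max k (f j) \<le> l")
        case True
        then show ?thesis using gen_times_parallel_edge[OF less.prems(1) j less.prems(2) neq]
          by (simp add: os_span_zero)
      next
        case gt: False
        define g where "g = (min k (f j), max k (f j))"
        have fj: "(f j, j) \<in> gens" using forest_edges[OF less.prems(1) j] .
        have g: "g \<in> gens" "snd g < j" using less.prems(2) fj gt neq by (auto simp: g_def gens_iff)
        have f': "f(j := k) \<in> forests" using less.prems by (rule forests_update)
        have "extensions (f(j := k)) = extensions f" using j by (auto simp: extensions_def supp_update k insert_absorb)
        moreover have "cl (ext_gen g \<odot> forest_mono f) \<in> os_span (extensions f)"
          using less.IH[of "snd g" f "fst g"] g less.prems by simp
        moreover have "cl (ext_gen g \<odot> forest_mono (f(j := k))) \<in> os_span (extensions (f(j := k)))"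
          using less.IH[of "snd g" "f(j := k)" "fst g"] g f' by (simp del: fun_upd_apply)
        ultimately have "cl (1 \<bullet> (ext_gen g \<odot> forest_mono f) + (-1) \<bullet> (ext_gen g \<odot> forest_mono (f(j := k))))
            \<in> os_span (extensions f)"
          using g less.prems f'
          by (intro os_span_combine[OF ext]) (auto simp: g_def E_closed forest_mono_closed)
        then show ?thesis
          using gen_times_replace_edge[OF less.prems(1) j less.prems(2) neq] gt
          by (simp add: g_def ext_scale_simps ext_times_distrib)
      qed
    qed
  qed
qed

end

section \<open>Admissible families\<close>

text \<open>Removing the last index gives the recursive form of admissibility: \<open>K'\<close> is
  \<open>K\<close> without its entry at \<open>p\<close>, and the pair at \<open>p\<close> is linked
  to the entry and the label at the last index \<open>s\<close> of \<open>K'\<close>.\<close>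

lemma admissible_iff:
  "admissible l m J I p K \<longleftrightarrow> 1 \<le> p \<and>
    ((\<exists>k. K = [p \<mapsto> k] \<and> {k, I p} = {m, l + 1}) \<or>
     (\<exists>s K' k. s < p \<and> admissible l m J I s K' \<and> p \<notin> dom K' \<and> K = K'(p \<mapsto> k) \<and>
        {k, I p} = {the (K' s), jth J s}))" (is "?L \<longleftrightarrow> ?R")
proof
  assume ?L
  then obtain ss where ss: "ss \<noteq> []" "sorted_wrt (<) ss" "1 \<le> hd ss" "last ss = p" "dom K = set ss"
    and h: "{the (K (hd ss)), I (hd ss)} = {m, l + 1}"
    and st: "\<And>u. 1 \<le> u \<Longrightarrow> u < length ss \<Longrightarrow>
           {the (K (ss ! u)), I (ss ! u)} = {the (K (ss ! (u - 1))), jth J (ss ! (u - 1))}"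
    unfolding admissible_def by blast
  obtain xs where xs: "ss = xs @ [p]" using ss(1,4) by (metis append_butlast_last_id)
  have less: "\<forall>x\<in>set xs. x < p" using ss(2) by (simp add: xs sorted_wrt_append)
  have "p \<in> dom K" using ss(5) xs by simp
  then obtain k where k: "K p = Some k" by blast
  show ?R
  proof (cases "xs = []")
    case True
    then have "dom K = {p}" using ss xs by simp
    then have "K = [p \<mapsto> k]" using k by (auto simp: fun_eq_iff domIff)
    then show ?thesis using ss(3) h True xs by auto
  next
    case False
    define s where "s = last xs"
    define K' where "K' = K(p := None)"
    have K': "K' x = K x" if "x \<in> set xs" for x using less that by (auto simp: K'_def)
    have "1 \<le> hd xs" using ss(3) False xs by simp
    moreover have "hd xs < p" using less False by simp
    moreover have "dom K' = set xs" using ss(5) xs less by (auto simp: K'_def)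
    moreover have "{the (K' (hd xs)), I (hd xs)} = {m, l + 1}" using h False xs K'[of "hd xs"] by simp
    moreover have "{the (K' (xs ! u)), I (xs ! u)} = {the (K' (xs ! (u - 1))), jth J (xs ! (u - 1))}"
      if "1 \<le> u" "u < length xs" for u
    proof -
      have "u - 1 < length xs" using that by simp
      then show ?thesis
        using st[of u] that K'[of "xs ! u"] K'[of "xs ! (u - 1)"] by (simp add: xs nth_append)
    qed
    ultimately have "admissible l m J I s K'"
      using ss(2) False unfolding admissible_def s_def
      by (intro exI[of _ xs]) (auto simp: xs sorted_wrt_append)
    moreover have "{k, I p} = {the (K' s), jth J s}"
      using st[of "length xs"] False k K'[of s] by (simp add: xs nth_append s_def last_conv_nth Suc_le_eq)
    moreover have "K = K'(p \<mapsto> k)" using k by (auto simp: K'_def fun_eq_iff)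
    moreover have "s < p" using less False by (simp add: s_def)
    moreover have "p \<notin> dom K'" by (simp add: K'_def domIff)
    ultimately show ?thesis using \<open>1 \<le> hd xs\<close> \<open>hd xs < p\<close> by fastforce
  qed
next
  assume ?R
  then have p: "1 \<le> p" by blast
  from \<open>?R\<close> consider (single) k where "K = [p \<mapsto> k]" "{k, I p} = {m, l + 1}"
    | (step) s K' k where "s < p" "admissible l m J I s K'" "p \<notin> dom K'" "K = K'(p \<mapsto> k)"
      "{k, I p} = {the (K' s), jth J s}" by blast
  then show ?L
  proof cases
    case single
    then show ?thesis unfolding admissible_def using p by (intro exI[of _ "[p]"]) auto
  next
    case step
    from step(2) obtain xs where xs: "xs \<noteq> []" "sorted_wrt (<) xs" "1 \<le> hd xs" "last xs = s" "dom K' = set xs"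
      and h: "{the (K' (hd xs)), I (hd xs)} = {m, l + 1}"
      and st: "\<And>u. 1 \<le> u \<Longrightarrow> u < length xs \<Longrightarrow>
             {the (K' (xs ! u)), I (xs ! u)} = {the (K' (xs ! (u - 1))), jth J (xs ! (u - 1))}"
      unfolding admissible_def by blast
    have le: "x \<le> s" if "x \<in> set xs" for x
    proof -
      obtain ys where ys: "xs = ys @ [s]" using xs(1,4) by (metis append_butlast_last_id)
      then show ?thesis using xs(2) that by (auto simp: sorted_wrt_append)
    qed
    have K: "K x = K' x" if "x \<in> set xs" for x using le[OF that] step(1,4) by auto
    have "{the (K ((xs @ [p]) ! u)), I ((xs @ [p]) ! u)} =
        {the (K ((xs @ [p]) ! (u - 1))), jth J ((xs @ [p]) ! (u - 1))}"
      if u: "1 \<le> u" "u < length (xs @ [p])" for u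
    proof (cases "u = length xs")
      case True
      have "(xs @ [p]) ! (u - 1) = s" using True xs(1,4) u by (simp add: nth_append last_conv_nth)
      then show ?thesis using True step K[of s] xs(1,4) by (simp add: nth_append)
    next
      case False
      then have "u < length xs" "u - 1 < length xs" using u by simp_all
      then show ?thesis using u st[of u] K[of "xs ! u"] K[of "xs ! (u - 1)"] by (simp add: nth_append)
    qed
    moreover have "sorted_wrt (<) (xs @ [p])" using xs(2) le step(1) by (force simp: sorted_wrt_append)
    moreover have "{the (K (hd (xs @ [p]))), I (hd (xs @ [p]))} = {m, l + 1}"
      using h xs(1) K[of "hd xs"] by simp
    moreover have "dom K = set (xs @ [p])" using step(4) xs(5) by simp
    moreover have "1 \<le> hd (xs @ [p])" using xs(1,3) by simp
    ultimately show ?thesis unfolding admissible_def by (intro exI[of _ "xs @ [p]"]) auto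
  qed
qed

lemma admissible_cases:
  assumes "admissible l m J I p K"
  obtains (single) k where "1 \<le> p" "K = [p \<mapsto> k]" "{k, I p} = {m, l + 1}"
    | (step) s K' k where "1 \<le> p" "s < p" "admissible l m J I s K'" "p \<notin> dom K'" "K = K'(p \<mapsto> k)"
      "{k, I p} = {the (K' s), jth J s}"
  using assms unfolding admissible_iff[of l m J I p K] by blast

lemma admissible_single:
  "1 \<le> p \<Longrightarrow> {k, I p} = {m, l + 1} \<Longrightarrow> admissible l m J I p [p \<mapsto> k]"
  by (subst admissible_iff) blast

lemma admissible_step:
  "1 \<le> p \<Longrightarrow> s < p \<Longrightarrow> admissible l m J I s K \<Longrightarrow> p \<notin> dom K \<Longrightarrow> {k, I p} = {the (K s), jth J s} \<Longrightarrow>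
    admissible l m J I p (K(p \<mapsto> k))"
  by (subst admissible_iff) blast

lemma admissible_pos: "admissible l m J I p K \<Longrightarrow> 1 \<le> p"
  by (erule admissible_cases)

lemma admissible_dom:
  assumes "admissible l m J I p K"
  shows "p \<in> dom K" "dom K \<subseteq> {1..p}"
proof -
  have "p \<in> dom K \<and> dom K \<subseteq> {1..p}"
    using assms
  proof (induction p arbitrary: K rule: less_induct)
    case (less p)
    from less.prems show ?case
    proof (cases rule: admissible_cases)
      case (single k)
      show ?thesis unfolding single(2) using single(1) by (simp del: fun_upd_apply)
    next
      case (step s K' k)
      then have "dom K' \<subseteq> {1..s}" using less.IH by blast
      then have "dom K' \<subseteq> {1..p}" using step(2) by fastforce
      then show ?thesis unfolding step(5) using step(1) by (simp del: fun_upd_apply)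
    qed
  qed
  then show "p \<in> dom K" "dom K \<subseteq> {1..p}" by auto
qed

lemma admissible_cong_aux:
  assumes "admissible l m J I p K" "\<And>s. s \<le> p \<Longrightarrow> I s = I' s"
  shows "admissible l m J I' p K"
  using assms
proof (induction p arbitrary: K rule: less_induct)
  case (less p)
  from less.prems(1) show ?case
  proof (cases rule: admissible_cases)
    case (single k)
    show ?thesis unfolding single(2)
      by (rule admissible_single[OF single(1)]) (use single(3) less.prems(2)[of p] in simp)
  next
    case (step s K' k)
    then have "admissible l m J I' s K'" using less by simp
    then show ?thesis unfolding step(5)
      by (rule admissible_step[OF step(1,2) _ step(4)]) (use step(6) less.prems(2)[of p] in simp)
  qed
qed

text \<open>Changing the tuple at \<open>p\<close> leaves the admissible families ending before
  \<open>p\<close> untouched.\<close>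

lemma admissible_cong:
  "(\<And>s. s \<le> p \<Longrightarrow> I s = I' s) \<Longrightarrow> admissible l m J I p K \<longleftrightarrow> admissible l m J I' p K"
  using admissible_cong_aux[of l m J I p K I'] admissible_cong_aux[of l m J I' p K I] by auto

section \<open>Positions\<close>

context
  fixes J :: "nat set"
  assumes fin: "finite J"
begin

lemma jth_bij: "bij_betw (jth J) {1..card J} J"
proof -
  have "bij_betw (\<lambda>i. sorted_list_of_set J ! i) {..<card J} J"
    using bij_betw_nth[of "sorted_list_of_set J" "{..<card J}" J] fin by simp
  moreover have "bij_betw (\<lambda>p. p - 1) {1..card J} {..<card J}"
    by (rule bij_betw_byWitness[where f' = Suc]) auto
  ultimately have "bij_betw ((\<lambda>i. sorted_list_of_set J ! i) \<circ> (\<lambda>p. p - 1)) {1..card J} J"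
    by (rule bij_betw_trans[rotated])
  moreover have "(\<lambda>i. sorted_list_of_set J ! i) \<circ> (\<lambda>p. p - 1) = jth J"
    by (simp add: jth_def fun_eq_iff)
  ultimately show ?thesis by simp
qed

lemma jth_less_iff:
  assumes "s \<in> {1..card J}" "p \<in> {1..card J}"
  shows "jth J s < jth J p \<longleftrightarrow> s < p"
proof -
  have less: "jth J s < jth J p" if "s < p" "s \<in> {1..card J}" "p \<in> {1..card J}" for s p
    unfolding jth_def
    by (rule sorted_wrt_nth_less[OF strict_sorted_list_of_set]) (use that in auto)
  show ?thesis using less[of s p] less[of p s] assms by (metis less_asym less_irrefl nat_neq_iff)
qed

lemma jth_mem: "p \<in> {1..card J} \<Longrightarrow> jth J p \<in> J"
  using jth_bij by (auto simp: bij_betw_def)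

lemma jth_eq_iff: "s \<in> {1..card J} \<Longrightarrow> p \<in> {1..card J} \<Longrightarrow> jth J s = jth J p \<longleftrightarrow> s = p"
  using jth_bij by (auto simp: bij_betw_def inj_on_eq_iff)

lemma jth_obtain:
  assumes "j \<in> J"
  obtains p where "p \<in> {1..card J}" "j = jth J p"
proof -
  have "j \<in> jth J ` {1..card J}" using assms jth_bij by (simp add: bij_betw_def)
  then show ?thesis using that by blast
qed

lemma sorted_list_of_set_jth: "sorted_list_of_set J = map (jth J) [1..<Suc (card J)]"
  by (rule nth_equalityI) (simp_all add: jth_def fin del: upt_Suc)

end

text \<open>By induction the preceding entry is smaller than its label \<open>jth J s\<close>, which
  in turn is smaller than \<open>jth J p\<close>. So the pair at \<open>p\<close> consists of two
  different numbers below \<open>jth J p\<close>; at the first index the pair is \<open>m\<close>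
  and \<open>l + 1\<close>.\<close>

lemma admissible_entry:
  assumes J: "J \<subseteq> {l + 2..n}" and m: "1 \<le> m" "m \<le> l" and "p \<le> card J"
    and "admissible l m J I p K"
  shows "1 \<le> the (K p) \<and> the (K p) < jth J p \<and> the (K p) \<noteq> I p"
  using assms(4,5)
proof (induction p arbitrary: K rule: less_induct)
  case (less p)
  have fin: "finite J" using J finite_subset by blast
  have p: "p \<in> {1..card J}" using less.prems admissible_pos by simp
  then have jp: "l + 2 \<le> jth J p" using jth_mem[OF fin] J by fastforce
  from less.prems(2) show ?case
  proof (cases rule: admissible_cases)
    case (single k)
    then show ?thesis using m jp by (auto simp: doubleton_eq_iff)
  next
    case (step s K' k)
    have s: "s \<in> {1..card J}" using step(2) admissible_pos[OF step(3)] p by simp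
    have IH: "1 \<le> the (K' s) \<and> the (K' s) < jth J s" using less.IH[OF step(2) _ step(3)] s by simp
    have "jth J s < jth J p" using jth_less_iff[OF fin s p] step(2) by simp
    then show ?thesis using step(5,6) IH by (auto simp: doubleton_eq_iff)
  qed
qed

section \<open>Tuples and forests\<close>

text \<open>Translates tuples indexed by positions, as in admissibility, into parent functions
  indexed by vertices, as in the relations.\<close>

definition forest_of :: "nat set \<Rightarrow> (nat \<Rightarrow> nat) \<Rightarrow> nat \<Rightarrow> nat" where
  "forest_of J I = (\<lambda>j. if j \<in> J then I (inv_into {1..card J} (jth J) j) else 0)"

lemma finite_tuples: "finite (tuples J)"
  unfolding tuples_def by (intro finite_PiE) auto

lemma tuples_range: "I \<in> tuples J \<Longrightarrow> p \<in> {1..card J} \<Longrightarrow> 1 \<le> I p \<and> I p < jth J p"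
  by (auto simp: tuples_def PiE_iff)

lemma tuples_eqI:
  "I \<in> tuples J \<Longrightarrow> R \<in> tuples J \<Longrightarrow> (\<And>p. p \<in> {1..card J} \<Longrightarrow> I p = R p) \<Longrightarrow> I = R"
  unfolding tuples_def by (rule PiE_ext)

lemma tuples_update:
  "I \<in> tuples J \<Longrightarrow> p \<in> {1..card J} \<Longrightarrow> 1 \<le> k \<Longrightarrow> k < jth J p \<Longrightarrow> I(p := k) \<in> tuples J"
  by (auto simp: tuples_def PiE_iff extensional_def)

context
  fixes J :: "nat set"
  assumes fin: "finite J"
begin

lemma forest_of_jth: "p \<in> {1..card J} \<Longrightarrow> forest_of J I (jth J p) = I p"
  using jth_bij[OF fin] jth_mem[OF fin, of p]
  by (simp add: forest_of_def bij_betw_def inv_into_f_f del: atLeastAtMost_iff)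

lemma forest_of_update:
  assumes "p \<in> {1..card J}"
  shows "forest_of J (I(p := k)) = (forest_of J I)(jth J p := k)"
proof
  fix j
  show "forest_of J (I(p := k)) j = ((forest_of J I)(jth J p := k)) j"
  proof (cases "j \<in> J")
    case True
    then obtain s where s: "s \<in> {1..card J}" "j = jth J s" by (rule jth_obtain[OF fin])
    then show ?thesis
      using forest_of_jth[OF s(1)] jth_eq_iff[OF fin s(1) assms] by simp
  next
    case False
    then have "j \<noteq> jth J p" using jth_mem[OF fin assms] by blast
    then show ?thesis using False by (simp add: forest_of_def)
  qed
qed

lemma forest_of_inj:
  assumes "I \<in> tuples J" "R \<in> tuples J" "forest_of J I = forest_of J R"
  shows "I = R"
proof (rule tuples_eqI[OF assms(1,2)])
  fix p assume "p \<in> {1..card J}"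
  then show "I p = R p" using forest_of_jth[of p I] forest_of_jth[of p R] assms(3) by simp
qed

lemma forest_of_less:
  assumes "I \<in> tuples J" "j \<in> J"
  shows "0 < forest_of J I j \<and> forest_of J I j < j"
proof -
  obtain s where s: "s \<in> {1..card J}" "j = jth J s" using assms(2) by (rule jth_obtain[OF fin])
  show ?thesis using forest_of_jth[OF s(1)] tuples_range[OF assms(1) s(1)] s(2) by simp
qed

lemma supp_forest_of: "I \<in> tuples J \<Longrightarrow> supp (forest_of J I) = J"
proof -
  assume I: "I \<in> tuples J"
  have "forest_of J I j \<noteq> 0 \<longleftrightarrow> j \<in> J" for j
    using forest_of_less[OF I, of j] by (cases "j \<in> J") (simp_all, simp add: forest_of_def)
  then show ?thesis by (simp add: supp_def)
qed

end

section \<open>The summands of the algebra as spans of forests\<close>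

context discriminantal
begin

definition forests_on :: "nat set \<Rightarrow> (nat \<Rightarrow> nat) set" where
  "forests_on J = {f \<in> forests. supp f = J}"

lemma forests_on_subset: "forests_on J \<subseteq> forests"
  by (auto simp: forests_on_def)

lemma forest_of_forest:
  assumes "J \<subseteq> {l + 1..n}" "I \<in> tuples J"
  shows "forest_of J I \<in> forests"
proof -
  have fin: "finite J" using assms(1) finite_subset by blast
  have "l < j \<and> j \<le> n \<and> forest_of J I j < j" if "forest_of J I j \<noteq> 0" for j
  proof -
    have "j \<in> J" using that by (auto simp: forest_of_def split: if_splits)
    then show ?thesis using assms(1) forest_of_less[OF fin assms(2)] by fastforce
  qed
  then show ?thesis by (simp add: forests_def)
qed

lemma forest_of_bij:
  assumes "J \<subseteq> {l + 1..n}"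
  shows "bij_betw (forest_of J) (tuples J) (forests_on J)"
  unfolding bij_betw_def
proof
  have fin: "finite J" using assms finite_subset by blast
  show "inj_on (forest_of J) (tuples J)" using forest_of_inj[OF fin] by (auto intro: inj_onI)
  show "forest_of J ` tuples J = forests_on J"
  proof
    show "forest_of J ` tuples J \<subseteq> forests_on J"
      using forest_of_forest[OF assms] supp_forest_of[OF fin] by (auto simp: forests_on_def)
    show "forests_on J \<subseteq> forest_of J ` tuples J"
    proof
      fix f assume "f \<in> forests_on J"
      then have f: "f \<in> forests" "supp f = J" by (auto simp: forests_on_def)
      define I where "I = restrict (\<lambda>p. f (jth J p)) {1..card J}"
      have "1 \<le> f (jth J p) \<and> f (jth J p) < jth J p" if "p \<in> {1..card J}" for p
      proof -
        have "f (jth J p) \<noteq> 0" using jth_mem[OF fin that] f(2) by (auto simp: supp_def)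
        then show ?thesis using f(1) by (auto simp: forests_def)
      qed
      then have "I \<in> tuples J" by (auto simp: tuples_def I_def PiE_iff)
      moreover have "f = forest_of J I"
      proof
        fix j
        show "f j = forest_of J I j"
        proof (cases "j \<in> J")
          case True
          then obtain s where s: "s \<in> {1..card J}" "j = jth J s" by (rule jth_obtain[OF fin])
          then show ?thesis using forest_of_jth[OF fin s(1), of I] by (simp add: I_def)
        next
          case False
          then show ?thesis using f(2) by (auto simp: forest_of_def supp_def)
        qed
      qed
      ultimately show "f \<in> forest_of J ` tuples J" by blast
    qed
  qed
qed

lemma os_mono_eq:
  assumes J: "J \<subseteq> {l + 1..n}" and I: "I \<in> tuples J"
  shows "os_mono n l I J = cl (forest_mono (forest_of J I))"
proof -
  have fin: "finite J" using J finite_subset by blast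
  have fold: "foldr (\<lambda>p x. os_gen n l (I p) (jth J p) \<otimes>\<^bsub>A\<^esub> x) ps \<one>\<^bsub>A\<^esub> =
      cl (ext_prod (map (\<lambda>p. (I p, jth J p)) ps)) \<and> ext_prod (map (\<lambda>p. (I p, jth J p)) ps) \<in> carrier E"
    if "set ps \<subseteq> {1..card J}" for ps
    using that
  proof (induction ps)
    case Nil
    then show ?case by (simp add: cl_simps E_closed)
  next
    case (Cons p ps)
    then have p: "p \<in> {1..card J}" by simp
    have "(I p, jth J p) \<in> gens"
      using tuples_range[OF I p] jth_mem[OF fin p] J by (auto simp: gens_iff)
    then show ?case using Cons by (simp add: os_gen_def cl_simps E_closed)
  qed
  have "map (\<lambda>j. (forest_of J I j, j)) (sorted_list_of_set J) = map (\<lambda>p. (I p, jth J p)) [1..<Suc (card J)]"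
    unfolding sorted_list_of_set_jth[OF fin] map_map
    by (rule map_cong[OF refl]) (use forest_of_jth[OF fin] in \<open>simp del: upt_Suc\<close>)
  then have "forest_mono (forest_of J I) = ext_prod (map (\<lambda>p. (I p, jth J p)) [1..<Suc (card J)])"
    by (simp only: forest_mono_def supp_forest_of[OF fin I])
  then show ?thesis unfolding os_mono_def using fold[of "[1..<Suc (card J)]"] by (simp del: upt_Suc) fastforce
qed

lemma lin_comb_reindex:
  assumes "bij_betw h T X"
  shows "(\<Sum>t\<in>T. c t \<bullet> forest_mono (h t)) = lin_comb X (\<lambda>f. c (inv_into T h f))"
  unfolding lin_comb_def
  by (subst sum.reindex_bij_betw[OF assms, symmetric], rule sum.cong)
    (use assms in \<open>auto simp: bij_betw_def inv_into_f_f\<close>)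

lemma A_J_eq_span:
  assumes J: "J \<subseteq> {l + 1..n}"
  shows "A_J n l J = os_span (forests_on J)"
proof -
  have eq: "(\<Oplus>\<^bsub>A\<^esub>I\<in>tuples J. os_smult n l (c I) (os_mono n l I J)) =
      cl (\<Sum>I\<in>tuples J. c I \<bullet> forest_mono (forest_of J I))" for c
  proof -
    have closed: "forest_mono (forest_of J I) \<in> carrier E" if "I \<in> tuples J" for I
      using forest_of_forest[OF J that] by (rule forest_mono_closed)
    have "(\<Oplus>\<^bsub>A\<^esub>I\<in>tuples J. os_smult n l (c I) (os_mono n l I J)) =
        (\<Oplus>\<^bsub>A\<^esub>I\<in>tuples J. cl (c I \<bullet> forest_mono (forest_of J I)))"
      by (rule A.finsum_cong') (use closed in \<open>auto simp: os_mono_eq[OF J] cl_smult cl_simps E_closed\<close>)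
    then show ?thesis using closed by (simp add: cl_finsum[OF finite_tuples] E_closed)
  qed
  show ?thesis
  proof
    show "A_J n l J \<subseteq> os_span (forests_on J)"
      unfolding A_J_def eq os_span_def lin_comb_reindex[OF forest_of_bij[OF J]] by blast
    show "os_span (forests_on J) \<subseteq> A_J n l J"
    proof
      fix u assume "u \<in> os_span (forests_on J)"
      then obtain c where "u = cl (lin_comb (forests_on J) c)" unfolding os_span_def by blast
      moreover have "lin_comb (forests_on J) c = (\<Sum>I\<in>tuples J. c (forest_of J I) \<bullet> forest_mono (forest_of J I))"
        unfolding lin_comb_def by (rule sum.reindex_bij_betw[OF forest_of_bij[OF J], symmetric])
      ultimately show "u \<in> A_J n l J"
        unfolding A_J_def eq by (intro CollectI exI[of _ "\<lambda>I. c (forest_of J I)"]) simp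
    qed
  qed
qed

section \<open>The graded pieces and multiplication by \<open>os_omega\<close>\<close>

lemma supp_subset: "f \<in> forests \<Longrightarrow> supp f \<subseteq> {l + 1..n}"
  by (auto simp: forests_def supp_def Suc_le_eq)

lemma subspace_sum_A_J:
  "subspace_sum A {J. J \<subseteq> {l + 1..n} \<and> card J = q \<and> P J} (A_J n l) =
    os_span {f \<in> forests. card (supp f) = q \<and> P (supp f)}"
proof -
  have "subspace_sum A {J. J \<subseteq> {l + 1..n} \<and> card J = q \<and> P J} (A_J n l) =
      os_span (\<Union>J\<in>{J. J \<subseteq> {l + 1..n} \<and> card J = q \<and> P J}. forests_on J)"
    by (rule subspace_sum_os_span) (auto simp: A_J_eq_span forests_on_def)
  also have "(\<Union>J\<in>{J. J \<subseteq> {l + 1..n} \<and> card J = q \<and> P J}. forests_on J) =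
      {f \<in> forests. card (supp f) = q \<and> P (supp f)}"
    using supp_subset by (auto simp: forests_on_def)
  finally show ?thesis .
qed

lemma B_deg_eq: "B_deg n l q = os_span {f \<in> forests. card (supp f) = q \<and> l + 1 \<in> supp f}"
  unfolding B_deg_def by (rule subspace_sum_A_J)

lemma Ahat_deg_eq: "Ahat_deg n l q = os_span {f \<in> forests. card (supp f) = q \<and> l + 1 \<notin> supp f}"
  unfolding Ahat_deg_def by (rule subspace_sum_A_J)

text \<open>\<open>os_mu\<close> has meaningful values only on \<open>os_deg\<close>, so the degree
  of a monomial must be checked before it is applied.\<close>

lemma os_deg_mono:
  assumes "f \<in> forests"
  shows "cl (forest_mono f) \<in> os_deg n l (card (supp f))"
proof -
  have "card S = card (supp f)" if "forest_mono f S \<noteq> 0" for S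
  proof -
    have "S = set (map (\<lambda>j. (f j, j)) (sorted_list_of_set (supp f)))"
      using ext_prod_nonzero that unfolding forest_mono_def by blast
    also have "\<dots> = (\<lambda>j. (f j, j)) ` supp f" using finite_supp[OF assms] by simp
    finally show ?thesis by (simp add: card_image inj_on_def)
  qed
  then show ?thesis unfolding os_deg_def using forest_mono_closed[OF assms] by blast
qed

lemma coef_outside:
  assumes "x \<in> carrier E" "cl x \<in> os_span X" "X \<subseteq> forests" "f \<in> forests" "f \<notin> X"
  shows "coef f x = 0"
proof -
  have "cl x = cl (lin_comb X (\<lambda>f. coef f x))"
    by (rule cl_eq_lin_comb_coef[OF assms(2) _ assms(3,1)]) simp
  then have "coef f x = coef f (lin_comb X (\<lambda>f. coef f x))"
    by (rule coef_cong[OF assms(4,1) lin_comb_closed[OF assms(3)]])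
  then show ?thesis using coef_lin_comb[OF assms(3,4)] assms(5) by simp
qed

lemma omega_times:
  assumes "f \<in> forests"
  shows "os_omega n l lam \<otimes>\<^bsub>A\<^esub> cl (forest_mono f) =
      cl (\<Sum>g\<in>gens. lam (fst g) (snd g) \<bullet> (ext_gen g \<odot> forest_mono f))" (is ?eq)
    and "(\<Sum>g\<in>gens. lam (fst g) (snd g) \<bullet> (ext_gen g \<odot> forest_mono f)) \<in> carrier E" (is "?x \<in> _")
    and "cl (\<Sum>g\<in>gens. lam (fst g) (snd g) \<bullet> (ext_gen g \<odot> forest_mono f)) \<in> os_span (extensions f)"
proof -
  have gen: "ext_gen g \<in> carrier E" if "g \<in> gens" for g using that E_closed(8)[of "fst g" "snd g"] by simp
  have f: "forest_mono f \<in> carrier E" using assms by (rule forest_mono_closed)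
  have "os_omega n l lam = (\<Oplus>\<^bsub>A\<^esub>g\<in>gens. cl (lam (fst g) (snd g) \<bullet> ext_gen g))"
    unfolding os_omega_def os_gen_def
    by (rule A.finsum_cong') (use gen in \<open>auto simp: cl_smult cl_simps E_closed\<close>)
  then have "os_omega n l lam = cl (\<Sum>g\<in>gens. lam (fst g) (snd g) \<bullet> ext_gen g)"
    using gen by (simp add: cl_finsum[OF finite_disc_gens] E_closed)
  then show ?eq
    using gen f by (simp add: cl_simps E_sum_closed E_closed ext_times_sum_left ext_times_distrib)
  show "?x \<in> carrier E" using gen f by (intro E_sum_closed E_closed)
  show "cl ?x \<in> os_span (extensions f)"
  proof (rule os_span_sum)
    show "extensions f \<subseteq> forests" by (auto simp: extensions_def)
    show "ext_gen g \<odot> forest_mono f \<in> carrier E \<and> cl (ext_gen g \<odot> forest_mono f) \<in> os_span (extensions f)"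
      if "g \<in> gens" for g
      using gen[OF that] f gen_times_in_span[OF assms, of "fst g" "snd g"] that by (simp add: E_closed)
  qed
qed

end

section \<open>The coefficients\<close>

locale coefficients = discriminantal +
  fixes m :: nat and J :: "nat set"
  assumes m: "1 \<le> m" "m \<le> l" and ln: "l < n" and J: "J \<subseteq> {l + 2..n}"
begin

lemma J': "J \<subseteq> {l + 1..n}" and finJ: "finite J" and new: "l + 1 \<notin> J"
  using J finite_subset by fastforce+

text \<open>The forest of the basis element \<open>a_{m,l+1} \<and> a_{R,J}\<close> whose
  coefficient is sought.\<close>

definition extended :: "(nat \<Rightarrow> nat) \<Rightarrow> nat \<Rightarrow> nat" where
  "extended R = (forest_of J R)(l + 1 := m)"

definition edge_coef :: "(nat \<Rightarrow> nat) \<Rightarrow> (nat \<Rightarrow> nat) \<Rightarrow> nat \<Rightarrow> nat \<Rightarrow> complex" where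
  "edge_coef R I k j = coef (extended R) (ext_gen (k, j) \<odot> forest_mono (forest_of J I))"

text \<open>The families of the formula, sorted by their last entry \<open>k\<close>: these are the
  ones that a single generator \<open>(k, jth J p)\<close> has to account for.\<close>

definition matching :: "(nat \<Rightarrow> nat) \<Rightarrow> (nat \<Rightarrow> nat) \<Rightarrow> nat \<Rightarrow> nat \<Rightarrow> (nat \<rightharpoonup> nat) set" where
  "matching R I p k = {K. admissible l m J I p K \<and> K p = Some k \<and> diff_subfamily J R I K}"

lemma forest_of_new: "forest_of J I (l + 1) = 0"
  using new by (simp add: forest_of_def)

lemma extended_forest: "R \<in> tuples J \<Longrightarrow> extended R \<in> forests"
  unfolding extended_def
  by (rule forests_update[OF forest_of_forest[OF J']]) (use m ln in \<open>auto simp: gens_iff\<close>)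

lemma edge_coef_new:
  assumes R: "R \<in> tuples J" and I: "I \<in> tuples J" and k: "1 \<le> k" "k \<le> l"
  shows "edge_coef R I k (l + 1) = (if k = m \<and> R = I then 1 else 0)"
proof -
  define f where "f = forest_of J I"
  have f: "f \<in> forests" "f (l + 1) = 0"
    using forest_of_forest[OF J' I] forest_of_new by (simp_all add: f_def)
  \<comment> \<open>\<open>l + 1\<close> lies below every element of \<open>J\<close>, so the new
    edge enters at the front without a sign.\<close>
  have "{i \<in> supp f. i < l + 1} = {}" using supp_forest_of[OF finJ I] J by (auto simp: f_def)
  then have "card {i \<in> supp f. i < l + 1} = 0" by (simp only: card.empty)
  then have mono: "ext_gen (k, l + 1) \<odot> forest_mono f = forest_mono (f(l + 1 := k))"
    using gen_times_new_edge[OF f, of k] k by (simp only: ext_scale_simps power_0)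
  have f': "f(l + 1 := k) \<in> forests"
    by (rule forests_update[OF f(1)]) (use k ln in \<open>auto simp: gens_iff\<close>)
  have "extended R = f(l + 1 := k) \<longleftrightarrow> k = m \<and> R = I"
  proof
    assume eq: "extended R = f(l + 1 := k)"
    have "forest_of J R = f"
    proof
      fix j
      show "forest_of J R j = f j"
        using fun_cong[OF eq, of j] f(2) forest_of_new by (cases "j = l + 1") (simp_all add: extended_def)
    qed
    then have "R = I" using forest_of_inj[OF finJ R I] by (simp add: f_def)
    moreover have "k = m" using fun_cong[OF eq, of "l + 1"] by (simp add: extended_def)
    ultimately show "k = m \<and> R = I" by simp
  qed (simp add: extended_def f_def)
  then show ?thesis
    unfolding edge_coef_def f_def[symmetric] mono
    using coef_forest_mono[OF extended_forest[OF R] f'] by (simp only:)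
qed

text \<open>The product is a signed forest monomial with \<open>j\<close> in its support, while
  \<open>extended R\<close> has no parent at \<open>j\<close>.\<close>

lemma edge_coef_outside:
  assumes R: "R \<in> tuples J" and I: "I \<in> tuples J" and kj: "(k, j) \<in> gens" "j \<notin> J" "j \<noteq> l + 1"
  shows "edge_coef R I k j = 0"
proof -
  define f where "f = forest_of J I"
  have f: "f \<in> forests" "f j = 0"
    using forest_of_forest[OF J' I] kj by (simp_all add: f_def forest_of_def)
  have k: "0 < k" using kj by (simp add: gens_iff)
  have "extended R j \<noteq> (f(j := k)) j" using k kj by (simp add: extended_def forest_of_def)
  then have "extended R \<noteq> f(j := k)" by metis
  then show ?thesis
    using coef_forest_mono[OF extended_forest[OF R] forests_update[OF f(1) kj(1)]]
      gen_times_new_edge[OF f k]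
    by (simp only: edge_coef_def coef_linear if_False mult_zero_right flip: f_def)
qed

lemma edge_coef_recursion:
  assumes R: "R \<in> tuples J" and I: "I \<in> tuples J" and p: "p \<in> {1..card J}" and k: "1 \<le> k" "k < jth J p"
  shows "edge_coef R I k (jth J p) =
    (if k = I p \<or> max k (I p) \<le> l then 0
     else edge_coef R I (min k (I p)) (max k (I p)) - edge_coef R (I(p := k)) (min k (I p)) (max k (I p)))"
proof -
  define f where "f = forest_of J I"
  define j where "j = jth J p"
  have f: "f \<in> forests" using forest_of_forest[OF J' I] by (simp add: f_def)
  have fj: "f j = I p" using forest_of_jth[OF finJ p] by (simp add: f_def j_def)
  have j: "j \<in> supp f" using jth_mem[OF finJ p] supp_forest_of[OF finJ I] by (simp add: f_def j_def)
  have kj: "(k, j) \<in> gens" using k jth_mem[OF finJ p] J by (auto simp: gens_iff j_def)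
  have f': "forest_of J (I(p := k)) = f(j := k)" using forest_of_update[OF finJ p] by (simp add: f_def j_def)
  note closed = forest_mono_closed[OF f] forest_mono_closed[OF forests_update[OF f kj]]
  have gkj: "ext_gen (k, j) \<in> carrier E" using kj by (rule E_closed)
  note R' = extended_forest[OF R]
  consider "k = I p" | "k \<noteq> I p" "max k (I p) \<le> l" | "k \<noteq> I p" "l < max k (I p)" by linarith
  then show ?thesis
  proof cases
    case 1
    then have "ext_gen (k, j) \<odot> forest_mono f = 0" using gen_times_same_edge[OF f j] fj by simp
    then show ?thesis using 1 by (simp only: edge_coef_def coef_linear if_True simp_thms flip: f_def j_def)
  next
    case 2
    then have "cl (ext_gen (k, j) \<odot> forest_mono f) = cl 0"
      using gen_times_parallel_edge[OF f j kj] fj by simp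
    then have "coef (extended R) (ext_gen (k, j) \<odot> forest_mono f) = coef (extended R) 0"
      by (rule coef_cong[OF R' E_closed(7)[OF gkj closed(1)] E_closed(1)])
    then show ?thesis using 2 by (simp only: edge_coef_def coef_linear if_True simp_thms flip: f_def j_def)
  next
    case 3
    define g where "g = (min k (I p), max k (I p))"
    have g: "ext_gen g \<in> carrier E"
      unfolding g_def using 3 kj forest_edges[OF f j] fj by (intro E_closed) (auto simp: gens_iff)
    have "cl (ext_gen (k, j) \<odot> forest_mono f) = cl (ext_gen g \<odot> (forest_mono f - forest_mono (f(j := k))))"
      using gen_times_replace_edge[OF f j kj] 3 by (simp only: fj g_def simp_thms)
    then have "coef (extended R) (ext_gen (k, j) \<odot> forest_mono f) =
        coef (extended R) (ext_gen g \<odot> (forest_mono f - forest_mono (f(j := k))))"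
      by (rule coef_cong[OF R' E_closed(7)[OF gkj closed(1)] E_closed(7)[OF g E_closed(4)[OF closed]]])
    then have "edge_coef R I k j = edge_coef R I (fst g) (snd g) - edge_coef R (I(p := k)) (fst g) (snd g)"
      by (simp only: edge_coef_def f' ext_times_distrib coef_linear prod.collapse flip: f_def)
    moreover have "\<not> (k = I p \<or> max k (I p) \<le> l)" using 3 by linarith
    ultimately show ?thesis by (simp only: g_def j_def fst_conv snd_conv if_False)
  qed
qed

section \<open>Single-generator coefficients count admissible families\<close>

lemma admissible_bounds:
  assumes "admissible l m J I s K" "s \<in> {1..card J}"
  shows "the (K s) < jth J s"
  using admissible_entry[OF J m _ assms(1)] assms(2) by simp

lemma diff_positions_update:
  assumes "p \<in> {1..card J}"
  shows "diff_positions J R (I(p := k)) = (if R p = k then diff_positions J R I - {p} else insert p (diff_positions J R I))"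
  using assms by (auto simp: diff_positions_def)

lemma diff_positions_self [simp]: "diff_positions J R R = {}"
  by (simp add: diff_positions_def)

lemma diff_positions_empty: "R \<in> tuples J \<Longrightarrow> I \<in> tuples J \<Longrightarrow> diff_positions J R I = {} \<Longrightarrow> R = I"
  by (rule tuples_eqI) (auto simp: diff_positions_def)

lemma finite_diff_positions: "finite (diff_positions J R I)"
  by (simp add: diff_positions_def)

text \<open>The unordered pair \<open>{k, I p}\<close> determines the preceding link: an entry is
  always smaller than its own label, so the larger member must be \<open>jth J s\<close> and the
  smaller one the entry at \<open>s\<close>.\<close>

lemma matching_step:
  assumes p: "p \<in> {1..card J}" and s: "s \<in> {1..card J}" "s < p"
    and k: "k \<noteq> I p" "{k, I p} = {a, jth J s}" "a < jth J s"
  shows "matching R I p k = (\<lambda>K. K(p \<mapsto> k)) ` {K. admissible l m J I s K \<and> K s = Some a \<and>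
    diff_subfamily J R I (K(p \<mapsto> k))}"
proof (intro subset_antisym subsetI)
  have js: "l + 2 \<le> jth J s" using jth_mem[OF finJ s(1)] J by fastforce
  fix K assume "K \<in> matching R I p k"
  then have K: "admissible l m J I p K" "K p = Some k" "diff_subfamily J R I K" by (auto simp: matching_def)
  from K(1) show "K \<in> (\<lambda>K. K(p \<mapsto> k)) ` {K. admissible l m J I s K \<and> K s = Some a \<and>
    diff_subfamily J R I (K(p \<mapsto> k))}"
  proof (cases rule: admissible_cases)
    case (single k')
    then have "{k, I p} = {m, l + 1}" using K(2) by auto
    \<comment> \<open>A one-element family is excluded because labels of \<open>J\<close> are at
      least \<open>l + 2\<close>.\<close>
    then have "jth J s \<in> {m, l + 1}" using k(2) by blast
    then show ?thesis using js m by simp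
  next
    case (step s' K' k')
    have k': "k' = k" using K(2) step(5) by simp
    have s': "s' \<in> {1..card J}" using admissible_pos[OF step(3)] step(2) p by simp
    have "{the (K' s'), jth J s'} = {a, jth J s}" using step(6) k(2) k' by simp
    moreover have "the (K' s') < jth J s'" by (rule admissible_bounds[OF step(3) s'])
    ultimately have eq: "the (K' s') = a" "jth J s' = jth J s" using k(3) by (auto simp: doubleton_eq_iff)
    then have "s' = s" using jth_eq_iff[OF finJ s' s(1)] by simp
    moreover have "K' s' = Some a" using admissible_dom(1)[OF step(3)] eq(1) by auto
    ultimately show ?thesis using step(3) K(3) unfolding step(5) k' by blast
  qed
next
  fix K assume "K \<in> (\<lambda>K. K(p \<mapsto> k)) ` {K. admissible l m J I s K \<and> K s = Some a \<and>
    diff_subfamily J R I (K(p \<mapsto> k))}"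
  then obtain K' where K': "admissible l m J I s K'" "K' s = Some a" "diff_subfamily J R I (K'(p \<mapsto> k))"
    and K: "K = K'(p \<mapsto> k)" by blast
  have "p \<notin> dom K'" using admissible_dom(2)[OF K'(1)] s(2) by auto
  then have "admissible l m J I p (K'(p \<mapsto> k))"
    using p s K' k by (intro admissible_step[of p s]) auto
  then show "K \<in> matching R I p k" unfolding matching_def K using K'(3) by simp
qed

text \<open>The recursion passes from \<open>(k, jth J p)\<close> to the edge \<open>(a, b)\<close>
  with \<open>b < jth J p\<close>, and from \<open>I\<close> also to \<open>I(p := k)\<close>; so
  the induction is on \<open>p\<close>, for all tuples. The cases follow the position of
  \<open>b\<close>: no new edge, \<open>b \<le> l\<close>, \<open>b = l + 1\<close> (a family
  starts), \<open>b\<close> outside \<open>J\<close>, or \<open>b\<close> an earlier label (a family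
  continues).\<close>

lemma edge_coef_matching:
  assumes R: "R \<in> tuples J" and I: "I \<in> tuples J" and p: "p \<in> {1..card J}" and k: "1 \<le> k" "k < jth J p"
  shows "edge_coef R I k (jth J p) = (-1) ^ card (diff_positions J R I) * of_nat (card (matching R I p k))"
  using I p k
proof (induction p arbitrary: I k rule: less_induct)
  case (less p)
  note I = less.prems(1) and p = less.prems(2) and k = less.prems(3,4)
  have Ip: "1 \<le> I p" "I p < jth J p" using tuples_range[OF I p] by auto
  have I': "I(p := k) \<in> tuples J" by (rule tuples_update[OF I p k])
  define a b where "a = min k (I p)" and "b = max k (I p)"
  have ab: "{k, I p} = {a, b}" "1 \<le> a" "b < jth J p" using k Ip by (auto simp: a_def b_def)
  have jl: "l + 2 \<le> jth J s" if "s \<in> {1..card J}" for s using jth_mem[OF finJ that] J by fastforce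
  \<comment> \<open>A family ending at \<open>p\<close> either starts there or continues one ending
    at some \<open>s\<close>; in the second case the larger member of the pair is the label
    \<open>jth J s\<close>, since the entry at \<open>s\<close> is below it.\<close>
  have empty: "matching R I p k = {}"
    if "{k, I p} \<noteq> {m, l + 1}" "\<And>s. s \<in> {1..card J} \<Longrightarrow> s < p \<Longrightarrow> b \<noteq> jth J s"
  proof (rule ccontr)
    assume "matching R I p k \<noteq> {}"
    then obtain K where K: "admissible l m J I p K" "K p = Some k" by (auto simp: matching_def)
    from K(1) show False
    proof (cases rule: admissible_cases)
      case (single k')
      then show False using K(2) that(1) by auto
    next
      case (step s K' k')
      have s: "s \<in> {1..card J}" using admissible_pos[OF step(3)] step(2) p by simp
      have "k' = k" using K(2) step(5) by simp
      moreover have "the (K' s) < jth J s" by (rule admissible_bounds[OF step(3) s])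
      ultimately have "b = jth J s" using step(6) unfolding b_def by (auto simp: doubleton_eq_iff)
      then show False using that(2) s step(2) by blast
    qed
  qed
  have rec: "edge_coef R I k (jth J p) = edge_coef R I a b - edge_coef R (I(p := k)) a b"
    if "k \<noteq> I p" "l < b"
  proof -
    have "\<not> (k = I p \<or> max k (I p) \<le> l)" using that unfolding b_def by linarith
    then show ?thesis using edge_coef_recursion[OF R I p k] by (simp only: a_def b_def if_False)
  qed
  consider "k = I p" | "k \<noteq> I p" "b \<le> l" | "k \<noteq> I p" "b = l + 1" | "k \<noteq> I p" "l + 1 < b" "b \<notin> J"
    | "k \<noteq> I p" "l + 1 < b" "b \<in> J" by linarith
  then show ?case
  proof cases
    case 1
    have "the (K p) \<noteq> I p" if "admissible l m J I p K" for K
      using admissible_entry[OF J m _ that] p by simp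
    then have "matching R I p k = {}" using 1 by (force simp: matching_def)
    then show ?thesis using edge_coef_recursion[OF R I p k] 1 by simp
  next
    case 2
    have "matching R I p k = {}"
    proof (rule empty)
      show "{k, I p} \<noteq> {m, l + 1}" using 2 by (auto simp: b_def doubleton_eq_iff)
      show "b \<noteq> jth J s" if "s \<in> {1..card J}" for s using jl[OF that] 2 by simp
    qed
    then show ?thesis using edge_coef_recursion[OF R I p k] 2 by (simp add: b_def)
  next
    case 3
    have al: "a \<le> l" using 3 by (auto simp: a_def b_def)
    \<comment> \<open>The two terms of the difference correspond to the two tuples compatible with
      the family \<open>[p \<mapsto> k]\<close>: \<open>R = I\<close> with sign \<open>+\<close>,
      and \<open>R = I(p := k)\<close>, which differs from \<open>I\<close> at one position, with
      sign \<open>-\<close>.\<close>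
    have rec: "edge_coef R I k (jth J p) =
        (if a = m \<and> R = I then 1 else 0) - (if a = m \<and> R = I(p := k) then 1 else 0)"
      using rec 3 edge_coef_new[OF R I ab(2) al] edge_coef_new[OF R I' ab(2) al] by simp
    show ?thesis
    proof (cases "a = m")
      case False
      then have "matching R I p k = {}"
        by (intro empty) (use ab 3 jl in \<open>fastforce simp: doubleton_eq_iff\<close>)+
      then show ?thesis using rec False by simp
    next
      case True
      have adm: "admissible l m J I p K \<and> K p = Some k \<longleftrightarrow> K = [p \<mapsto> k]" for K
      proof
        assume K: "admissible l m J I p K \<and> K p = Some k"
        then have "admissible l m J I p K" ..
        then show "K = [p \<mapsto> k]"
        proof (cases rule: admissible_cases)
          case (single k')
          have "k' = k" using K single(2) by simp
          then show ?thesis using single(2) by simp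
        next
          case (step s K' k')
          have s: "s \<in> {1..card J}" using admissible_pos[OF step(3)] step(2) p by simp
          have "k' = k" using K step(5) by simp
          then have "jth J s \<in> {a, b}" using step(6) ab(1) by auto
          then show ?thesis using jl[OF s] 3 al by auto
        qed
      next
        assume "K = [p \<mapsto> k]"
        then show "admissible l m J I p K \<and> K p = Some k"
          using admissible_single[of p k I m l J] p ab(1) True 3 by (simp del: fun_upd_apply) simp
      qed
      have "diff_subfamily J R I [p \<mapsto> k] \<longleftrightarrow> R = I \<or> R = I(p := k)"
      proof
        assume "diff_subfamily J R I [p \<mapsto> k]"
        then have *: "s = p \<and> R s = k" if "s \<in> diff_positions J R I" for s
          using that by (auto simp: diff_subfamily_def split: if_splits)
        show "R = I \<or> R = I(p := k)"
        proof (cases "diff_positions J R I = {}")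
          case False
          then have "R p = k" "diff_positions J R I \<subseteq> {p}" using * by blast+
          then have "diff_positions J R (I(p := k)) = {}"
            using diff_positions_update[OF p, of R I k] by auto
          then show ?thesis using diff_positions_empty[OF R I'] by simp
        qed (use diff_positions_empty[OF R I] in simp)
      next
        assume "R = I \<or> R = I(p := k)"
        then show "diff_subfamily J R I [p \<mapsto> k]"
          by (auto simp: diff_subfamily_def diff_positions_def split: if_splits)
      qed
      moreover have "matching R I p k = {K. K = [p \<mapsto> k] \<and> diff_subfamily J R I K}"
        unfolding matching_def using adm by blast
      ultimately have "matching R I p k = (if R = I \<or> R = I(p := k) then {[p \<mapsto> k]} else {})"
        by auto
      moreover have "I \<noteq> I(p := k)" using 3(1) by (metis fun_upd_same)
      moreover have "diff_positions J (I(p := k)) I = {p}"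
        using p 3(1) by (auto simp: diff_positions_def)
      ultimately show ?thesis using rec True by (auto simp del: fun_upd_apply)
    qed
  next
    case 4
    have "edge_coef R I k (jth J p) = 0"
    proof -
      have "jth J p \<le> n" using jth_mem[OF finJ p] J by auto
      moreover have "a < b" using 4(1) by (auto simp: a_def b_def)
      ultimately have "(a, b) \<in> gens" using 4(2) ab(2,3) by (simp add: gens_iff)
      then show ?thesis
        using rec 4 edge_coef_outside[OF R I, of a b] edge_coef_outside[OF R I', of a b] by simp
    qed
    moreover have "matching R I p k = {}"
    proof (rule empty)
      show "{k, I p} \<noteq> {m, l + 1}" using 4 m by (auto simp: b_def doubleton_eq_iff)
      show "b \<noteq> jth J s" if "s \<in> {1..card J}" for s using jth_mem[OF finJ that] 4 by auto
    qed
    ultimately show ?thesis by simp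
  next
    case 5
    obtain s where s: "s \<in> {1..card J}" "b = jth J s" using 5(3) by (rule jth_obtain[OF finJ])
    have sp: "s < p" using jth_less_iff[OF finJ s(1) p] ab(3) s(2) by simp
    have a: "a < jth J s" using 5(1) s(2) by (auto simp: a_def b_def)
    have IH: "edge_coef R I' a b = (-1) ^ card (diff_positions J R I') * of_nat (card (matching R I' s a))"
      if "I' \<in> tuples J" for I'
      unfolding s(2) by (rule less.IH[OF sp that s(1) ab(2) a])
    have rec: "edge_coef R I k (jth J p) = edge_coef R I a b - edge_coef R (I(p := k)) a b"
      using rec 5 by simp
    have "matching R I p k = (\<lambda>K. K(p \<mapsto> k)) ` {K. admissible l m J I s K \<and> K s = Some a \<and>
        diff_subfamily J R I (K(p \<mapsto> k))}" (is "_ = _ ` ?M")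
      by (rule matching_step[OF p s(1) sp]) (use 5(1) ab(1) s(2) a in simp_all)
    \<comment> \<open>Families ending at \<open>s < p\<close> have no entry at \<open>p\<close>, so
      the update can be undone.\<close>
    moreover have "inj_on (\<lambda>K. K(p \<mapsto> k)) ?M"
    proof (rule inj_onI)
      fix K K' assume "K \<in> ?M" "K' \<in> ?M" and eq: "K(p \<mapsto> k) = K'(p \<mapsto> k)"
      then have "admissible l m J I s K" "admissible l m J I s K'" by auto
      then have "K p = None" "K' p = None" using admissible_dom(2) sp by fastforce+
      then show "K = K'" using eq by (metis fun_upd_triv fun_upd_upd)
    qed
    ultimately have card: "card (matching R I p k) = card ?M" by (simp add: card_image)
    have None: "K p = None" if "admissible l m J I s K" for K
      using admissible_dom(2)[OF that] sp by fastforce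
    have adm: "admissible l m J (I(p := k)) s K \<longleftrightarrow> admissible l m J I s K" for K
      by (rule admissible_cong) (use sp in auto)
    \<comment> \<open>Shorter families have no entry at \<open>p\<close>, so a term survives only if
      \<open>R\<close> agrees at \<open>p\<close> with its tuple. If \<open>R p = I p\<close>, only
      the first term remains; if \<open>R p = k\<close>, only the second, whose minus sign makes up
      for one difference position fewer; otherwise both vanish.\<close>
    consider "R p = I p" | "R p = k" | "R p \<noteq> I p" "R p \<noteq> k" by blast
    then show ?thesis
    proof cases
      case 1
      have "?M = matching R I s a"
        using 1 by (auto simp: matching_def diff_subfamily_def diff_positions_def split: if_splits)
      moreover have "matching R (I(p := k)) s a = {}"
        using None p 1 5(1)
        by (fastforce simp: matching_def adm diff_subfamily_def diff_positions_def)
      ultimately show ?thesis by (simp add: rec IH[OF I] IH[OF I'] card del: fun_upd_apply)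
    next
      case 2
      have "p \<in> diff_positions J R I" using 2 p 5(1) by (simp add: diff_positions_def)
      moreover have diff: "diff_positions J R (I(p := k)) = diff_positions J R I - {p}"
        using diff_positions_update[OF p, of R I k] 2 by simp
      ultimately have "card (diff_positions J R I) = Suc (card (diff_positions J R (I(p := k))))"
        using finite_diff_positions card.remove by metis
      moreover have "?M = matching R (I(p := k)) s a"
        unfolding matching_def adm diff_subfamily_def diff using 2 by auto
      moreover have "matching R I s a = {}"
        using None \<open>p \<in> diff_positions J R I\<close> by (fastforce simp: matching_def diff_subfamily_def)
      ultimately show ?thesis by (simp add: rec IH[OF I] IH[OF I'] card del: fun_upd_apply)
    next
      case 3
      have "matching R I s a = {}" "matching R (I(p := k)) s a = {}" "?M = {}"
        using None p 3 by (fastforce simp: matching_def adm diff_subfamily_def diff_positions_def)+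
      then show ?thesis by (simp only: rec IH[OF I] IH[OF I'] card card.empty of_nat_0 mult_zero_right diff_self)
    qed
  qed
qed

section \<open>Summation over all generators\<close>

definition omega_mono :: "(nat \<Rightarrow> nat \<Rightarrow> complex) \<Rightarrow> (nat \<Rightarrow> nat) \<Rightarrow> (nat \<times> nat) set \<Rightarrow> complex" where
  "omega_mono lam I = (\<Sum>g\<in>gens. lam (fst g) (snd g) \<bullet> (ext_gen g \<odot> forest_mono (forest_of J I)))"

lemma coef_omega_mono:
  assumes R: "R \<in> tuples J" and I: "I \<in> tuples J"
  shows "coef (extended R) (omega_mono lam I) = (-1) ^ card (diff_positions J R I) *
              ((if R = I then 1 else 0) * lam m (l + 1) +
               (\<Sum>p = 1..card J.
                  \<Sum>K | admissible l m J I p K \<and> diff_subfamily J R I K. lam (the (K p)) (jth J p)))"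
proof -
  define s where "s = ((-1) ^ card (diff_positions J R I) :: complex)"
  define h where "h = (\<lambda>j. \<Sum>k\<in>{1..<j}. lam k j * edge_coef R I k j)"
  have "coef (extended R) (omega_mono lam I) =
      (\<Sum>g\<in>gens. lam (fst g) (snd g) * edge_coef R I (fst g) (snd g))"
    by (simp add: omega_mono_def coef_sum coef_linear edge_coef_def)
  also have "\<dots> = (\<Sum>(j, k)\<in>(SIGMA j:{l + 1..n}. {1..<j}). lam k j * edge_coef R I k j)"
    by (rule sum.reindex_bij_witness[of _ prod.swap prod.swap]) (auto simp: gens_iff)
  also have "\<dots> = (\<Sum>j\<in>{l + 1..n}. h j)"
    unfolding h_def by (rule sum.Sigma[symmetric]) auto
  also have "\<dots> = (\<Sum>j\<in>insert (l + 1) J. h j)"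
  proof (rule sum.mono_neutral_right)
    show "insert (l + 1) J \<subseteq> {l + 1..n}" using J' ln by auto
    show "\<forall>j\<in>{l + 1..n} - insert (l + 1) J. h j = 0"
    proof
      fix j assume j: "j \<in> {l + 1..n} - insert (l + 1) J"
      then have "edge_coef R I k j = 0" if "k \<in> {1..<j}" for k
        using that by (intro edge_coef_outside[OF R I]) (auto simp: gens_iff)
      then show "h j = 0" by (simp add: h_def)
    qed
  qed simp
  also have "\<dots> = h (l + 1) + (\<Sum>j\<in>J. h j)" using finJ new by simp
  \<comment> \<open>The sign can be pulled out of this term as well: it is \<open>1\<close> for
    \<open>R = I\<close>, and otherwise the term is \<open>0\<close>.\<close>
  also have "h (l + 1) = s * ((if R = I then 1 else 0) * lam m (l + 1))"
  proof -
    have "h (l + 1) = (\<Sum>k\<in>{1..<l + 1}. if k = m then (if R = I then lam m (l + 1) else 0) else 0)"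
      unfolding h_def
    proof (rule sum.cong[OF refl])
      fix k assume k: "k \<in> {1..<l + 1}"
      then have "edge_coef R I k (l + 1) = (if k = m \<and> R = I then 1 else 0)"
        by (intro edge_coef_new[OF R I]) auto
      then show "lam k (l + 1) * edge_coef R I k (l + 1) =
          (if k = m then (if R = I then lam m (l + 1) else 0) else 0)" by simp
    qed
    also have "\<dots> = (if R = I then lam m (l + 1) else 0)" using m by simp
    finally show ?thesis by (simp add: s_def)
  qed
  also have "(\<Sum>j\<in>J. h j) = (\<Sum>p\<in>{1..card J}. h (jth J p))"
    by (rule sum.reindex_bij_betw[OF jth_bij[OF finJ], symmetric])
  also have "\<dots> = (\<Sum>p\<in>{1..card J}.
      s * (\<Sum>K | admissible l m J I p K \<and> diff_subfamily J R I K. lam (the (K p)) (jth J p)))"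
  proof (rule sum.cong[OF refl])
    fix p assume p: "p \<in> {1..card J}"
    let ?S = "{K. admissible l m J I p K \<and> diff_subfamily J R I K}"
    have fin: "finite ?S" using finite_admissible[of l m J I p] by (rule rev_finite_subset) auto
    \<comment> \<open>On a fibre with last entry \<open>k\<close> the weight is constant, so the sum
      over families becomes the count in \<open>edge_coef_matching\<close> times that
      weight.\<close>
    have fibre: "{K \<in> ?S. the (K p) = k} = matching R I p k" for k
    proof -
      have "p \<in> dom K" if "admissible l m J I p K" for K using that by (rule admissible_dom)
      then show ?thesis by (force simp: matching_def)
    qed
    have "(\<Sum>K\<in>?S. lam (the (K p)) (jth J p)) =
        (\<Sum>k\<in>{1..<jth J p}. \<Sum>K\<in>{K \<in> ?S. the (K p) = k}. lam (the (K p)) (jth J p))"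
    proof (rule sum.group[symmetric, OF fin])
      show "(\<lambda>K. the (K p)) ` ?S \<subseteq> {1..<jth J p}"
        using admissible_entry[OF J m, of p I] p by fastforce
    qed simp
    also have "\<dots> = (\<Sum>k\<in>{1..<jth J p}. of_nat (card (matching R I p k)) * lam k (jth J p))"
    proof (rule sum.cong[OF refl])
      fix k
      have "(\<Sum>K\<in>{K \<in> ?S. the (K p) = k}. lam (the (K p)) (jth J p)) =
          (\<Sum>K\<in>{K \<in> ?S. the (K p) = k}. lam k (jth J p))" by (rule sum.cong) auto
      then show "(\<Sum>K\<in>{K \<in> ?S. the (K p) = k}. lam (the (K p)) (jth J p)) =
          of_nat (card (matching R I p k)) * lam k (jth J p)" unfolding fibre by simp
    qed
    finally have "s * (\<Sum>K\<in>?S. lam (the (K p)) (jth J p)) =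
        (\<Sum>k\<in>{1..<jth J p}. s * (of_nat (card (matching R I p k)) * lam k (jth J p)))"
      by (simp only: sum_distrib_left)
    also have "\<dots> = h (jth J p)"
      unfolding h_def by (rule sum.cong) (auto simp: edge_coef_matching[OF R I p] s_def)
    finally show "h (jth J p) = s * (\<Sum>K\<in>?S. lam (the (K p)) (jth J p))" by (rule sym)
  qed
  finally show ?thesis
    unfolding s_def[symmetric] by (simp only: sum_distrib_left distrib_left)
qed

section \<open>The summands over \<open>l + 1\<close> and the projections onto them\<close>

definition star :: "nat \<Rightarrow> (nat \<Rightarrow> nat) set" where
  "star i = {f \<in> forests_on (insert (l + 1) J). f (l + 1) = i}"

lemma star_subset: "star i \<subseteq> forests"
  by (auto simp: star_def forests_on_def)

text \<open>Attaching \<open>l + 1\<close> to \<open>i\<close> and detaching it again are inverse to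
  each other; so \<open>star i\<close> indexes the basis of the summand
  \<open>a_{i,l+1} \<and> A_J\<close>.\<close>

lemma star_bij:
  assumes "1 \<le> i" "i \<le> l"
  shows "bij_betw (\<lambda>f. f(l + 1 := i)) (forests_on J) (star i)"
proof (rule bij_betw_byWitness[where f' = "\<lambda>f. f(l + 1 := 0)"])
  have gen: "(i, l + 1) \<in> gens" using assms ln by (simp add: gens_iff)
  have zero: "f (l + 1) = 0" if "f \<in> forests_on J" for f
    using that new by (auto simp: forests_on_def supp_def)
  show "\<forall>f\<in>forests_on J. (f(l + 1 := i))(l + 1 := 0) = f"
    using zero by (metis fun_upd_triv fun_upd_upd)
  show "\<forall>f\<in>star i. (f(l + 1 := 0))(l + 1 := i) = f"
    unfolding star_def by (metis (mono_tags, lifting) fun_upd_triv fun_upd_upd mem_Collect_eq)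
  show "(\<lambda>f. f(l + 1 := i)) ` forests_on J \<subseteq> star i"
    using forests_update[OF _ gen] assms
    by (auto simp: star_def forests_on_def supp_update simp del: fun_upd_apply) auto
  show "(\<lambda>f. f(l + 1 := 0)) ` star i \<subseteq> forests_on J"
  proof
    fix g assume "g \<in> (\<lambda>f. f(l + 1 := 0)) ` star i"
    then obtain f where f: "f \<in> forests" "supp f = insert (l + 1) J" and g: "g = f(l + 1 := 0)"
      by (auto simp: star_def forests_on_def)
    have "g \<in> forests" using f(1) by (simp add: g forests_def)
    moreover have "supp g = supp f - {l + 1}" by (auto simp: g supp_def)
    ultimately show "g \<in> forests_on J" using f(2) new by (simp add: forests_on_def)
  qed
qed

lemma new_edge:
  assumes "1 \<le> i" "f \<in> forests_on J"
  shows "ext_gen (i, l + 1) \<odot> forest_mono f = forest_mono (f(l + 1 := i))"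
proof -
  have f: "f \<in> forests" "supp f = J" using assms(2) by (auto simp: forests_on_def)
  have "f (l + 1) = 0" using f(2) new by (auto simp: supp_def)
  moreover have "{i \<in> supp f. i < l + 1} = {}" using f(2) J by auto
  then have "card {i \<in> supp f. i < l + 1} = 0" by (simp only: card.empty)
  ultimately show ?thesis
    using gen_times_new_edge[OF f(1), of "l + 1" i] assms(1) by (simp only: ext_scale_simps power_0)
qed

text \<open>Left multiplication by the generator of \<open>(i, l + 1)\<close> sends forest monomials
  on \<open>J\<close> to forest monomials on \<open>star i\<close> with coefficient
  \<open>1\<close>.\<close>

lemma summand_eq_span:
  assumes i: "1 \<le> i" "i \<le> l"
  shows "summand n l J i = os_span (star i)"
proof -
  have gen: "ext_gen (i, l + 1) \<in> carrier E" using i ln by (intro E_closed) (simp add: gens_iff)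
  have eq: "os_gen n l i (l + 1) \<otimes>\<^bsub>A\<^esub> cl (lin_comb (forests_on J) c) =
      cl (\<Sum>f\<in>forests_on J. c f \<bullet> forest_mono (f(l + 1 := i)))" for c
  proof -
    have "ext_gen (i, l + 1) \<odot> lin_comb (forests_on J) c =
        (\<Sum>f\<in>forests_on J. c f \<bullet> forest_mono (f(l + 1 := i)))"
      unfolding lin_comb_def ext_times_sum_right ext_times_distrib
      by (rule sum.cong[OF refl]) (simp only: new_edge[OF i(1)])
    then show ?thesis
      by (simp only: os_gen_def cl_simps(3)[OF gen lin_comb_closed[OF forests_on_subset]])
  qed
  show ?thesis
    unfolding summand_def A_J_eq_span[OF J']
  proof
    show "(\<lambda>\<eta>. os_gen n l i (l + 1) \<otimes>\<^bsub>A\<^esub> \<eta>) ` os_span (forests_on J) \<subseteq> os_span (star i)"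
    proof
      fix u assume "u \<in> (\<lambda>\<eta>. os_gen n l i (l + 1) \<otimes>\<^bsub>A\<^esub> \<eta>) ` os_span (forests_on J)"
      then obtain c where "u = os_gen n l i (l + 1) \<otimes>\<^bsub>A\<^esub> cl (lin_comb (forests_on J) c)"
        unfolding os_span_def by blast
      then show "u \<in> os_span (star i)"
        unfolding eq lin_comb_reindex[OF star_bij[OF i]] os_span_def by blast
    qed
    show "os_span (star i) \<subseteq> (\<lambda>\<eta>. os_gen n l i (l + 1) \<otimes>\<^bsub>A\<^esub> \<eta>) ` os_span (forests_on J)"
    proof
      fix u assume "u \<in> os_span (star i)"
      then obtain c where "u = cl (lin_comb (star i) c)" unfolding os_span_def by blast
      also have "lin_comb (star i) c = (\<Sum>f\<in>forests_on J. c (f(l + 1 := i)) \<bullet> forest_mono (f(l + 1 := i)))"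
        unfolding lin_comb_def by (rule sum.reindex_bij_betw[OF star_bij[OF i], symmetric])
      also have "cl \<dots> = os_gen n l i (l + 1) \<otimes>\<^bsub>A\<^esub> cl (lin_comb (forests_on J) (\<lambda>f. c (f(l + 1 := i))))"
        by (rule eq[symmetric])
      finally show "u \<in> (\<lambda>\<eta>. os_gen n l i (l + 1) \<otimes>\<^bsub>A\<^esub> \<eta>) ` os_span (forests_on J)"
        unfolding os_span_def by blast
    qed
  qed
qed

lemma extended_bij: "bij_betw extended (tuples J) (star m)"
proof -
  have "extended = (\<lambda>f. f(l + 1 := m)) \<circ> forest_of J" by (simp add: extended_def fun_eq_iff)
  then show ?thesis using bij_betw_trans[OF forest_of_bij[OF J'] star_bij[OF m]] by simp
qed

text \<open>Each projection deletes forests from the expansion: \<open>pi_B\<close> keeps those with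
  \<open>l + 1\<close> in the support, and \<open>pi_m\<close> those in which the parent of
  \<open>l + 1\<close> is \<open>m\<close>.\<close>

lemma pi_m_Psi_J:
  assumes I: "I \<in> tuples J"
  shows "pi_m n l J m (Psi_J n l J lam (os_mono n l I J)) =
    cl (lin_comb (star m) (\<lambda>f. coef f (omega_mono lam I)))"
proof -
  define f where "f = forest_of J I"
  define x where "x = omega_mono lam I"
  define q where "q = card J"
  define c where "c = (\<lambda>g. coef g x)"
  define X where "X = {g \<in> forests. card (supp g) = q + 1 \<and> l + 1 \<in> supp g}"
  define Y where "Y = {g \<in> forests. card (supp g) = q + 1 \<and> l + 1 \<notin> supp g}"
  define W where "W = forests_on (insert (l + 1) J)"
  have f: "f \<in> forests" "supp f = J"
    using forest_of_forest[OF J' I] supp_forest_of[OF finJ I] by (simp_all add: f_def)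
  have mono: "os_mono n l I J = cl (forest_mono f)" unfolding f_def by (rule os_mono_eq[OF J' I])
  have x: "os_omega n l lam \<otimes>\<^bsub>A\<^esub> cl (forest_mono f) = cl x" "x \<in> carrier E" "cl x \<in> os_span (extensions f)"
    using omega_times[OF f(1), of lam] by (simp_all add: x_def omega_mono_def f_def)
  have sub: "X \<subseteq> forests" "Y \<subseteq> forests" "X \<inter> Y = {}" "X \<union> Y \<subseteq> forests"
    by (auto simp: X_def Y_def)
  have ext: "extensions f \<subseteq> X \<union> Y"
  proof
    fix g assume "g \<in> extensions f"
    then obtain j where g: "g \<in> forests" "j \<notin> J" "supp g = insert j J"
      unfolding extensions_def f(2) by blast
    then have "card (supp g) = q + 1" using finJ by (simp add: q_def)
    then show "g \<in> X \<union> Y" using g(1) unfolding X_def Y_def by blast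
  qed
  have "cl (forest_mono f) \<in> os_span {g \<in> forests. card (supp g) = q \<and> l + 1 \<notin> supp g}"
    by (rule os_span_forest_mono) (use f new in \<open>auto simp: q_def\<close>)
  then have hat: "cl (forest_mono f) \<in> Ahat_deg n l q" by (simp only: Ahat_deg_eq)
  have AJ: "cl (forest_mono f) \<in> A_J n l J"
    unfolding A_J_eq_span[OF J'] by (rule os_span_forest_mono) (use f in \<open>auto simp: forests_on_def\<close>)
  have deg: "cl (forest_mono f) \<in> os_deg n l q" using os_deg_mono[OF f(1)] f(2) by (simp add: q_def)
  have "Psi_J n l J lam (os_mono n l I J) = pi_B n l (q + 1) (cl x)"
    using AJ hat deg x(1) by (simp add: mono Psi_J_def Psi_def os_mu_def flip: q_def)
  also have "cl x = cl (lin_comb (X \<union> Y) c)"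
    unfolding c_def by (rule cl_eq_lin_comb_coef[OF x(3) ext sub(4) x(2)])
  also have "pi_B n l (q + 1) (cl (lin_comb (X \<union> Y) c)) = cl (lin_comb X c)"
    unfolding pi_B_def B_deg_eq Ahat_deg_eq X_def[symmetric] Y_def[symmetric]
    by (rule proj_along_os_span[OF sub(1-3)])
  \<comment> \<open>The product reaches only forests with one label more than \<open>J\<close>. If
    \<open>l + 1\<close> is among their labels, the support is \<open>insert (l + 1) J\<close>; the
    other coefficients over \<open>X\<close> are \<open>0\<close>.\<close>
  also have "lin_comb X c = lin_comb W c"
  proof (rule lin_comb_extend[OF _ sub(1)])
    show "W \<subseteq> X" using finJ new by (auto simp: W_def X_def forests_on_def q_def)
    fix g assume g: "g \<in> X" "g \<notin> W"
    have "g \<notin> extensions f"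
    proof
      assume "g \<in> extensions f"
      then obtain j where "g \<in> forests" "supp g = insert j J" unfolding extensions_def f(2) by blast
      moreover have "l + 1 \<in> supp g" using g(1) by (simp add: X_def)
      ultimately show False using g(2) new by (auto simp: W_def forests_on_def)
    qed
    then show "c g = 0"
      unfolding c_def using g sub(1) by (intro coef_outside[OF x(2,3)]) (auto simp: extensions_def)
  qed
  \<comment> \<open>The parent of \<open>l + 1\<close> is nonzero and below \<open>l + 1\<close>, so
    \<open>W\<close> splits into the stars of \<open>1, ..., l\<close>.\<close>
  also have "W = star m \<union> (\<Union>i\<in>{1..l} - {m}. star i)"
  proof -
    have "0 < g (l + 1) \<and> g (l + 1) < l + 1" if "g \<in> W" for g
    proof -
      have "g \<in> forests" "l + 1 \<in> supp g" using that by (auto simp: W_def forests_on_def)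
      then show ?thesis by (auto simp: forests_def supp_def)
    qed
    then show ?thesis using m by (fastforce simp: star_def W_def)
  qed
  finally have Psi: "Psi_J n l J lam (os_mono n l I J) =
      cl (lin_comb (star m \<union> (\<Union>i\<in>{1..l} - {m}. star i)) c)" .
  have "subspace_sum A ({1..l} - {m}) (summand n l J) = os_span (\<Union>i\<in>{1..l} - {m}. star i)"
  proof (rule subspace_sum_os_span)
    show "star i \<inter> star j = {}" if "i \<noteq> j" for i j using that by (auto simp: star_def)
  qed (use star_subset summand_eq_span in auto)
  then have "pi_m n l J m = proj_along A (os_span (star m)) (os_span (\<Union>i\<in>{1..l} - {m}. star i))"
    unfolding pi_m_def summand_eq_span[OF m] by (rule arg_cong)
  moreover have "star m \<inter> (\<Union>i\<in>{1..l} - {m}. star i) = {}" by (auto simp: star_def)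
  ultimately have "pi_m n l J m (Psi_J n l J lam (os_mono n l I J)) = cl (lin_comb (star m) c)"
    using proj_along_os_span[OF star_subset, of "\<Union>i\<in>{1..l} - {m}. star i" m c] star_subset
    by (simp only: Psi) blast
  then show ?thesis by (simp only: c_def x_def)
qed

lemma expansion_eq:
  "(\<Oplus>\<^bsub>A\<^esub>R\<in>tuples J. os_smult n l (c R) (os_gen n l m (l + 1) \<otimes>\<^bsub>A\<^esub> os_mono n l R J)) =
    cl (lin_comb (star m) (\<lambda>f. c (inv_into (tuples J) extended f)))"
proof -
  have gen: "ext_gen (m, l + 1) \<in> carrier E" using m ln by (intro E_closed) (simp add: gens_iff)
  have summands: "os_smult n l (c R) (os_gen n l m (l + 1) \<otimes>\<^bsub>A\<^esub> os_mono n l R J) =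
      cl (c R \<bullet> forest_mono (extended R))" "forest_mono (extended R) \<in> carrier E"
    if R: "R \<in> tuples J" for R
  proof -
    have f: "forest_of J R \<in> forests" "forest_of J R \<in> forests_on J"
      using forest_of_forest[OF J' R] supp_forest_of[OF finJ R] by (simp_all add: forests_on_def)
    show closed: "forest_mono (extended R) \<in> carrier E"
      by (rule forest_mono_closed[OF extended_forest[OF R]])
    have "os_gen n l m (l + 1) \<otimes>\<^bsub>A\<^esub> os_mono n l R J = cl (forest_mono (extended R))"
      unfolding os_gen_def os_mono_eq[OF J' R] cl_simps(3)[OF gen forest_mono_closed[OF f(1)]]
        new_edge[OF m(1) f(2)] extended_def ..
    then show "os_smult n l (c R) (os_gen n l m (l + 1) \<otimes>\<^bsub>A\<^esub> os_mono n l R J) =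
        cl (c R \<bullet> forest_mono (extended R))"
      using closed by (simp only: cl_smult)
  qed
  have "(\<Oplus>\<^bsub>A\<^esub>R\<in>tuples J. os_smult n l (c R) (os_gen n l m (l + 1) \<otimes>\<^bsub>A\<^esub> os_mono n l R J)) =
      (\<Oplus>\<^bsub>A\<^esub>R\<in>tuples J. cl (c R \<bullet> forest_mono (extended R)))"
    by (rule A.finsum_cong') (use summands in \<open>auto simp: cl_simps E_closed\<close>)
  also have "\<dots> = cl (\<Sum>R\<in>tuples J. c R \<bullet> forest_mono (extended R))"
    using summands(2) by (intro cl_finsum finite_tuples E_closed)
  finally show ?thesis by (simp only: lin_comb_reindex[OF extended_bij])
qed

text \<open>Both sides are combinations of the forests in \<open>star m\<close>, so they agree
  exactly when the values of the dual functionals agree. One direction is independence, the other is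
  substitution.\<close>

lemma expansion_iff:
  assumes I: "I \<in> tuples J"
  shows "pi_m n l J m (Psi_J n l J lam (os_mono n l I J)) =
      (\<Oplus>\<^bsub>A\<^esub>R\<in>tuples J. os_smult n l (c R) (os_gen n l m (l + 1) \<otimes>\<^bsub>A\<^esub> os_mono n l R J)) \<longleftrightarrow>
    (\<forall>R\<in>tuples J. c R = coef (extended R) (omega_mono lam I))" (is "?L \<longleftrightarrow> ?R")
proof -
  let ?inv = "inv_into (tuples J) extended"
  have inv: "?inv (extended R) = R" if "R \<in> tuples J" for R
    using extended_bij that by (simp add: bij_betw_def inv_into_f_f)
  have mem: "extended R \<in> star m" if "R \<in> tuples J" for R
    using extended_bij that by (auto simp: bij_betw_def)
  show ?thesis
    unfolding pi_m_Psi_J[OF I] expansion_eq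
  proof
    assume eq: "cl (lin_comb (star m) (\<lambda>f. coef f (omega_mono lam I))) = cl (lin_comb (star m) (\<lambda>f. c (?inv f)))"
    show ?R
    proof
      fix R assume R: "R \<in> tuples J"
      have "coef (extended R) (lin_comb (star m) (\<lambda>f. coef f (omega_mono lam I))) =
          coef (extended R) (lin_comb (star m) (\<lambda>f. c (?inv f)))"
        by (rule coef_cong[OF extended_forest[OF R] _ _ eq]) (rule lin_comb_closed[OF star_subset])+
      then show "c R = coef (extended R) (omega_mono lam I)"
        using R by (simp add: coef_lin_comb[OF star_subset extended_forest] mem inv)
    qed
  next
    assume eq: ?R
    have "lin_comb (star m) (\<lambda>f. coef f (omega_mono lam I)) = lin_comb (star m) (\<lambda>f. c (?inv f))"
    proof (rule lin_comb_cong)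
      fix f assume "f \<in> star m"
      then obtain R where "R \<in> tuples J" "f = extended R" using extended_bij by (auto simp: bij_betw_def)
      then show "coef f (omega_mono lam I) = c (?inv f)" using eq inv by simp
    qed
    then show "cl (lin_comb (star m) (\<lambda>f. coef f (omega_mono lam I))) = cl (lin_comb (star m) (\<lambda>f. c (?inv f)))"
      by (simp only:)
  qed
qed

end

theorem theorem1p12:
  fixes n l m :: nat and J :: "nat set"
    and lam :: "nat \<Rightarrow> nat \<Rightarrow> complex"
    and Lam :: "(nat \<Rightarrow> nat) \<Rightarrow> (nat \<Rightarrow> nat) \<Rightarrow> complex"
  assumes "1 \<le> l" and "l < n" and "1 \<le> m" and "m \<le> l" and "J \<subseteq> {l + 2..n}"
  shows "(\<forall>I\<in>tuples J.
            pi_m n l J m (Psi_J n l J lam (os_mono n l I J)) =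
              (\<Oplus>\<^bsub>os_alg n l\<^esub>R\<in>tuples J.
                 os_smult n l (Lam R I) (os_gen n l m (l + 1) \<otimes>\<^bsub>os_alg n l\<^esub> os_mono n l R J)))
         \<longleftrightarrow>
         (\<forall>R\<in>tuples J. \<forall>I\<in>tuples J.
            Lam R I = (-1) ^ card (diff_positions J R I) *
              ((if R = I then 1 else 0) * lam m (l + 1) +
               (\<Sum>p = 1..card J.
                  \<Sum>K | admissible l m J I p K \<and> diff_subfamily J R I K. lam (the (K p)) (jth J p))))"
proof -
  interpret coefficients n l m J by unfold_locales (use assms in auto)
  show ?thesis
    using expansion_iff[of _ lam "\<lambda>R. Lam R _"] coef_omega_mono[of _ _ lam] by (simp cong: ball_cong) blast
qed

end
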